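(* Suppose Assumptions A1, A2, A3 of the context hold. Run the SLAM algorithm of the context with $N_k=k+1$ and $p_j=2^jl_0$, where $l_0\in\mathbb N\setminus\{0\}$. For $K\in\mathbb N\setminus\{0\}$ let $R_K$ be uniformly distributed on $\{0,\dots,K-1\}$, independently of the algorithm's randomness. Then the following hold. (i) For every $K\ge1$, $$\mathbb E\big[\|G_s(x_{R_K})\|^2\big]\le\frac{2(\phi(x_0)-\phi_{\inf})}{\alpha cK}+\frac{\left(\frac1L+6Ls^2+2\alpha c\right)\sigma^2(\ln(K)+1)}{\alpha cK}+\frac{6L(s-c)^2(L_r+3B_g)^2\left\lceil\left[\log_{1/\beta}\left(\frac{sL}{2(1-\alpha)}\right)\right]_++2\right\rceil\left\lceil\log_2\left(\frac{l_0+K}{l_0}\right)\right\rceil}{\alpha cK},$$ and the right-hand side is $\mathcal O\!\left(\frac{\Phi\ln(K)}{K}\right)$, where $$\Phi=c^{-1}(\phi(x_0)-\phi_{\inf})+(L^{-1}c^{-1}+6Ls^2c^{-1}+2)\sigma^2+6L(s-c)^2(L_r+B_g)^2c^{-1}\,[\ln(sL)]_+.$$ Consequently the iteration complexity $K_\epsilon$ and sample complexity $S_\epsilon$ satisfy $$K_\epsilon=\mathcal O\!\left(\ln\!\left(\frac{\Phi}{\epsilon^2}\right)\frac{\Phi}{\epsilon^2}\right),\qquad S_\epsilon=\mathcal O\!\left(\left(\ln\!\left(\frac{\Phi}{\epsilon^2}\right)\right)^2\frac{\Phi^2}{\epsilon^4}\right).$$ (ii) Suppose in addition that $s=\frac{2(1-\alpha)\beta\zeta}{L}$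 for some constant $\zeta\in(0,1]$. Then for every $K\ge1$, $$\mathbb E\big[\|G_s(x_{R_K})\|^2\big]\le\frac{L(\phi(x_0)-\phi_{\inf})}{(1-\alpha)\beta\zeta\alpha K}+\frac{\left(\frac1{2\alpha(1-\alpha)\beta\zeta}+\frac{12(1-\alpha)\beta\zeta}{\alpha}+2\right)\sigma^2(\ln(K)+1)}{K},$$ and the right-hand side is $\mathcal O\!\left(\frac{\Phi_2\ln(K)}{K}\right)$, where $\Phi_2=L(\phi(x_0)-\phi_{\inf})+\sigma^2$.
   Context: Notation. $\mathbb N$ is the set of nonnegative integers, $\|\cdot\|$ the Euclidean norm on $\mathbb R^n$, $[a]_+=\max\{a,0\}$, $\lceil\cdot\rceil$ the ceiling, $\mathrm{dom}(r)=\{x: r(x)<\infty\}$. Problem. Minimize $\phi(x)=f(x)+r(x)$ over $x\in\mathbb R^n$, where $f(x)=\mathbb E[F(x,\boldsymbol\xi)]$, $\boldsymbol\xi:\Omega\to\Xi\subseteq\mathbb R^d$ is a random variable on a probability space $(\Omega,\mathcal F,\mathbb P)$, and $F(\cdot,\xi)$ is real-valued for $\xi\in\Xi$. A1. (i) $r:\mathbb R^n\to(-\infty,\infty]$ is proper, closed, convex, and $L_r$-Lipschitz continuous on $\mathrm{dom}(r)$. (ii) $f$ is proper and closed, $\mathrm{dom}(f)$ is convex, $\mathrm{dom}(r)\subseteq\mathrm{int}(\mathrm{dom}(f))$, $f$ is continuously differentiable on $\mathrm{int}(\mathrm{dom}(f))$, and its gradient $g=\nabla f$ satisfies $\|g(x)\|\le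 B_g$ for all $x\in\mathrm{dom}(r)$, for some $B_g>0$. (iii) $\phi$ is bounded below on $\mathrm{dom}(r)$; $\phi_{\inf}=\inf\{\phi(x):x\in\mathrm{dom}(r)\}$. A2. For every $\xi\in\Xi$, $F(\cdot,\xi)$ is continuously differentiable on $\mathrm{int}(\mathrm{dom}(f))$ and $\nabla F(\cdot,\xi)$ (gradient in $x$) is Lipschitz continuous with constant $L>0$ (independent of $\xi$) on $\mathrm{dom}(r)$. A3. There is $\sigma>0$ such that for every $x\in\mathrm{dom}(r)$, $\mathbb E[F(x,\boldsymbol\xi)\mid x]=f(x)$, $\mathbb E[\nabla F(x,\boldsymbol\xi)\mid x]=g(x)$, $\mathbb E[\|\nabla F(x,\boldsymbol\xi)-g(x)\|^2\mid x]\le\sigma^2$ almost surely. Proximal operator and residual. For $t>0$, $\mathrm{prox}_{tr}(x)=\arg\min_y\{r(y)+\frac1{2t}\|y-x\|^2\}$ and $G_t(x)=\frac1t\big(x-\mathrm{prox}_{tr}(x-tg(x))\big)$. Algorithm SLAM. Inputs: $x_0\in\mathrm{dom}(r)$, $\alpha,\beta\in(0,1)$, $s\in(0,\infty)$, positive integers $p_0,p_1,\dots$ (cycle lengths) and $N_0,N_1,\dots$ (batch sizes). At iteration $k=0,1,2,\dots$: draw i.i.d. copies $\xi_{k,1},\dots,\xi_{k,N_k}$ of $\boldsymbol\xi$, independent of the past; set $\tilde f_k=\frac1{N_k}\sum_iF(\cdot,\xi_{k,i})$, $\tilde g_k=\frac1{N_k}\sum_i\nabla F(\cdot,\xi_{k,i})$,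 $\tilde\phi_k=\tilde f_k+r$, and $x_k(t)=\mathrm{prox}_{tr}(x_k-t\tilde g_k(x_k))$. Set $t_k^{\rm init}=s$ if $k\in\{0,p_0,p_0+p_1,p_0+p_1+p_2,\dots\}$ (start of a cycle) and $t_k^{\rm init}=t_{k-1}$ otherwise. Let $t_k=\beta^mt_k^{\rm init}$ with $m\in\mathbb N$ smallest such that $\tilde\phi_k(x_k(t_k))-\tilde\phi_k(x_k)\le-\frac{\alpha}{t_k}\|x_k-x_k(t_k)\|^2$. Set $x_{k+1}=x_k(t_k)$. Constant. $c=\min\{s,\frac{2(1-\alpha)\beta}{L}\}$. Complexities. For $\epsilon>0$, $K_\epsilon$ is the smallest number of iterations $K$ guaranteeing $\mathbb E[\|G_s(x_{R_K})\|]\le\epsilon$, and $S_\epsilon=\sum_{k=0}^{K_\epsilon-1}N_k$. Big-O. $\mathcal O(\cdot)$ is the usual order notation (as $K\to\infty$ or $\epsilon\to0$); the source does not specify which parameters the hidden multiplicative constants may depend on. *)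

theory Defs
  imports "HOL-Probability.Probability" "HOL-Library.Landau_Symbols"
begin

section \<open>Extended-real-valued functions\<close>

definition edom :: "('a \<Rightarrow> ereal) \<Rightarrow> 'a set" where
  "edom h = {x. h x < \<infinity>}"

definition proper_fun :: "('a \<Rightarrow> ereal) \<Rightarrow> bool" where
  "proper_fun h \<longleftrightarrow> (\<forall>x. h x \<noteq> -\<infinity>) \<and> edom h \<noteq> {}"

definition epi :: "('a \<Rightarrow> ereal) \<Rightarrow> ('a \<times> real) set" where
  "epi h = {(x, a). h x \<le> ereal a}"

definition closed_fun :: "('a::topological_space \<Rightarrow> ereal) \<Rightarrow> bool" where
  "closed_fun h \<longleftrightarrow> closed (epi h)"

definition convex_fun :: "('a::real_vector \<Rightarrow> ereal) \<Rightarrow> bool" where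
  "convex_fun h \<longleftrightarrow> convex (epi h)"

(* Only meaningful at points of differentiability. *)
definition grad :: "('a::real_inner \<Rightarrow> real) \<Rightarrow> 'a \<Rightarrow> 'a" where
  "grad h x = (THE d. GDERIV h x :> d)"

definition C1_on :: "('a::real_inner \<Rightarrow> real) \<Rightarrow> 'a set \<Rightarrow> bool" where
  "C1_on h U \<longleftrightarrow> (\<forall>x\<in>U. h differentiable (at x)) \<and> continuous_on U (grad h)"

definition prox :: "real \<Rightarrow> ('a::real_normed_vector \<Rightarrow> ereal) \<Rightarrow> 'a \<Rightarrow> 'a" where
  "prox t r x = arg_min (\<lambda>y. r y + ereal (1 / (2 * t) * (norm (y - x))\<^sup>2)) (\<lambda>_. True)"

definition prox_residual ::
    "('a::real_normed_vector \<Rightarrow> ereal) \<Rightarrow> ('a \<Rightarrow> 'a) \<Rightarrow> real \<Rightarrow> 'a \<Rightarrow> 'a" where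
  "prox_residual r g t x = (1 / t) *\<^sub>R (x - prox t r (x - t *\<^sub>R g x))"


section \<open>The stochastic composite problem\<close>

(* Expectation with values in the extended reals.  If both the positive and the negative part
   have infinite expectation, the value is \<infinity> - \<infinity> = \<infinity> (the usual convention in minimisation,
   which is also that of type ereal). *)
definition eexpectation :: "'w measure \<Rightarrow> ('w \<Rightarrow> real) \<Rightarrow> ereal" where
  "eexpectation M X =
     enn2ereal (\<integral>\<^sup>+ w. ennreal (X w) \<partial>M) - enn2ereal (\<integral>\<^sup>+ w. ennreal (- X w) \<partial>M)"

definition mean_fun :: "'w measure \<Rightarrow> ('w \<Rightarrow> 'd) \<Rightarrow> ('a \<Rightarrow> 'd \<Rightarrow> real) \<Rightarrow> 'a \<Rightarrow> ereal" where
  "mean_fun M \<xi> F x = eexpectation M (\<lambda>w. F x (\<xi> w))"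

(* On dom r both r and f are finite, so real_of_ereal loses nothing
   there; the same holds for f on the interior of its domain. *)
definition regular_problem ::
    "('a::euclidean_space \<Rightarrow> ereal) \<Rightarrow> real \<Rightarrow> ('a \<Rightarrow> ereal) \<Rightarrow> real \<Rightarrow> bool" where
  "regular_problem r L\<^sub>r f B\<^sub>g \<longleftrightarrow>
     proper_fun r \<and> closed_fun r \<and> convex_fun r \<and> L\<^sub>r-lipschitz_on (edom r) (\<lambda>x. real_of_ereal (r x)) \<and>
     proper_fun f \<and> closed_fun f \<and> convex (edom f) \<and> edom r \<subseteq> interior (edom f) \<and>
     C1_on (\<lambda>x. real_of_ereal (f x)) (interior (edom f)) \<and>
     0 < B\<^sub>g \<and> (\<forall>x\<in>edom r. norm (grad (\<lambda>y. real_of_ereal (f y)) x) \<le> B\<^sub>g) \<and>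
     (\<exists>b::real. \<forall>x\<in>edom r. ereal b \<le> f x + r x)"

definition smooth_samples ::
    "('a::euclidean_space \<Rightarrow> ereal) \<Rightarrow> ('a \<Rightarrow> ereal) \<Rightarrow> ('a \<Rightarrow> 'd \<Rightarrow> real) \<Rightarrow> 'd set \<Rightarrow> real \<Rightarrow> bool" where
  "smooth_samples r f F \<Xi> L \<longleftrightarrow>
     0 < L \<and>
     (\<forall>z\<in>\<Xi>. C1_on (\<lambda>x. F x z) (interior (edom f)) \<and> L-lipschitz_on (edom r) (grad (\<lambda>x. F x z)))"

(* The integrability clauses rule out the default value 0 of the Bochner integral. *)
definition unbiased_bounded_variance ::
    "('a::euclidean_space \<Rightarrow> ereal) \<Rightarrow> ('a \<Rightarrow> ereal) \<Rightarrow> ('a \<Rightarrow> 'd \<Rightarrow> real) \<Rightarrow> 'w measure \<Rightarrow> ('w \<Rightarrow> 'd)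
       \<Rightarrow> real \<Rightarrow> bool" where
  "unbiased_bounded_variance r f F M \<xi> \<sigma> \<longleftrightarrow>
     0 < \<sigma> \<and>
     (\<forall>x\<in>edom r.
        (let g = grad (\<lambda>y. real_of_ereal (f y)) x;
             G = (\<lambda>w. grad (\<lambda>y. F y (\<xi> w)) x)
         in integrable M (\<lambda>w. F x (\<xi> w)) \<and> ereal (\<integral>w. F x (\<xi> w) \<partial>M) = f x \<and>
            integrable M G \<and> (\<integral>w. G w \<partial>M) = g \<and>
            integrable M (\<lambda>w. (norm (G w - g))\<^sup>2) \<and> (\<integral>w. (norm (G w - g))\<^sup>2 \<partial>M) \<le> \<sigma>\<^sup>2))"


section \<open>The algorithm\<close>

text \<open>
  Everything below is a deterministic function of the sample array \<open>z\<close>, where \<open>z k i\<close>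
  (for \<open>i = 1, \<dots>, N k\<close>) is the \<open>i\<close>-th sample drawn at iteration \<open>k\<close>.
\<close>

definition batch_fun :: "('a \<Rightarrow> 'd \<Rightarrow> real) \<Rightarrow> (nat \<Rightarrow> nat) \<Rightarrow> (nat \<Rightarrow> nat \<Rightarrow> 'd) \<Rightarrow> nat \<Rightarrow> 'a \<Rightarrow> real" where
  "batch_fun F N z k y = (1 / real (N k)) * (\<Sum>i = 1..N k. F y (z k i))"

definition batch_grad ::
    "('a::real_inner \<Rightarrow> 'd \<Rightarrow> real) \<Rightarrow> (nat \<Rightarrow> nat) \<Rightarrow> (nat \<Rightarrow> nat \<Rightarrow> 'd) \<Rightarrow> nat \<Rightarrow> 'a \<Rightarrow> 'a" where
  "batch_grad F N z k y = (1 / real (N k)) *\<^sub>R (\<Sum>i = 1..N k. grad (\<lambda>u. F u (z k i)) y)"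

definition batch_obj ::
    "('a \<Rightarrow> ereal) \<Rightarrow> ('a \<Rightarrow> 'd \<Rightarrow> real) \<Rightarrow> (nat \<Rightarrow> nat) \<Rightarrow> (nat \<Rightarrow> nat \<Rightarrow> 'd) \<Rightarrow> nat \<Rightarrow> 'a \<Rightarrow> ereal" where
  "batch_obj r F N z k y = ereal (batch_fun F N z k y) + r y"

definition trial_point ::
    "('a::real_inner \<Rightarrow> ereal) \<Rightarrow> ('a \<Rightarrow> 'd \<Rightarrow> real) \<Rightarrow> (nat \<Rightarrow> nat) \<Rightarrow> (nat \<Rightarrow> nat \<Rightarrow> 'd)
       \<Rightarrow> nat \<Rightarrow> 'a \<Rightarrow> real \<Rightarrow> 'a" where
  "trial_point r F N z k x t = prox t r (x - t *\<^sub>R batch_grad F N z k x)"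

definition sufficient_decrease ::
    "('a::real_inner \<Rightarrow> ereal) \<Rightarrow> ('a \<Rightarrow> 'd \<Rightarrow> real) \<Rightarrow> (nat \<Rightarrow> nat) \<Rightarrow> real \<Rightarrow> (nat \<Rightarrow> nat \<Rightarrow> 'd)
       \<Rightarrow> nat \<Rightarrow> 'a \<Rightarrow> real \<Rightarrow> bool" where
  "sufficient_decrease r F N \<alpha> z k x t \<longleftrightarrow>
     batch_obj r F N z k (trial_point r F N z k x t) - batch_obj r F N z k x
       \<le> ereal (- (\<alpha> / t) * (norm (x - trial_point r F N z k x t))\<^sup>2)"

definition backtrack ::
    "('a::real_inner \<Rightarrow> ereal) \<Rightarrow> ('a \<Rightarrow> 'd \<Rightarrow> real) \<Rightarrow> (nat \<Rightarrow> nat) \<Rightarrow> real \<Rightarrow> real \<Rightarrow> (nat \<Rightarrow> nat \<Rightarrow> 'd)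
       \<Rightarrow> nat \<Rightarrow> 'a \<Rightarrow> real \<Rightarrow> real" where
  "backtrack r F N \<alpha> \<beta> z k x t_init =
     \<beta> ^ (LEAST m. sufficient_decrease r F N \<alpha> z k x (\<beta> ^ m * t_init)) * t_init"

definition cycle_start :: "(nat \<Rightarrow> nat) \<Rightarrow> nat \<Rightarrow> bool" where
  "cycle_start p k \<longleftrightarrow> (\<exists>j. k = (\<Sum>i<j. p i))"

(* The state before iteration k is the pair of x_k and t_(k-1).  The second component of the
   initial state is never read, since iteration 0 starts a cycle. *)
primrec slam_state ::
    "('a::real_inner \<Rightarrow> ereal) \<Rightarrow> ('a \<Rightarrow> 'd \<Rightarrow> real) \<Rightarrow> (nat \<Rightarrow> nat) \<Rightarrow> (nat \<Rightarrow> nat) \<Rightarrow> real \<Rightarrow> real \<Rightarrow> real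
       \<Rightarrow> 'a \<Rightarrow> (nat \<Rightarrow> nat \<Rightarrow> 'd) \<Rightarrow> nat \<Rightarrow> 'a \<times> real" where
  "slam_state r F N p \<alpha> \<beta> s x0 z 0 = (x0, s)"
| "slam_state r F N p \<alpha> \<beta> s x0 z (Suc k) =
     (let (x, t_prev) = slam_state r F N p \<alpha> \<beta> s x0 z k;
          t_init = (if cycle_start p k then s else t_prev);
          t = backtrack r F N \<alpha> \<beta> z k x t_init
      in (trial_point r F N z k x t, t))"

definition slam ::
    "('a::real_inner \<Rightarrow> ereal) \<Rightarrow> ('a \<Rightarrow> 'd \<Rightarrow> real) \<Rightarrow> (nat \<Rightarrow> nat) \<Rightarrow> (nat \<Rightarrow> nat) \<Rightarrow> real \<Rightarrow> real \<Rightarrow> real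
       \<Rightarrow> 'a \<Rightarrow> (nat \<Rightarrow> nat \<Rightarrow> 'd) \<Rightarrow> nat \<Rightarrow> 'a" where
  "slam r F N p \<alpha> \<beta> s x0 z k = fst (slam_state r F N p \<alpha> \<beta> s x0 z k)"


section \<open>Sampling and complexities\<close>

definition sample_index :: "(nat \<Rightarrow> nat) \<Rightarrow> (nat \<times> nat) set" where
  "sample_index N = (SIGMA k:UNIV. {1..N k})"

(* X k i are i.i.d. copies of \<xi>.  They may live on another probability space P than \<xi>, and all
   of them are jointly independent, which covers independence of a batch from the past. *)
definition iid_copies ::
    "'w measure \<Rightarrow> ('w \<Rightarrow> 'd) \<Rightarrow> 'd measure \<Rightarrow> (nat \<Rightarrow> nat) \<Rightarrow> 'p measure \<Rightarrow> (nat \<Rightarrow> nat \<Rightarrow> 'p \<Rightarrow> 'd) \<Rightarrow> bool" where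
  "iid_copies M \<xi> S N P X \<longleftrightarrow>
     prob_space.indep_vars P (\<lambda>_. S) (\<lambda>(k, i). X k i) (sample_index N) \<and>
     (\<forall>(k, i)\<in>sample_index N. distr P S (X k i) = distr M S \<xi>)"

(* R is uniform on {0..<K} and independent of the sigma-algebra generated by all the samples. *)
definition uniform_index ::
    "'d measure \<Rightarrow> (nat \<Rightarrow> nat) \<Rightarrow> 'p measure \<Rightarrow> (nat \<Rightarrow> nat \<Rightarrow> 'p \<Rightarrow> 'd) \<Rightarrow> nat \<Rightarrow> ('p \<Rightarrow> nat) \<Rightarrow> bool" where
  "uniform_index S N P X K R \<longleftrightarrow>
     distr P (count_space UNIV) R = measure_pmf (pmf_of_set {0..<K}) \<and>
     prob_space.indep_set P
       (sets (vimage_algebra (space P) R (count_space UNIV)))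
       (sets (vimage_algebra (space P) (\<lambda>w. restrict (\<lambda>(k, i). X k i w) (sample_index N))
                (Pi\<^sub>M (sample_index N) (\<lambda>_. S))))"

(* e K is the expected size of the residual at the output of a run with K iterations. *)
definition iteration_complexity :: "(nat \<Rightarrow> real) \<Rightarrow> real \<Rightarrow> nat" where
  "iteration_complexity e \<epsilon> = (LEAST K. 1 \<le> K \<and> e K \<le> \<epsilon>)"

definition sample_complexity :: "(nat \<Rightarrow> nat) \<Rightarrow> (nat \<Rightarrow> real) \<Rightarrow> real \<Rightarrow> nat" where
  "sample_complexity N e \<epsilon> = (\<Sum>k<iteration_complexity e \<epsilon>. N k)"

end

theory Submission
  imports Defs "HOL-Real_Asymp.Real_Asymp"
begin

text \<open>
  The line search enforces decrease of the sampled objective, whereas the claim concerns the true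
  one, and the next iterate depends on the batch that defines the sampled objective. The proof
  compares the next iterate with a reference point: the proximal gradient point for the exact
  gradient and the initial step size of the line search. Both data are fixed before the batch is
  drawn, so the value error of the batch has mean zero there and at the current iterate. The error
  at the next iterate exceeds the one at the reference point by at most the squared gradient error
  at the reference point, divided by \<open>2 L\<close>, plus \<open>3 L / 2\<close> times the squared distance of the two
  points. The proximal step
  is Lipschitz continuous in the direction and in the step size (\<open>step_diff_direction\<close>,
  \<open>step_diff_stepsize\<close>), so this distance is bounded by \<open>s\<close> times the gradient error at the
  current iterate and, if the line search reduces the step size, by another \<open>(s - c) (L\<^sub>r + B\<^sub>g)\<close>.
  The decrease itself is at least \<open>\<alpha> c\<close> times the squared residual of the sampled problem, because
  the residual does not increase with the step size (\<open>step_residual_antimono\<close>) and all step sizes lie between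
  \<open>c\<close> and \<open>s\<close>. This is \<open>one_iteration\<close>.

  Summing over the iterations telescopes the objective. In expectation the squared gradient
  errors contribute multiples of \<open>\<sigma>\<^sup>2 / (k + 1)\<close>, hence the harmonic sum and the factor \<open>ln K + 1\<close>. The iterations that
  reduce the step size are counted path by path: each cycle has a bounded number of them
  (\<open>card_reductions_le\<close>), since short steps are always accepted, and doubling cycle lengths allow
  only logarithmically many cycles (\<open>card_doubling_cycle_starts_le\<close>). A uniformly distributed
  index that is independent of the samples turns the average over the iterations into the
  expectation at the output.

  The probabilistic part needs that the iterates are random variables. They are: the sampled
  functions are continuous in the point and measurable in the sample, and the step sizes take
  countably many values (\<open>measurable_state\<close>). The iterates are functions of the past samples only,
  so that Fubini's theorem for the product of the law of the past and the law of a new sample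
  replaces conditional expectations.

  For the complexities, all terms of the bound are at most a multiple of \<open>(ln K + 1) / K\<close>, and
  Jensen's inequality passes from the mean square to the mean. With \<open>u = \<Phi> / \<epsilon>\<^sup>2\<close> a multiple of
  \<open>u ln u\<close> iterations then suffices. The second part is the case \<open>c = s\<close>, in which the term for the
  step size reductions vanishes.
\<close>

section \<open>Gradients and the descent lemma\<close>

lemma GDERIV_unique:
  assumes "GDERIV h x :> d" and "GDERIV h x :> e"
  shows "d = e"
proof -
  have "(\<lambda>v. v \<bullet> d) = (\<lambda>v. v \<bullet> e)"
    using assms unfolding gderiv_def by (rule has_derivative_unique)
  then have "v \<bullet> d = v \<bullet> e" for v
    by (rule fun_cong)
  then have "(d - e) \<bullet> (d - e) = 0"
    by (simp add: inner_diff_right)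
  then show ?thesis
    by simp
qed

lemma GDERIV_grad:
  fixes h :: "'a::euclidean_space \<Rightarrow> real"
  assumes "h differentiable (at x)"
  shows "GDERIV h x :> grad h x"
proof -
  obtain h' where h': "(h has_derivative h') (at x)"
    using assms by (auto simp: differentiable_def)
  then have "linear h'"
    by (rule has_derivative_linear)
  define a where "a = adjoint h' 1"
  have "h' = (\<lambda>v. v \<bullet> a)"
    using adjoint_works[OF \<open>linear h'\<close>, of _ 1] by (auto simp: a_def)
  then have "GDERIV h x :> a"
    using h' by (simp add: gderiv_def)
  then show ?thesis
    unfolding grad_def using GDERIV_unique by (metis theI)
qed

lemma has_real_derivative_along_line:
  assumes "GDERIV h (x + \<tau> *\<^sub>R v) :> d"
  shows "((\<lambda>\<tau>. h (x + \<tau> *\<^sub>R v)) has_real_derivative (v \<bullet> d)) (at \<tau>)"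
proof -
  have "((\<lambda>\<tau>. x + \<tau> *\<^sub>R v) has_derivative (\<lambda>\<tau>. \<tau> *\<^sub>R v)) (at \<tau>)"
    by (auto intro!: derivative_eq_intros)
  from has_derivative_compose[OF this, of h "\<lambda>u. u \<bullet> d"] assms
  have "((\<lambda>\<tau>. h (x + \<tau> *\<^sub>R v)) has_derivative (\<lambda>a. (a *\<^sub>R v) \<bullet> d)) (at \<tau>)"
    by (simp add: gderiv_def)
  moreover have "(\<lambda>a. (a *\<^sub>R v) \<bullet> d) = (*) (v \<bullet> d)"
    by (simp add: fun_eq_iff)
  ultimately show ?thesis
    by (simp add: has_field_derivative_def)
qed

text \<open>
  Along the segment between the points, which stays in the convex set \<open>C\<close>, the Lipschitz condition
  bounds the growth of the derivative, so that the difference of the two sides is monotone.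
\<close>

lemma descent_lemma:
  assumes "convex C" and G: "\<And>u. u \<in> C \<Longrightarrow> GDERIV h u :> G u" and lip: "L-lipschitz_on C G"
    and x: "x \<in> C" and y: "y \<in> C"
  shows "h y \<le> h x + (y - x) \<bullet> G x + L / 2 * (norm (y - x))\<^sup>2"
proof -
  define v where "v = y - x"
  define \<psi> where "\<psi> \<tau> = h (x + \<tau> *\<^sub>R v) - \<tau> * (v \<bullet> G x) - L / 2 * \<tau>\<^sup>2 * (norm v)\<^sup>2" for \<tau>
  have "\<psi> 1 \<le> \<psi> 0"
  proof (rule DERIV_nonpos_imp_nonincreasing[of 0 1 \<psi>])
    fix \<tau> :: real assume \<tau>: "0 \<le> \<tau>" "\<tau> \<le> 1"
    have "x + \<tau> *\<^sub>R v = (1 - \<tau>) *\<^sub>R x + \<tau> *\<^sub>R y"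
      by (simp add: v_def algebra_simps)
    then have C: "x + \<tau> *\<^sub>R v \<in> C"
      using \<tau> x y convexD_alt[OF \<open>convex C\<close>] by simp
    have "(\<psi> has_real_derivative (v \<bullet> G (x + \<tau> *\<^sub>R v) - v \<bullet> G x - L * \<tau> * (norm v)\<^sup>2)) (at \<tau>)"
      unfolding \<psi>_def
      by (auto intro!: derivative_eq_intros has_real_derivative_along_line G C)
    moreover have "v \<bullet> G (x + \<tau> *\<^sub>R v) - v \<bullet> G x \<le> L * \<tau> * (norm v)\<^sup>2"
    proof -
      have "v \<bullet> (G (x + \<tau> *\<^sub>R v) - G x) \<le> norm v * norm (G (x + \<tau> *\<^sub>R v) - G x)"
        by (rule norm_cauchy_schwarz)
      also have "\<dots> \<le> norm v * (L * norm (\<tau> *\<^sub>R v))"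
        using lipschitz_onD[OF lip C x] by (intro mult_left_mono) (auto simp: dist_norm)
      finally show ?thesis
        using \<tau> by (simp add: inner_diff_right power2_eq_square algebra_simps)
    qed
    ultimately show "\<exists>y. DERIV \<psi> \<tau> :> y \<and> y \<le> 0"
      by force
  qed simp
  then show ?thesis
    by (simp add: \<psi>_def v_def)
qed


section \<open>The proximal operator of a Lipschitz convex function\<close>

locale convex_regularizer =
  fixes r :: "'a::euclidean_space \<Rightarrow> ereal" and L\<^sub>r :: real
  assumes proper: "proper_fun r" and closed_r: "closed_fun r" and convex_r: "convex_fun r"
    and lipschitz: "L\<^sub>r-lipschitz_on (edom r) (\<lambda>x. real_of_ereal (r x))"
begin

abbreviation \<rho> :: "'a \<Rightarrow> real" where
  "\<rho> x \<equiv> real_of_ereal (r x)"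

lemma L\<^sub>r_nonneg: "0 \<le> L\<^sub>r"
  using lipschitz by (rule lipschitz_on_nonneg)

lemma edom_nonempty: "edom r \<noteq> {}"
  using proper by (simp add: proper_fun_def)

lemma r_eq: "x \<in> edom r \<Longrightarrow> r x = ereal (\<rho> x)"
  using proper by (cases "r x") (auto simp: proper_fun_def edom_def)

lemma edom_le: "x \<in> edom r \<Longrightarrow> r x \<le> ereal (\<rho> x)"
  by (metis r_eq order_refl)

lemma r_eq_infty: "x \<notin> edom r \<Longrightarrow> r x = \<infinity>"
  by (simp add: edom_def)

lemma r_le_imp_edom: "r x \<le> ereal a \<Longrightarrow> x \<in> edom r"
  by (auto simp: edom_def)

lemma lipschitz_le:
  assumes "x \<in> edom r" "y \<in> edom r"
  shows "\<bar>\<rho> x - \<rho> y\<bar> \<le> L\<^sub>r * norm (x - y)"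
  using lipschitz_onD[OF lipschitz assms] by (simp add: dist_norm)

text \<open>
  The Lipschitz bound keeps the values of \<open>r\<close> finite along a convergent sequence in the domain, so
  that the limit of the graph points lies in the closed epigraph.
\<close>

lemma closed_edom: "closed (edom r)"
  unfolding closed_sequential_limits
proof safe
  fix u l assume u: "\<forall>n. u n \<in> edom r" and l: "u \<longlonglongrightarrow> l"
  have "Cauchy (\<lambda>n. \<rho> (u n))"
    using uniformly_continuous_imp_Cauchy_continuous[OF lipschitz_on_uniformly_continuous[OF lipschitz]]
      LIMSEQ_imp_Cauchy[OF l] u by (auto simp: Cauchy_continuous_on_def o_def)
  then obtain a where a: "(\<lambda>n. \<rho> (u n)) \<longlonglongrightarrow> a"
    using Cauchy_convergent convergent_def by blast
  have "(l, a) \<in> epi r"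
    using closed_r unfolding closed_fun_def
  proof (rule closed_sequentially)
    show "(u n, \<rho> (u n)) \<in> epi r" for n
      using u edom_le by (simp add: epi_def)
    show "(\<lambda>n. (u n, \<rho> (u n))) \<longlonglongrightarrow> (l, a)"
      by (intro tendsto_Pair l a)
  qed
  then show "l \<in> edom r"
    by (auto simp: epi_def intro: r_le_imp_edom)
qed

lemma convex_combination:
  assumes x: "x \<in> edom r" and y: "y \<in> edom r" and \<theta>: "0 \<le> \<theta>" "\<theta> \<le> 1"
  shows "(1 - \<theta>) *\<^sub>R x + \<theta> *\<^sub>R y \<in> edom r"
    and "\<rho> ((1 - \<theta>) *\<^sub>R x + \<theta> *\<^sub>R y) \<le> (1 - \<theta>) * \<rho> x + \<theta> * \<rho> y"
proof -
  have "(1 - \<theta>) *\<^sub>R (x, \<rho> x) + \<theta> *\<^sub>R (y, \<rho> y) \<in> epi r"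
    using convex_r \<theta> unfolding convex_fun_def
    by (intro convexD_alt) (auto simp: epi_def edom_le x y)
  then have *: "r ((1 - \<theta>) *\<^sub>R x + \<theta> *\<^sub>R y) \<le> ereal ((1 - \<theta>) * \<rho> x + \<theta> * \<rho> y)"
    by (simp add: epi_def)
  then show "(1 - \<theta>) *\<^sub>R x + \<theta> *\<^sub>R y \<in> edom r"
    by (rule r_le_imp_edom)
  then show "\<rho> ((1 - \<theta>) *\<^sub>R x + \<theta> *\<^sub>R y) \<le> (1 - \<theta>) * \<rho> x + \<theta> * \<rho> y"
    using * r_eq by (metis ereal_less_eq(3))
qed

lemma convex_edom: "convex (edom r)"
  using convex_combination(1) by (auto simp: convex_alt)

text \<open>
  A minimizer exists because the Lipschitz bound makes the quadratic term dominate: outside a large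
  ball around \<open>v\<close> the objective exceeds its value at any chosen point of the domain.
\<close>

lemma prox_minimizer:
  assumes t: "0 < t"
  shows "prox t r v \<in> edom r"
    and "y \<in> edom r \<Longrightarrow> \<rho> (prox t r v) + 1 / (2 * t) * (norm (prox t r v - v))\<^sup>2
                        \<le> \<rho> y + 1 / (2 * t) * (norm (y - v))\<^sup>2"
proof -
  define q where "q y = \<rho> y + 1 / (2 * t) * (norm (y - v))\<^sup>2" for y
  define Q where "Q y = r y + ereal (1 / (2 * t) * (norm (y - v))\<^sup>2)" for y
  have Q: "Q y = (if y \<in> edom r then ereal (q y) else \<infinity>)" for y
    unfolding Q_def q_def using r_eq[of y] r_eq_infty[of y]
    by (metis plus_ereal.simps(1,2))
  obtain a where a: "a \<in> edom r"
    using edom_nonempty by blast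
  define b where "b = norm (a - v)"
  define B where "B = edom r \<inter> cball v (b + 2 * t * L\<^sub>r)"
  have "compact B"
    unfolding B_def by (intro closed_Int_compact closed_edom compact_cball)
  moreover have aB: "a \<in> B"
    using a t L\<^sub>r_nonneg by (simp add: B_def b_def dist_norm norm_minus_commute)
  moreover have "continuous_on B q"
    unfolding q_def
    by (intro continuous_intros continuous_on_subset[OF lipschitz_on_continuous_on[OF lipschitz]])
       (auto simp: B_def)
  ultimately obtain m where m: "m \<in> B" "\<And>y. y \<in> B \<Longrightarrow> q m \<le> q y"
    using continuous_attains_inf[of B q] by blast
  have "q m \<le> q y" if y: "y \<in> edom r" for y
  proof (cases "y \<in> B")
    case False
    define d where "d = norm (y - v)"
    have d: "d > b + 2 * t * L\<^sub>r"
      using False y by (simp add: B_def d_def dist_norm norm_minus_commute)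
    have b: "0 \<le> b" and tL: "0 \<le> t * L\<^sub>r"
      using t L\<^sub>r_nonneg by (simp_all add: b_def)
    have "norm (a - y) \<le> b + d"
      unfolding b_def d_def using norm_triangle_ineq4[of "a - v" "y - v"] by simp
    then have "\<rho> a - \<rho> y \<le> L\<^sub>r * (b + d)"
      using lipschitz_le[OF a y] L\<^sub>r_nonneg by (smt (verit) mult_left_mono)
    also have "\<dots> = (b + d) * (2 * t * L\<^sub>r) / (2 * t)"
      using t by simp
    also have "\<dots> \<le> (b + d) * (d - b) / (2 * t)"
      using d b tL t by (intro divide_right_mono mult_left_mono) auto
    also have "\<dots> = 1 / (2 * t) * d\<^sup>2 - 1 / (2 * t) * b\<^sup>2"
      using t by (simp add: field_simps power2_eq_square)
    finally have "q a \<le> q y"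
      by (simp add: q_def b_def d_def)
    then show ?thesis
      using m(2)[OF aB] by simp
  qed (use m in auto)
  then have "is_arg_min Q (\<lambda>_. True) m"
    using m(1) by (auto simp: is_arg_min_def Q B_def not_less)
  then have "is_arg_min Q (\<lambda>_. True) (prox t r v)"
    unfolding prox_def arg_min_def Q_def by (rule someI)
  then have min: "Q (prox t r v) \<le> Q y" for y
    by (auto simp: is_arg_min_def not_less)
  show *: "prox t r v \<in> edom r"
    using min[of a] a by (auto simp: Q split: if_splits)
  show "\<rho> (prox t r v) + 1 / (2 * t) * (norm (prox t r v - v))\<^sup>2
      \<le> \<rho> y + 1 / (2 * t) * (norm (y - v))\<^sup>2" if "y \<in> edom r"
    using min[of y] that * by (simp add: Q q_def)
qed

text \<open>
  The optimality condition: the scaled displacement is a subgradient at the proximal point. All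
  later estimates for the proximal operator rest on it. It follows by comparing the minimizer with
  points of the segment towards \<open>y\<close> that approach it.
\<close>

lemma prox_subgradient:
  assumes t: "0 < t" and y: "y \<in> edom r"
  shows "\<rho> (prox t r v) + ((1 / t) *\<^sub>R (v - prox t r v)) \<bullet> (y - prox t r v) \<le> \<rho> y"
proof -
  define p where "p = prox t r v"
  have p: "p \<in> edom r"
    using prox_minimizer(1)[OF t] by (simp add: p_def)
  have *: "\<rho> p + (1 / t) * ((v - p) \<bullet> (y - p)) - \<rho> y \<le> \<theta> * (1 / (2 * t) * (norm (y - p))\<^sup>2)"
    if \<theta>: "0 < \<theta>" "\<theta> < 1" for \<theta>
  proof -
    let ?u = "(1 - \<theta>) *\<^sub>R p + \<theta> *\<^sub>R y"
    have "?u - v = (p - v) + \<theta> *\<^sub>R (y - p)"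
      by (simp add: algebra_simps)
    then have n: "(norm (?u - v))\<^sup>2
        = (norm (p - v))\<^sup>2 + 2 * \<theta> * ((p - v) \<bullet> (y - p)) + \<theta>\<^sup>2 * (norm (y - p))\<^sup>2"
      by (simp only: power2_norm_eq_inner inner_add_left inner_add_right inner_scaleR_left
          inner_scaleR_right inner_commute[of "y - p" "p - v"]) (simp add: power2_eq_square algebra_simps)
    have "\<rho> p + 1 / (2 * t) * (norm (p - v))\<^sup>2 \<le> \<rho> ?u + 1 / (2 * t) * (norm (?u - v))\<^sup>2"
      using prox_minimizer(2)[OF t convex_combination(1)[OF p y]] \<theta> by (simp add: p_def)
    also have "\<dots> \<le> ((1 - \<theta>) * \<rho> p + \<theta> * \<rho> y) + 1 / (2 * t) * (norm (?u - v))\<^sup>2"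
      using convex_combination(2)[OF p y] \<theta> by simp
    finally have "\<theta> * (\<rho> p - \<rho> y)
        \<le> \<theta> * ((1 / t) * ((p - v) \<bullet> (y - p)) + \<theta> * (1 / (2 * t) * (norm (y - p))\<^sup>2))"
      unfolding n by (simp add: algebra_simps power2_eq_square add_divide_distrib)
    then have "\<rho> p - \<rho> y \<le> (1 / t) * ((p - v) \<bullet> (y - p)) + \<theta> * (1 / (2 * t) * (norm (y - p))\<^sup>2)"
      using \<theta> by (simp only: mult_le_cancel_left_pos)
    moreover have "(1 / t) * ((p - v) \<bullet> (y - p)) = - ((1 / t) * ((v - p) \<bullet> (y - p)))"
      by (simp add: inner_diff_left diff_divide_distrib)
    ultimately show ?thesis
      by linarith
  qed
  have "\<rho> p + (1 / t) * ((v - p) \<bullet> (y - p)) - \<rho> y \<le> 0"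
  proof (rule tendsto_lowerbound)
    show "((\<lambda>\<theta>. \<theta> * (1 / (2 * t) * (norm (y - p))\<^sup>2)) \<longlongrightarrow> 0) (at_right 0)"
      by (rule tendsto_eq_intros refl tendsto_mult_left_zero | simp)+
    show "\<forall>\<^sub>F \<theta> in at_right 0. \<rho> p + (1 / t) * ((v - p) \<bullet> (y - p)) - \<rho> y
        \<le> \<theta> * (1 / (2 * t) * (norm (y - p))\<^sup>2)"
      using eventually_at_right_real[OF zero_less_one] by eventually_elim (use * in auto)
  qed simp
  then show ?thesis
    by (simp add: p_def)
qed

text \<open>Adding the two subgradient inequalities yields firm nonexpansiveness.\<close>

lemma prox_nonexpansive:
  assumes t: "0 < t"
  shows "norm (prox t r v - prox t r w) \<le> norm (v - w)"
proof -
  define p q where "p = prox t r v" and "q = prox t r w"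
  have "((1 / t) *\<^sub>R (v - p)) \<bullet> (q - p) + ((1 / t) *\<^sub>R (w - q)) \<bullet> (p - q) \<le> 0"
    using prox_subgradient[OF t, of q v] prox_subgradient[OF t, of p w] prox_minimizer(1)[OF t]
    by (simp add: p_def q_def)
  then have "(1 / t) * ((v - p) \<bullet> (q - p) + (w - q) \<bullet> (p - q)) \<le> 0"
    by (simp add: distrib_left)
  then have "(v - p) \<bullet> (q - p) + (w - q) \<bullet> (p - q) \<le> 0"
    using t by (simp add: divide_le_0_iff)
  then have "(norm (p - q))\<^sup>2 \<le> (v - w) \<bullet> (p - q)"
    by (simp add: power2_norm_eq_inner inner_diff_left inner_diff_right inner_commute)
  also have "\<dots> \<le> norm (v - w) * norm (p - q)"
    by (rule norm_cauchy_schwarz)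
  finally have "norm (p - q) * norm (p - q) \<le> norm (v - w) * norm (p - q)"
    by (simp add: power2_eq_square)
  then show ?thesis
    using mult_right_le_imp_le[of "norm (p - q)" "norm (p - q)" "norm (v - w)"]
    by (cases "p = q") (auto simp: p_def q_def)
qed

text \<open>A proximal gradient step from \<open>x\<close> with step size \<open>t\<close>, where \<open>d\<close> is the gradient or an estimate of it.\<close>

definition step :: "'a \<Rightarrow> 'a \<Rightarrow> real \<Rightarrow> 'a" where
  "step d x t = prox t r (x - t *\<^sub>R d)"

lemma step_in_edom: "0 < t \<Longrightarrow> step d x t \<in> edom r"
  by (simp add: step_def prox_minimizer(1))

lemma step_subgradient:
  assumes "0 < t" "y \<in> edom r"
  shows "\<rho> (step d x t) + ((1 / t) *\<^sub>R (x - step d x t) - d) \<bullet> (y - step d x t) \<le> \<rho> y"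
proof -
  have "(1 / t) *\<^sub>R (x - t *\<^sub>R d - step d x t) = (1 / t) *\<^sub>R (x - step d x t) - d"
    using assms by (simp add: algebra_simps)
  then show ?thesis
    using prox_subgradient[OF assms, of "x - t *\<^sub>R d"] by (simp add: step_def)
qed

lemma step_decrease:
  assumes t: "0 < t" and x: "x \<in> edom r"
  shows "\<rho> (step d x t) + d \<bullet> (step d x t - x) \<le> \<rho> x - (1 / t) * (norm (x - step d x t))\<^sup>2"
  using step_subgradient[OF t x, of d x]
  unfolding inner_diff_left[of "(1 / t) *\<^sub>R (x - step d x t)"]
  by (simp only: inner_scaleR_left power2_norm_eq_inner inner_diff_right)
    (simp add: inner_diff_left inner_diff_right inner_commute algebra_simps)

text \<open>
  A step from a point of the domain cannot be long: the decrease of \<open>\<rho>\<close> is at most linear in its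
  length, with slope \<open>L\<^sub>r\<close>, while \<open>step_decrease\<close> demands a quadratic one.
\<close>

lemma step_length_le:
  assumes t: "0 < t" and x: "x \<in> edom r"
  shows "norm (x - step d x t) \<le> t * (L\<^sub>r + norm d)"
proof -
  define n where "n = norm (x - step d x t)"
  have "(1 / t) * n\<^sup>2 \<le> \<rho> x - \<rho> (step d x t) + d \<bullet> (x - step d x t)"
    using step_decrease[OF assms, of d] unfolding n_def inner_diff_right by linarith
  also have "\<dots> \<le> L\<^sub>r * n + norm d * n"
    using lipschitz_le[OF x step_in_edom[OF t]] norm_cauchy_schwarz[of d "x - step d x t"]
    unfolding n_def by (smt (verit))
  finally have "n * n \<le> t * (L\<^sub>r + norm d) * n"
    using t by (simp add: field_simps power2_eq_square)
  then show ?thesis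
    using mult_right_le_imp_le[of n n] t L\<^sub>r_nonneg unfolding n_def[symmetric]
    by (cases "n = 0") (auto simp: n_def)
qed

lemma step_diff_direction:
  assumes "0 < t"
  shows "norm (step d x t - step e x t) \<le> t * norm (d - e)"
proof -
  have "norm (step d x t - step e x t) \<le> norm ((x - t *\<^sub>R d) - (x - t *\<^sub>R e))"
    unfolding step_def by (rule prox_nonexpansive[OF assms])
  also have "(x - t *\<^sub>R d) - (x - t *\<^sub>R e) = - (t *\<^sub>R (d - e))"
    by (simp add: algebra_simps)
  finally show ?thesis
    using assms by simp
qed

lemma step_monotone:
  assumes t: "0 < t1" "0 < t2"
  shows "((1 / t1) *\<^sub>R (x - step d x t1) - (1 / t2) *\<^sub>R (x - step d x t2))
           \<bullet> (step d x t1 - step d x t2) \<ge> 0"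
  using step_subgradient[OF t(1) step_in_edom[OF t(2)], of d x d x]
    step_subgradient[OF t(2) step_in_edom[OF t(1)], of d x d x]
  by (simp add: inner_diff_left inner_diff_right algebra_simps)

text \<open>
  Write \<open>G1\<close> and \<open>G2\<close> for the scaled displacements. The difference of the two points is
  \<open>- t1 (G1 - G2) - (t1 - t2) G2\<close>. By monotonicity the first summand contributes nothing positive to
  the squared norm, and the norm of \<open>G2\<close> is bounded by \<open>step_length_le\<close>.
\<close>

lemma step_diff_stepsize:
  assumes t: "0 < t1" "0 < t2" and x: "x \<in> edom r"
  shows "norm (step d x t1 - step d x t2) \<le> \<bar>t1 - t2\<bar> * (L\<^sub>r + norm d)"
proof -
  define G1 G2 where "G1 = (1 / t1) *\<^sub>R (x - step d x t1)" and "G2 = (1 / t2) *\<^sub>R (x - step d x t2)"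
  define D where "D = step d x t1 - step d x t2"
  have "D = t2 *\<^sub>R G2 - t1 *\<^sub>R G1"
    using t by (simp add: D_def G1_def G2_def)
  then have D: "D = - (t1 *\<^sub>R (G1 - G2)) - (t1 - t2) *\<^sub>R G2"
    by (simp add: algebra_simps)
  have "D \<bullet> D = (- (t1 *\<^sub>R (G1 - G2)) - (t1 - t2) *\<^sub>R G2) \<bullet> D"
    using D by simp
  also have "\<dots> = - t1 * ((G1 - G2) \<bullet> D) - (t1 - t2) * (G2 \<bullet> D)"
    by (simp add: inner_diff_left)
  also have "\<dots> \<le> - ((t1 - t2) * (G2 \<bullet> D))"
    using step_monotone[OF t, of x d] t by (simp add: D_def G1_def G2_def)
  also have "\<dots> \<le> \<bar>t1 - t2\<bar> * \<bar>G2 \<bullet> D\<bar>"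
    by (metis abs_ge_minus_self abs_mult)
  also have "\<dots> \<le> \<bar>t1 - t2\<bar> * (norm G2 * norm D)"
    by (intro mult_left_mono Cauchy_Schwarz_ineq2) simp
  also have "\<dots> \<le> \<bar>t1 - t2\<bar> * ((L\<^sub>r + norm d) * norm D)"
    using step_length_le[OF t(2) x, of d] t
    by (intro mult_left_mono mult_right_mono) (auto simp: G2_def divide_le_eq mult.commute)
  finally have "norm D * norm D \<le> (\<bar>t1 - t2\<bar> * (L\<^sub>r + norm d)) * norm D"
    by (simp add: norm_eq_sqrt_inner)
  then show ?thesis
    using mult_right_le_imp_le[of "norm D" "norm D"] L\<^sub>r_nonneg unfolding D_def[symmetric]
    by (cases "D = 0") auto
qed

text \<open>
  For the norms of the scaled displacements \<open>G1\<close> and \<open>G2\<close>, monotonicity gives \<open>(\<bar>G1\<bar> - \<bar>G2\<bar>) (t2 \<bar>G2\<bar> - t1 \<bar>G1\<bar>) \<ge> 0\<close>; if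
  \<open>\<bar>G2\<bar>\<close> were larger than \<open>\<bar>G1\<bar>\<close>, the two factors would have opposite signs.
\<close>

lemma step_residual_antimono:
  assumes t: "0 < t1" "t1 \<le> t2"
  shows "norm (x - step d x t2) / t2 \<le> norm (x - step d x t1) / t1"
proof -
  define G1 G2 where "G1 = (1 / t1) *\<^sub>R (x - step d x t1)" and "G2 = (1 / t2) *\<^sub>R (x - step d x t2)"
  have t2: "0 < t2"
    using t by simp
  have D: "step d x t1 - step d x t2 = t2 *\<^sub>R G2 - t1 *\<^sub>R G1"
    using t by (simp add: G1_def G2_def)
  have "(G1 - G2) \<bullet> (t2 *\<^sub>R G2 - t1 *\<^sub>R G1) \<ge> 0"
    using step_monotone[OF t(1) t2, of x d] unfolding D G1_def[symmetric] G2_def[symmetric] .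
  then have "t1 * (norm G1)\<^sup>2 + t2 * (norm G2)\<^sup>2 \<le> (t1 + t2) * (G1 \<bullet> G2)"
    by (simp add: power2_norm_eq_inner inner_diff_left inner_diff_right inner_commute algebra_simps)
  also have "\<dots> \<le> (t1 + t2) * (norm G1 * norm G2)"
    using t t2 by (intro mult_left_mono norm_cauchy_schwarz) auto
  finally have *: "(norm G1 - norm G2) * (t2 * norm G2 - t1 * norm G1) \<ge> 0"
    by (simp add: algebra_simps power2_eq_square)
  have "norm G2 \<le> norm G1"
  proof (rule ccontr)
    assume "\<not> norm G2 \<le> norm G1"
    then have "norm G1 < norm G2" "t1 * norm G1 < t2 * norm G2"
      using t t2 by (auto intro: mult_le_less_imp_less)
    then have "(norm G1 - norm G2) * (t2 * norm G2 - t1 * norm G1) < 0"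
      by (intro mult_neg_pos) auto
    then show False
      using * by simp
  qed
  then show ?thesis
    using t t2 by (simp add: G1_def G2_def)
qed

end

section \<open>One run of the algorithm on a fixed sample array\<close>

text \<open>
  All conditions concern the domain of \<open>r\<close>, because the iterates and the segments between them stay
  in this convex set. The set \<open>Z\<close> consists of the possible sample values.
\<close>

locale composite_problem = convex_regularizer r L\<^sub>r
  for r :: "'a::euclidean_space \<Rightarrow> ereal" and L\<^sub>r :: real +
  fixes f :: "'a \<Rightarrow> real" and g :: "'a \<Rightarrow> 'a" and B\<^sub>g :: real
    and F :: "'a \<Rightarrow> 'd \<Rightarrow> real" and Z :: "'d set" and L :: real
  assumes GDERIV_f: "x \<in> edom r \<Longrightarrow> GDERIV f x :> g x"
    and norm_g_le: "x \<in> edom r \<Longrightarrow> norm (g x) \<le> B\<^sub>g"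
    and lipschitz_g: "L-lipschitz_on (edom r) g"
    and GDERIV_F: "z \<in> Z \<Longrightarrow> x \<in> edom r \<Longrightarrow> GDERIV (\<lambda>y. F y z) x :> grad (\<lambda>y. F y z) x"
    and lipschitz_F: "z \<in> Z \<Longrightarrow> L-lipschitz_on (edom r) (grad (\<lambda>y. F y z))"
    and L_pos: "0 < L"

locale slam_method = composite_problem r L\<^sub>r f g B\<^sub>g F Z L
  for r :: "'a::euclidean_space \<Rightarrow> ereal" and L\<^sub>r f g B\<^sub>g and F :: "'a \<Rightarrow> 'd \<Rightarrow> real" and Z L +
  fixes N p :: "nat \<Rightarrow> nat" and \<alpha> \<beta> s :: real and x0 :: 'a
  assumes N_pos: "0 < N k"
    and \<alpha>: "0 < \<alpha>" "\<alpha> < 1" and \<beta>: "0 < \<beta>" "\<beta> < 1" and s_pos: "0 < s" and x0: "x0 \<in> edom r"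
begin

definition c :: real where
  "c = min s (2 * (1 - \<alpha>) * \<beta> / L)"

lemma c_pos: "0 < c"
  using \<alpha> \<beta> s_pos L_pos by (simp add: c_def)

lemma c_le_s: "c \<le> s"
  by (simp add: c_def)

definition admissible :: "(nat \<Rightarrow> nat \<Rightarrow> 'd) \<Rightarrow> bool" where
  "admissible z \<longleftrightarrow> (\<forall>k. \<forall>i\<in>{1..N k}. z k i \<in> Z)"

abbreviation state :: "(nat \<Rightarrow> nat \<Rightarrow> 'd) \<Rightarrow> nat \<Rightarrow> 'a \<times> real" where
  "state \<equiv> slam_state r F N p \<alpha> \<beta> s x0"

abbreviation iterate :: "(nat \<Rightarrow> nat \<Rightarrow> 'd) \<Rightarrow> nat \<Rightarrow> 'a" where
  "iterate \<equiv> slam r F N p \<alpha> \<beta> s x0"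

definition stepsize :: "(nat \<Rightarrow> nat \<Rightarrow> 'd) \<Rightarrow> nat \<Rightarrow> real" where
  "stepsize z k = snd (state z (Suc k))"

definition init_stepsize :: "(nat \<Rightarrow> nat \<Rightarrow> 'd) \<Rightarrow> nat \<Rightarrow> real" where
  "init_stepsize z k = (if cycle_start p k then s else snd (state z k))"

text \<open>
  The proximal gradient point for the exact gradient and the step size with which the line search
  begins. Unlike the next iterate it depends only on the past samples.
\<close>

definition reference_point :: "(nat \<Rightarrow> nat \<Rightarrow> 'd) \<Rightarrow> nat \<Rightarrow> 'a" where
  "reference_point z k = step (g (iterate z k)) (iterate z k) (init_stepsize z k)"

definition batch_error :: "(nat \<Rightarrow> nat \<Rightarrow> 'd) \<Rightarrow> nat \<Rightarrow> 'a \<Rightarrow> real" where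
  "batch_error z k y = f y - batch_fun F N z k y"

definition batch_grad_error :: "(nat \<Rightarrow> nat \<Rightarrow> 'd) \<Rightarrow> nat \<Rightarrow> 'a \<Rightarrow> 'a" where
  "batch_grad_error z k y = g y - batch_grad F N z k y"

definition residual :: "'a \<Rightarrow> real" where
  "residual x = norm (prox_residual r g s x)"

lemma residual_eq: "residual x = norm (x - step (g x) x s) / s"
  using s_pos by (simp add: residual_def prox_residual_def step_def)

lemma residual_le: "x \<in> edom r \<Longrightarrow> residual x \<le> L\<^sub>r + B\<^sub>g"
  using step_length_le[OF s_pos, of x "g x"] norm_g_le[of x] s_pos
  unfolding residual_eq by (simp add: pos_divide_le_eq mult.commute) (smt (verit) mult_left_mono)

lemma trial_point_eq_step: "trial_point r F N z k x t = step (batch_grad F N z k x) x t"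
  by (simp add: trial_point_def step_def)

lemma stepsize_eq_backtrack:
  "stepsize z k = backtrack r F N \<alpha> \<beta> z k (iterate z k) (init_stepsize z k)"
  by (simp add: stepsize_def init_stepsize_def slam_def Let_def split: prod.splits)

lemma iterate_Suc:
  "iterate z (Suc k) = step (batch_grad F N z k (iterate z k)) (iterate z k) (stepsize z k)"
  by (simp add: stepsize_def slam_def Let_def trial_point_eq_step split: prod.splits)

lemma iterate_0: "iterate z 0 = x0"
  by (simp add: slam_def)

lemma sufficient_decrease_iff:
  assumes "0 < t" "x \<in> edom r"
  shows "sufficient_decrease r F N \<alpha> z k x t \<longleftrightarrow>
     (let y = step (batch_grad F N z k x) x t in
      batch_fun F N z k y + \<rho> y - (batch_fun F N z k x + \<rho> x) \<le> - (\<alpha> / t) * (norm (x - y))\<^sup>2)"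
proof -
  define y where "y = step (batch_grad F N z k x) x t"
  have "r y = ereal (\<rho> y)"
    using r_eq step_in_edom[OF assms(1)] unfolding y_def by blast
  then have "batch_obj r F N z k y = ereal (batch_fun F N z k y + \<rho> y)"
    unfolding batch_obj_def by (metis plus_ereal.simps(1))
  moreover have "batch_obj r F N z k x = ereal (batch_fun F N z k x + \<rho> x)"
    using r_eq[OF assms(2)] unfolding batch_obj_def by (metis plus_ereal.simps(1))
  ultimately show ?thesis
    unfolding sufficient_decrease_def trial_point_eq_step Let_def y_def[symmetric] by simp
qed

context
  fixes z
  assumes adm: "admissible z"
begin

lemma sample_in_Z: "i \<in> {1..N k} \<Longrightarrow> z k i \<in> Z"
  using adm by (simp add: admissible_def)

lemma GDERIV_batch_fun:
  assumes x: "x \<in> edom r"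
  shows "GDERIV (batch_fun F N z k) x :> batch_grad F N z k x"
proof -
  have "(batch_fun F N z k has_derivative
      (\<lambda>v. 1 / real (N k) * (\<Sum>i = 1..N k. v \<bullet> grad (\<lambda>y. F y (z k i)) x))) (at x)"
    unfolding batch_fun_def
    by (intro has_derivative_mult_right has_derivative_sum)
       (use GDERIV_F[OF sample_in_Z x] in \<open>simp add: gderiv_def\<close>)
  then show ?thesis
    by (simp add: gderiv_def batch_grad_def inner_sum_right)
qed

lemma lipschitz_batch_grad: "L-lipschitz_on (edom r) (batch_grad F N z k)"
proof (rule lipschitz_onI)
  fix x y assume xy: "x \<in> edom r" "y \<in> edom r"
  have "norm (\<Sum>i = 1..N k. grad (\<lambda>u. F u (z k i)) x - grad (\<lambda>u. F u (z k i)) y)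
      \<le> (\<Sum>i = 1..N k. L * norm (x - y))"
    using lipschitz_onD[OF lipschitz_F[OF sample_in_Z] xy]
    by (intro sum_norm_le) (simp add: dist_norm)
  also have "\<dots> = real (N k) * (L * norm (x - y))"
    by simp
  finally have "1 / real (N k) * norm (\<Sum>i = 1..N k. grad (\<lambda>u. F u (z k i)) x - grad (\<lambda>u. F u (z k i)) y)
      \<le> L * norm (x - y)"
    using N_pos[of k] by (simp add: field_simps)
  then show "dist (batch_grad F N z k x) (batch_grad F N z k y) \<le> L * dist x y"
    by (simp add: batch_grad_def dist_norm sum_subtractf flip: scaleR_diff_right)
qed (use L_pos in simp)

text \<open>
  The descent lemma for the sampled function and the decrease of \<open>\<rho>\<close> bound the change of the sampled
  objective by \<open>L / 2 - 1 / t\<close> times the squared step length.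
\<close>

lemma sufficient_decrease_short_step:
  assumes t: "0 < t" "t \<le> 2 * (1 - \<alpha>) / L" and x: "x \<in> edom r"
  shows "sufficient_decrease r F N \<alpha> z k x t"
proof -
  define d where "d = batch_grad F N z k x"
  define y where "y = step d x t"
  have "batch_fun F N z k y \<le> batch_fun F N z k x + (y - x) \<bullet> d + L / 2 * (norm (y - x))\<^sup>2"
    unfolding d_def y_def
    by (rule descent_lemma[OF convex_edom GDERIV_batch_fun lipschitz_batch_grad x step_in_edom[OF t(1)]])
  moreover have "\<rho> y + d \<bullet> (y - x) \<le> \<rho> x - (1 / t) * (norm (x - y))\<^sup>2"
    unfolding y_def by (rule step_decrease[OF t(1) x])
  moreover have "L / 2 * (norm (x - y))\<^sup>2 \<le> (1 / t - \<alpha> / t) * (norm (x - y))\<^sup>2"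
    using t L_pos by (intro mult_right_mono) (auto simp: field_simps)
  ultimately show ?thesis
    unfolding sufficient_decrease_iff[OF t(1) x] Let_def d_def[symmetric] y_def[symmetric]
    by (simp add: norm_minus_commute inner_commute algebra_simps)
qed

text \<open>
  If the step size is reduced, then the last rejected trial exceeds \<open>2 (1 - \<alpha>) / L\<close>. This trial is
  the accepted step size divided by \<open>\<beta>\<close>, and it is at most the initial one.
\<close>

lemma backtrack_cases:
  fixes k
  assumes t: "0 < t" and x: "x \<in> edom r"
  defines "\<tau> \<equiv> backtrack r F N \<alpha> \<beta> z k x t"
  shows "sufficient_decrease r F N \<alpha> z k x \<tau>" and "0 < \<tau>"
    and "\<tau> = t \<or> (\<tau> \<le> \<beta> * t \<and> 2 * (1 - \<alpha>) / L < \<tau> / \<beta> \<and> 2 * (1 - \<alpha>) / L < t)"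
proof -
  define sd where "sd m = sufficient_decrease r F N \<alpha> z k x (\<beta> ^ m * t)" for m
  define m where "m = (LEAST m. sd m)"
  have \<tau>: "\<tau> = \<beta> ^ m * t"
    by (simp add: \<tau>_def m_def sd_def backtrack_def)
  obtain n where "\<beta> ^ n < 2 * (1 - \<alpha>) / L / t"
    using real_arch_pow_inv[of "2 * (1 - \<alpha>) / L / t" \<beta>] \<alpha> \<beta> L_pos t by auto
  then have "\<beta> ^ n * t < 2 * (1 - \<alpha>) / L"
    using t by (simp only: pos_less_divide_eq)
  then have "sd n"
    unfolding sd_def using t \<beta>
    by (intro sufficient_decrease_short_step x) auto
  then have "sd m"
    unfolding m_def by (rule LeastI)
  then show "sufficient_decrease r F N \<alpha> z k x \<tau>"
    by (simp add: sd_def \<tau>)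
  show "0 < \<tau>"
    using t \<beta> by (simp add: \<tau>)
  show "\<tau> = t \<or> (\<tau> \<le> \<beta> * t \<and> 2 * (1 - \<alpha>) / L < \<tau> / \<beta> \<and> 2 * (1 - \<alpha>) / L < t)"
  proof (cases m)
    case (Suc m')
    have "\<not> sd m'"
      using Suc not_less_Least[of m' sd] by (simp add: m_def)
    then have "2 * (1 - \<alpha>) / L < \<beta> ^ m' * t"
      unfolding sd_def using sufficient_decrease_short_step[OF _ _ x, of "\<beta> ^ m' * t" k] t \<beta>
      by (meson mult_pos_pos not_le zero_less_power)
    moreover have le: "\<beta> ^ m' * t \<le> 1 * t"
      using t \<beta> by (intro mult_right_mono power_le_one) auto
    moreover have "\<tau> = \<beta> * (\<beta> ^ m' * t)"
      by (simp add: \<tau> Suc)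
    moreover have "\<beta> * (\<beta> ^ m' * t) \<le> \<beta> * t"
      using le \<beta> by (intro mult_left_mono) auto
    ultimately show ?thesis
      using \<beta> by auto
  qed (simp add: \<tau>)
qed

lemma run_invariant: "iterate z k \<in> edom r \<and> c \<le> snd (state z k) \<and> snd (state z k) \<le> s"
proof (induction k)
  case 0
  then show ?case
    using x0 c_le_s by (simp add: slam_def)
next
  case (Suc k)
  have init: "c \<le> init_stepsize z k" "init_stepsize z k \<le> s"
    using Suc c_le_s by (auto simp: init_stepsize_def)
  have x: "iterate z k \<in> edom r"
    using Suc by simp
  note bt = backtrack_cases[OF _ x, of "init_stepsize z k" k, folded stepsize_eq_backtrack]
  have pos: "0 < init_stepsize z k"
    using init c_pos by simp
  have "stepsize z k = init_stepsize z k
      \<or> (stepsize z k \<le> \<beta> * init_stepsize z k \<and> 2 * (1 - \<alpha>) / L < stepsize z k / \<beta>)"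
    using bt(3)[OF pos] by auto
  then have "c \<le> stepsize z k \<and> stepsize z k \<le> s"
  proof
    assume *: "stepsize z k \<le> \<beta> * init_stepsize z k \<and> 2 * (1 - \<alpha>) / L < stepsize z k / \<beta>"
    have "\<beta> * init_stepsize z k \<le> 1 * init_stepsize z k"
      using \<beta> pos by (intro mult_right_mono) auto
    moreover have "2 * (1 - \<alpha>) * \<beta> / L \<le> stepsize z k"
      using * \<beta> by (simp add: field_simps)
    ultimately show ?thesis
      using * init by (auto simp: c_def)
  qed (use init in simp)
  moreover have "iterate z (Suc k) \<in> edom r"
    unfolding iterate_Suc by (intro step_in_edom bt(2) pos)
  ultimately show ?case
    by (simp add: stepsize_def)
qed

lemma iterate_in_edom: "iterate z k \<in> edom r"
  using run_invariant by blast

lemma init_stepsize_bounds: "c \<le> init_stepsize z k" "init_stepsize z k \<le> s" "0 < init_stepsize z k"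
  using run_invariant[of k] c_le_s c_pos by (auto simp: init_stepsize_def)

lemma stepsize_bounds: "c \<le> stepsize z k" "stepsize z k \<le> s" "0 < stepsize z k"
  using run_invariant[of "Suc k"] c_pos by (auto simp: stepsize_def)

lemmas stepsize_cases =
  backtrack_cases[OF init_stepsize_bounds(3)[of k] iterate_in_edom[of k], of k,
    folded stepsize_eq_backtrack] for k

lemma reference_point_in_edom: "reference_point z k \<in> edom r"
  unfolding reference_point_def by (intro step_in_edom init_stepsize_bounds)

lemma GDERIV_batch_error: "x \<in> edom r \<Longrightarrow> GDERIV (batch_error z k) x :> batch_grad_error z k x"
  unfolding batch_error_def batch_grad_error_def
  by (intro GDERIV_diff GDERIV_f GDERIV_batch_fun)

lemma lipschitz_batch_grad_error: "(2 * L)-lipschitz_on (edom r) (batch_grad_error z k)"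
  using lipschitz_on_diff[OF lipschitz_g lipschitz_batch_grad[of k]]
  by (simp add: batch_grad_error_def)

text \<open>
  The line search only controls the sampled objective, and the next iterate depends on the batch,
  so the sampling error at that iterate has no useful conditional mean. The error is therefore
  split at the reference point: there it has mean zero given the past, and the difference to the
  next iterate is controlled by the gradient error and the distance of the two points. This
  distance consists of a part caused by the gradient error and, only if the line search reduces
  the step size, a part caused by the change of the step size.
\<close>

lemma one_iteration:
  fixes k
  defines "x \<equiv> iterate z k" and "y \<equiv> reference_point z k"
  shows "\<alpha> * c / 2 * (residual x)\<^sup>2
    \<le> (f x + \<rho> x) - (f (iterate z (Suc k)) + \<rho> (iterate z (Suc k)))
      + (batch_error z k y - batch_error z k x)
      + 1 / (2 * L) * (norm (batch_grad_error z k y))\<^sup>2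
      + (3 * L * s\<^sup>2 + \<alpha> * c) * (norm (batch_grad_error z k x))\<^sup>2
      + 3 * L * (s - c)\<^sup>2 * (L\<^sub>r + B\<^sub>g)\<^sup>2 * of_bool (stepsize z k \<noteq> init_stepsize z k)"
proof -
  define d where "d = batch_grad F N z k x"
  define t where "t = init_stepsize z k"
  define \<tau> where "\<tau> = stepsize z k"
  define x' where "x' = iterate z (Suc k)"
  define b :: real where "b = of_bool (\<tau> \<noteq> t)"
  define E where "E = norm (batch_grad_error z k x)"
  have x: "x \<in> edom r" and y: "y \<in> edom r" and x'C: "x' \<in> edom r"
    unfolding x_def y_def x'_def by (intro iterate_in_edom reference_point_in_edom)+
  have \<tau>: "0 < \<tau>" "\<tau> \<le> s" "c \<le> \<tau>" and t: "0 < t" "t \<le> s" "c \<le> t"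
    using stepsize_bounds[of k] init_stepsize_bounds[of k] by (auto simp: \<tau>_def t_def)
  have x': "x' = step d x \<tau>"
    by (simp add: x'_def iterate_Suc d_def x_def \<tau>_def)
  have y_eq: "y = step (g x) x t"
    by (simp add: y_def reference_point_def x_def t_def)
  have E: "norm (d - g x) = E"
    by (simp add: E_def batch_grad_error_def d_def norm_minus_commute)
  have decrease: "batch_fun F N z k x' + \<rho> x' - (batch_fun F N z k x + \<rho> x)
      \<le> - (\<alpha> / \<tau>) * (norm (x - x'))\<^sup>2"
    using stepsize_cases(1)[of k] sufficient_decrease_iff[OF \<tau>(1) x, of z k]
    by (simp add: Let_def x' d_def x_def \<tau>_def)
  have dist: "(norm (x' - y))\<^sup>2 \<le> 2 * s\<^sup>2 * E\<^sup>2 + 2 * (s - c)\<^sup>2 * (L\<^sub>r + B\<^sub>g)\<^sup>2 * b"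
  proof -
    define u where "u = norm (x' - step (g x) x \<tau>)"
    define v where "v = norm (step (g x) x \<tau> - y)"
    have "u \<le> \<tau> * E"
      unfolding u_def x' E[symmetric] by (rule step_diff_direction[OF \<tau>(1)])
    also have "\<dots> \<le> s * E"
      using \<tau> by (intro mult_right_mono) (auto simp: E_def)
    finally have u: "u\<^sup>2 \<le> s\<^sup>2 * E\<^sup>2"
      unfolding power_mult_distrib[symmetric] by (intro power_mono) (auto simp: u_def)
    have v: "v\<^sup>2 \<le> (s - c)\<^sup>2 * (L\<^sub>r + B\<^sub>g)\<^sup>2 * b"
    proof (cases "\<tau> = t")
      case False
      have "v \<le> \<bar>\<tau> - t\<bar> * (L\<^sub>r + norm (g x))"
        unfolding v_def y_eq by (rule step_diff_stepsize[OF \<tau>(1) t(1) x])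
      also have "\<dots> \<le> (s - c) * (L\<^sub>r + B\<^sub>g)"
        using \<tau> t norm_g_le[OF x] L\<^sub>r_nonneg by (intro mult_mono) auto
      finally show ?thesis
        using False unfolding power_mult_distrib[symmetric] b_def
        by (simp add: power_mono v_def)
    qed (simp add: v_def y_eq b_def)
    have "norm (x' - y) \<le> u + v"
      unfolding u_def v_def using norm_triangle_ineq[of "x' - step (g x) x \<tau>"] by (metis diff_add_cancel add_diff_eq)
    then have "(norm (x' - y))\<^sup>2 \<le> (u + v)\<^sup>2"
      by (intro power_mono) auto
    also have "\<dots> \<le> 2 * u\<^sup>2 + 2 * v\<^sup>2"
      using sum_squares_bound[of u v] by (simp add: power2_sum)
    finally show ?thesis
      using u v by linarith
  qed
  have error: "batch_error z k x' \<le> batch_error z k y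
      + 1 / (2 * L) * (norm (batch_grad_error z k y))\<^sup>2 + 3 * L / 2 * (norm (x' - y))\<^sup>2"
  proof -
    define a where "a = norm (batch_grad_error z k y)"
    define n where "n = norm (x' - y)"
    have "(x' - y) \<bullet> batch_grad_error z k y \<le> n * a"
      unfolding a_def n_def by (rule norm_cauchy_schwarz)
    also have "n * a \<le> 1 / (2 * L) * a\<^sup>2 + L / 2 * n\<^sup>2"
      \<comment> \<open>Young's inequality with the weight that balances \<open>1 / (2 L)\<close> against \<open>L / 2\<close>.\<close>
      using L_pos zero_le_power2[of "a - L * n"] by (simp add: field_simps power2_eq_square)
    finally show ?thesis
      using descent_lemma[OF convex_edom GDERIV_batch_error lipschitz_batch_grad_error y x'C, of k]
      by (simp add: a_def n_def)
  qed
  have progress: "\<alpha> * c / 2 * (residual x)\<^sup>2 - \<alpha> * c * E\<^sup>2 \<le> \<alpha> / \<tau> * (norm (x - x'))\<^sup>2"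
  proof -
    define A where "A = norm (x - step d x s) / s"
    have "norm (step d x s - step (g x) x s) \<le> s * E"
      unfolding E[symmetric] by (rule step_diff_direction[OF s_pos])
    moreover have "norm (x - step (g x) x s) \<le> norm (x - step d x s) + norm (step d x s - step (g x) x s)"
      using norm_triangle_ineq[of "x - step d x s" "step d x s - step (g x) x s"] by simp
    ultimately have "norm (x - step (g x) x s) \<le> norm (x - step d x s) + s * E"
      by simp
    then have "residual x \<le> A + E"
      using s_pos by (simp add: residual_eq A_def field_simps)
    moreover have "0 \<le> residual x"
      by (simp add: residual_def)
    ultimately have "(residual x)\<^sup>2 \<le> (A + E)\<^sup>2"
      by (intro power_mono)
    also have "\<dots> \<le> 2 * A\<^sup>2 + 2 * E\<^sup>2"
      using sum_squares_bound[of A E] by (simp add: power2_sum)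
    finally have "(residual x)\<^sup>2 / 2 - E\<^sup>2 \<le> A\<^sup>2"
      by simp
    also have "A\<^sup>2 \<le> (norm (x - x') / \<tau>)\<^sup>2"
      unfolding A_def x' using \<tau> s_pos by (intro power_mono step_residual_antimono) auto
    finally have "\<alpha> * c * ((residual x)\<^sup>2 / 2 - E\<^sup>2) \<le> \<alpha> * c * (norm (x - x') / \<tau>)\<^sup>2"
      using \<alpha> c_pos by (intro mult_left_mono) auto
    also have "\<dots> \<le> \<alpha> * \<tau> * (norm (x - x') / \<tau>)\<^sup>2"
      using \<alpha> \<tau> by (intro mult_right_mono mult_left_mono) auto
    also have "\<dots> = \<alpha> / \<tau> * (norm (x - x'))\<^sup>2"
      using \<tau> by (simp add: power2_eq_square)
    finally show ?thesis
      by (simp add: algebra_simps)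
  qed
  have "3 * L / 2 * (norm (x' - y))\<^sup>2
      \<le> 3 * L / 2 * (2 * s\<^sup>2 * E\<^sup>2 + 2 * (s - c)\<^sup>2 * (L\<^sub>r + B\<^sub>g)\<^sup>2 * b)"
    using dist L_pos by (intro mult_left_mono) auto
  also have "\<dots> = 3 * L * s\<^sup>2 * E\<^sup>2 + 3 * L * (s - c)\<^sup>2 * (L\<^sub>r + B\<^sub>g)\<^sup>2 * b"
    by (simp add: algebra_simps)
  finally have dist': "3 * L / 2 * (norm (x' - y))\<^sup>2
      \<le> 3 * L * s\<^sup>2 * E\<^sup>2 + 3 * L * (s - c)\<^sup>2 * (L\<^sub>r + B\<^sub>g)\<^sup>2 * b" .
  have "batch_error z k x' - batch_error z k x
      = (f x' - f x) - (batch_fun F N z k x' - batch_fun F N z k x)"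
    by (simp add: batch_error_def)
  then show ?thesis
    using decrease error progress dist'
    unfolding x'_def[symmetric] E_def[symmetric] b_def[symmetric] \<tau>_def[symmetric] t_def[symmetric]
      distrib_right
    by linarith
qed

text \<open>
  Within a cycle the step size starts at \<open>s\<close> and each reduction multiplies it by at most \<open>\<beta>\<close>, but
  no reduction happens once the step size is at most \<open>2 (1 - \<alpha>) / L\<close>. A number \<open>b\<close> of
  reductions after which this is the case bounds the number of reductions per cycle.
\<close>

lemma card_reductions_le:
  assumes b: "\<And>n. 2 * (1 - \<alpha>) / L < s * \<beta> ^ n \<Longrightarrow> n < b"
  shows "card {k. k < K \<and> stepsize z k \<noteq> init_stepsize z k} \<le> card {k. k < K \<and> cycle_start p k} * b"
proof -
  define red where "red K = card {k. k < K \<and> stepsize z k \<noteq> init_stepsize z k}" for K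
  define cyc where "cyc K = card {k. k < K \<and> cycle_start p k}" for K
  have count_Suc: "card {k. k < Suc K \<and> Q k} = card {k. k < K \<and> Q k} + of_bool (Q K)" for Q K
  proof -
    have "{k. k < Suc K \<and> Q k} = (if Q K then insert K {k. k < K \<and> Q k} else {k. k < K \<and> Q k})"
      by (auto simp: less_Suc_eq)
    then show ?thesis
      by simp
  qed
  have start: "cycle_start p 0"
    by (auto simp: cycle_start_def intro!: exI[of _ 0])
  \<comment> \<open>\<open>n\<close> is the number of reductions in the current cycle; the cycles before it account for
    \<open>cyc K - 1\<close> times \<open>b\<close>. Adding \<open>b\<close> on the left avoids the subtraction, and \<open>n = b\<close> is the right
    start for \<open>K = 0\<close>, where no cycle has begun.\<close>
  have "\<exists>n\<le>b. red K + b \<le> cyc K * b + n \<and> (0 < K \<longrightarrow> snd (state z K) \<le> s * \<beta> ^ n)"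
  proof (induction K)
    case 0
    then show ?case
      by (auto simp: red_def cyc_def)
  next
    case (Suc K)
    then obtain n where n: "n \<le> b" "red K + b \<le> cyc K * b + n"
        "0 < K \<Longrightarrow> snd (state z K) \<le> s * \<beta> ^ n"
      by blast
    define n0 where "n0 = (if cycle_start p K then 0 else n)"
    have n0: "n0 \<le> b" "red K + b \<le> cyc (Suc K) * b + n0"
      using n by (auto simp: n0_def cyc_def count_Suc)
    have init: "init_stepsize z K \<le> s * \<beta> ^ n0"
      using n(3) start by (cases "K = 0") (auto simp: init_stepsize_def n0_def)
    show ?case
    proof (cases "stepsize z K = init_stepsize z K")
      case True
      then show ?thesis
        using n0 init by (intro exI[of _ n0]) (auto simp: red_def count_Suc stepsize_def)
    next
      case False
      then have *: "stepsize z K \<le> \<beta> * init_stepsize z K" "2 * (1 - \<alpha>) / L < init_stepsize z K"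
        using stepsize_cases(3)[of K] by auto
      have "n0 < b"
        using b[of n0] * init by simp
      moreover have "stepsize z K \<le> s * \<beta> ^ Suc n0"
        using order_trans[OF *(1) mult_left_mono[OF init]] \<beta> by (simp add: mult.left_commute)
      ultimately show ?thesis
        using n0 False by (intro exI[of _ "Suc n0"]) (auto simp: red_def count_Suc stepsize_def)
    qed
  qed
  then show ?thesis
    unfolding red_def cyc_def by (meson add_le_cancel_right add_le_mono le_refl le_trans)
qed

end

end

section \<open>Random variables built from independent samples\<close>

text \<open>
  A function that is continuous in its first argument on a set \<open>C\<close> and measurable in the second is
  the limit of functions that take only countably many values in the first argument, obtained by
  replacing a point of \<open>C\<close> by the first element of a countable dense subset that is close to it.
\<close>

lemma borel_measurable_continuous_fst_compose:
  fixes h :: "'a::{metric_space, second_countable_topology} \<Rightarrow> 'b \<Rightarrow> 'c::metric_space"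
  assumes h: "\<And>x. x \<in> C \<Longrightarrow> h x \<in> borel_measurable S"
    and cont: "\<And>z. z \<in> space S \<Longrightarrow> continuous_on C (\<lambda>x. h x z)"
    and a: "a \<in> borel_measurable Q" "\<And>w. w \<in> space Q \<Longrightarrow> a w \<in> C"
    and b: "b \<in> measurable Q S"
  shows "(\<lambda>w. h (a w) (b w)) \<in> borel_measurable Q"
proof (cases "space Q = {}")
  case False
  obtain T where T: "countable T" "T \<subseteq> C" "C \<subseteq> closure T"
    by (rule separable)
  define e where "e = from_nat_into T"
  have "T \<noteq> {}"
    using False a(2) T(3) by fastforce
  then have e_C: "e j \<in> C" for j
    using T(2) from_nat_into[of T j] by (auto simp: e_def)
  have dense: "\<exists>j. dist (e j) x < 1 / real (Suc n)" if "x \<in> C" for x n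
  proof -
    have "x \<in> closure T"
      using that T(3) by blast
    then obtain y where y: "y \<in> T" "dist y x < 1 / real (Suc n)"
      unfolding closure_approachable by (auto simp del: of_nat_Suc dest!: spec[of _ "1 / real (Suc n)"])
    obtain j where "e j = y"
      using from_nat_into_surj[OF T(1) y(1)] by (auto simp: e_def)
    then show ?thesis
      using y(2) by blast
  qed
  define J where "J n w = (LEAST j. dist (e j) (a w) < 1 / real (Suc n))" for n w
  have J: "dist (e (J n w)) (a w) < 1 / real (Suc n)" if "w \<in> space Q" for n w
    unfolding J_def by (rule LeastI_ex) (rule dense[OF a(2)[OF that]])
  show ?thesis
  proof (rule borel_measurable_LIMSEQ_metric)
    fix n
    have "J n \<in> measurable Q (count_space UNIV)"
      unfolding J_def using a(1) by measurable
    moreover have "(\<lambda>w. h (e j) (b w)) \<in> borel_measurable Q" for j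
      using measurable_compose[OF b h[OF e_C]] .
    ultimately show "(\<lambda>w. h (e (J n w)) (b w)) \<in> borel_measurable Q"
      by (rule measurable_compose_countable[rotated])
  next
    fix w assume w: "w \<in> space Q"
    have "(\<lambda>n. e (J n w)) \<longlonglongrightarrow> a w"
    proof (rule metric_tendsto_imp_tendsto)
      show "(\<lambda>n. 1 / real (Suc n)) \<longlonglongrightarrow> 0"
        by (rule LIMSEQ_Suc[OF lim_1_over_n])
      show "\<forall>\<^sub>F n in sequentially. dist (e (J n w)) (a w) \<le> dist (1 / real (Suc n)) 0"
        using J[OF w] by (intro always_eventually allI less_imp_le) (simp add: dist_real_def)
    qed
    moreover have "b w \<in> space S"
      using b w by (rule measurable_space)
    ultimately show "(\<lambda>n. h (e (J n w)) (b w)) \<longlonglongrightarrow> h (a w) (b w)"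
      using cont e_C a(2)[OF w] by (auto simp: continuous_on_sequentially o_def)
  qed
next
  case True
  then show ?thesis
    by (simp add: measurable_def)
qed

text \<open>The gradient is a limit of difference quotients along the coordinate directions.\<close>

lemma borel_measurable_grad:
  fixes F :: "'a::euclidean_space \<Rightarrow> 'd \<Rightarrow> real"
  assumes F: "\<And>y. F y \<in> borel_measurable D"
    and deriv: "\<And>z. z \<in> space D \<Longrightarrow> GDERIV (\<lambda>y. F y z) x :> grad (\<lambda>y. F y z) x"
  shows "(\<lambda>z. grad (\<lambda>y. F y z) x) \<in> borel_measurable D"
proof (rule borel_measurable_LIMSEQ_metric)
  fix n
  show "(\<lambda>z. \<Sum>b\<in>Basis. ((F (x + (1 / real (Suc n)) *\<^sub>R b) z - F x z) / (1 / real (Suc n))) *\<^sub>R b)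
      \<in> borel_measurable D"
    using F by measurable
next
  fix z assume z: "z \<in> space D"
  have "(\<lambda>n. (F (x + (1 / real (Suc n)) *\<^sub>R b) z - F x z) / (1 / real (Suc n)))
      \<longlonglongrightarrow> b \<bullet> grad (\<lambda>y. F y z) x" for b
  proof -
    have "((\<lambda>\<tau>. F (x + \<tau> *\<^sub>R b) z) has_real_derivative (b \<bullet> grad (\<lambda>y. F y z) x)) (at 0)"
      by (rule has_real_derivative_along_line) (use deriv[OF z] in simp)
    then have "(\<lambda>\<tau>. (F (x + \<tau> *\<^sub>R b) z - F x z) / \<tau>) \<midarrow>0\<rightarrow> b \<bullet> grad (\<lambda>y. F y z) x"
      by (simp add: DERIV_def)
    moreover have "filterlim (\<lambda>n. 1 / real (Suc n)) (at 0) sequentially"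
      by (intro filterlim_atI LIMSEQ_Suc[OF lim_1_over_n] always_eventually) simp
    ultimately show ?thesis
      by (rule filterlim_compose)
  qed
  then have "(\<lambda>n. \<Sum>b\<in>Basis. ((F (x + (1 / real (Suc n)) *\<^sub>R b) z - F x z) / (1 / real (Suc n))) *\<^sub>R b)
      \<longlonglongrightarrow> (\<Sum>b\<in>Basis. (b \<bullet> grad (\<lambda>y. F y z) x) *\<^sub>R b)"
    by (intro tendsto_intros)
  then show "(\<lambda>n. \<Sum>b\<in>Basis. ((F (x + (1 / real (Suc n)) *\<^sub>R b) z - F x z) / (1 / real (Suc n))) *\<^sub>R b)
      \<longlonglongrightarrow> grad (\<lambda>y. F y z) x"
    by (simp only: inner_commute[of _ "grad (\<lambda>y. F y z) x"] euclidean_representation)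
qed

context prob_space
begin

text \<open>
  Independence enters as the statement that the joint law is a product. Integrating over the new
  sample first, with the past held fixed, plays the role of the conditional expectation.
\<close>

lemma joint_law_product_integral_zero:
  fixes \<Psi> :: "'b \<Rightarrow> 'c \<Rightarrow> real"
  assumes U: "U \<in> measurable M T" and V: "V \<in> measurable M D" and D: "distr M D V = D"
    and joint: "distr M (T \<Otimes>\<^sub>M D) (\<lambda>w. (U w, V w)) = distr M T U \<Otimes>\<^sub>M D"
    and meas: "case_prod \<Psi> \<in> borel_measurable (T \<Otimes>\<^sub>M D)"
    and int: "integrable M (\<lambda>w. \<Psi> (U w) (V w))"
    and zero: "\<And>u. u \<in> space T \<Longrightarrow> (\<integral>v. \<Psi> u v \<partial>D) = 0"
  shows "(\<integral>w. \<Psi> (U w) (V w) \<partial>M) = 0"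
proof -
  interpret TU: prob_space "distr M T U"
    by (rule prob_space_distr[OF U])
  interpret DV: prob_space D
    using prob_space_distr[OF V] by (simp add: D)
  interpret pair_prob_space "distr M T U" D ..
  have UV: "(\<lambda>w. (U w, V w)) \<in> measurable M (T \<Otimes>\<^sub>M D)"
    using U V by measurable
  have int': "integrable (distr M T U \<Otimes>\<^sub>M D) (case_prod \<Psi>)"
    unfolding joint[symmetric] integrable_distr_eq[OF UV meas] using int by simp
  have "(\<integral>w. \<Psi> (U w) (V w) \<partial>M) = (\<integral>y. case_prod \<Psi> y \<partial>distr M (T \<Otimes>\<^sub>M D) (\<lambda>w. (U w, V w)))"
    using meas by (subst integral_distr[OF UV]) simp_all
  also have "\<dots> = (\<integral>u. \<integral>v. \<Psi> u v \<partial>D \<partial>distr M T U)"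
    unfolding joint using integral_fst'[OF int'] by simp
  also have "\<dots> = (\<integral>u. 0 \<partial>distr M T U)"
    by (intro Bochner_Integration.integral_cong) (use zero in auto)
  finally show ?thesis
    by simp
qed

lemma joint_law_product_integral_le:
  fixes \<Psi> :: "'b \<Rightarrow> 'c \<Rightarrow> real"
  assumes U: "U \<in> measurable M T" and V: "V \<in> measurable M D" and D: "distr M D V = D"
    and joint: "distr M (T \<Otimes>\<^sub>M D) (\<lambda>w. (U w, V w)) = distr M T U \<Otimes>\<^sub>M D"
    and meas: "case_prod \<Psi> \<in> borel_measurable (T \<Otimes>\<^sub>M D)"
    and nonneg: "\<And>u v. 0 \<le> \<Psi> u v"
    and int: "\<And>u. u \<in> space T \<Longrightarrow> integrable D (\<Psi> u)"
    and le: "\<And>u. u \<in> space T \<Longrightarrow> (\<integral>v. \<Psi> u v \<partial>D) \<le> b" and b: "0 \<le> b"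
  shows "integrable M (\<lambda>w. \<Psi> (U w) (V w))" and "(\<integral>w. \<Psi> (U w) (V w) \<partial>M) \<le> b"
proof -
  interpret TU: prob_space "distr M T U"
    by (rule prob_space_distr[OF U])
  interpret DV: prob_space D
    using prob_space_distr[OF V] by (simp add: D)
  interpret pair_prob_space "distr M T U" D ..
  have UV: "(\<lambda>w. (U w, V w)) \<in> measurable M (T \<Otimes>\<^sub>M D)"
    using U V by measurable
  have m: "(\<lambda>x. ennreal (case_prod \<Psi> x)) \<in> borel_measurable (T \<Otimes>\<^sub>M D)"
    using meas by measurable
  have "(\<integral>\<^sup>+w. ennreal (\<Psi> (U w) (V w)) \<partial>M)
      = (\<integral>\<^sup>+y. ennreal (case_prod \<Psi> y) \<partial>distr M (T \<Otimes>\<^sub>M D) (\<lambda>w. (U w, V w)))"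
    using m by (subst nn_integral_distr[OF UV]) simp_all
  also have "\<dots> = (\<integral>\<^sup>+u. \<integral>\<^sup>+v. ennreal (\<Psi> u v) \<partial>D \<partial>distr M T U)"
    unfolding joint using DV.nn_integral_fst[of "\<lambda>x. ennreal (case_prod \<Psi> x)" "distr M T U"] m
    by simp
  also have "\<dots> \<le> (\<integral>\<^sup>+u. ennreal b \<partial>distr M T U)"
    using int le nonneg by (intro nn_integral_mono) (auto simp: nn_integral_eq_integral ennreal_leI)
  also have "\<dots> = ennreal b"
    using TU.emeasure_space_1 by simp
  finally have *: "(\<integral>\<^sup>+w. ennreal (\<Psi> (U w) (V w)) \<partial>M) \<le> ennreal b" .
  have meas': "(\<lambda>w. \<Psi> (U w) (V w)) \<in> borel_measurable M"
    using measurable_compose[OF UV meas] by simp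
  show "integrable M (\<lambda>w. \<Psi> (U w) (V w))"
    using * meas' nonneg by (intro integrableI_nonneg) (auto intro: le_less_trans)
  show "(\<integral>w. \<Psi> (U w) (V w) \<partial>M) \<le> b"
    using * nonneg b meas' by (simp add: integral_eq_nn_integral enn2real_leI)
qed

text \<open>
  The predicate \<open>indep_var\<close> relates two variables of the same range type. Therefore \<open>X q\<close> is first
  regarded as a family with the single index \<open>q\<close>.
\<close>

lemma indep_vars_joint_law:
  assumes ind: "indep_vars (\<lambda>_. D) X I" and A: "A \<subseteq> I" and q: "q \<in> I" "q \<notin> A"
    and D: "distr M D (X q) = D"
  defines "T \<equiv> Pi\<^sub>M A (\<lambda>_. D)" and "U \<equiv> (\<lambda>w. restrict (\<lambda>i. X i w) A)"
  shows "U \<in> measurable M T" and "X q \<in> measurable M D"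
    and "distr M (T \<Otimes>\<^sub>M D) (\<lambda>w. (U w, X q w)) = distr M T U \<Otimes>\<^sub>M D"
proof -
  let ?T' = "Pi\<^sub>M {q} (\<lambda>_. D)" and ?V = "\<lambda>w. restrict (\<lambda>i. X i w) {q}"
  have ind': "indep_var T U ?T' ?V"
    unfolding T_def U_def by (rule indep_var_restrict[OF ind]) (use A q in auto)
  show U: "U \<in> measurable M T"
    using ind' by (rule indep_var_rv1)
  have V: "?V \<in> measurable M ?T'"
    using ind' by (rule indep_var_rv2)
  have proj: "(\<lambda>v. v q) \<in> measurable ?T' D"
    by measurable
  show Xq: "X q \<in> measurable M D"
    using measurable_compose[OF V proj] by simp
  have distr_V: "distr (distr M ?T' ?V) D (\<lambda>v. v q) = D"
    using distr_distr[OF proj V] D by (simp add: o_def)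
  interpret DD: prob_space D
    using prob_space_distr[OF Xq] by (simp add: D)
  have "distr M T U \<Otimes>\<^sub>M D = distr (distr M T U) T (\<lambda>u. u) \<Otimes>\<^sub>M distr (distr M ?T' ?V) D (\<lambda>v. v q)"
    unfolding distr_V by (simp add: distr_id2)
  also have "\<dots> = distr (distr M T U \<Otimes>\<^sub>M distr M ?T' ?V) (T \<Otimes>\<^sub>M D) (\<lambda>(u, v). (u, v q))"
    by (rule pair_measure_distr) (use DD.sigma_finite_measure_axioms in \<open>simp_all add: distr_V\<close>)
  also have "distr M T U \<Otimes>\<^sub>M distr M ?T' ?V = distr M (T \<Otimes>\<^sub>M ?T') (\<lambda>w. (U w, ?V w))"
    using ind' by (simp add: indep_var_distribution_eq)
  also have "distr \<dots> (T \<Otimes>\<^sub>M D) (\<lambda>(u, v). (u, v q)) = distr M (T \<Otimes>\<^sub>M D) (\<lambda>w. (U w, X q w))"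
    using U V by (subst distr_distr) (auto simp: o_def intro!: measurable_Pair)
  finally show "distr M (T \<Otimes>\<^sub>M D) (\<lambda>w. (U w, X q w)) = distr M T U \<Otimes>\<^sub>M D"
    by simp
qed

end

section \<open>The random run\<close>

locale slam_sampling =
  slam_method r L\<^sub>r f g B\<^sub>g F "space D" L N p \<alpha> \<beta> s x0 + prob_space P
  for r :: "'a::euclidean_space \<Rightarrow> ereal" and L\<^sub>r f g B\<^sub>g and F :: "'a \<Rightarrow> 'd \<Rightarrow> real"
    and D :: "'d measure" and L N p \<alpha> \<beta> s x0 and P :: "'p measure" +
  fixes X :: "nat \<Rightarrow> nat \<Rightarrow> 'p \<Rightarrow> 'd" and \<sigma> :: real
  assumes D: "prob_space D"
    and F_measurable: "F y \<in> borel_measurable D"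
    and F_mean: "x \<in> edom r \<Longrightarrow> integrable D (F x)" "x \<in> edom r \<Longrightarrow> (\<integral>z. F x z \<partial>D) = f x"
    and grad_mean: "x \<in> edom r \<Longrightarrow> integrable D (\<lambda>z. grad (\<lambda>y. F y z) x)"
      "x \<in> edom r \<Longrightarrow> (\<integral>z. grad (\<lambda>y. F y z) x \<partial>D) = g x"
    and grad_variance: "x \<in> edom r \<Longrightarrow> integrable D (\<lambda>z. (norm (grad (\<lambda>y. F y z) x - g x))\<^sup>2)"
      "x \<in> edom r \<Longrightarrow> (\<integral>z. (norm (grad (\<lambda>y. F y z) x - g x))\<^sup>2 \<partial>D) \<le> \<sigma>\<^sup>2"
    and indep_samples: "indep_vars (\<lambda>_. D) (\<lambda>(k, i). X k i) (sample_index N)"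
    and distr_samples: "i \<in> {1..N k} \<Longrightarrow> distr P D (X k i) = D"
begin

lemma in_sample_index: "(k, i) \<in> sample_index N \<longleftrightarrow> i \<in> {1..N k}"
  by (simp add: sample_index_def)

lemma X_measurable: "i \<in> {1..N k} \<Longrightarrow> X k i \<in> measurable P D"
  using indep_samples by (auto simp: indep_vars_def2 sample_index_def)

definition samples :: "'p \<Rightarrow> nat \<Rightarrow> nat \<Rightarrow> 'd" where
  "samples w = (\<lambda>k i. X k i w)"

lemma admissible_samples: "w \<in> space P \<Longrightarrow> admissible (samples w)"
  unfolding admissible_def samples_def using measurable_space[OF X_measurable] by blast

lemma continuous_F: "z \<in> space D \<Longrightarrow> continuous_on (edom r) (\<lambda>x. F x z)"
  using GDERIV_F unfolding gderiv_def
  by (intro continuous_at_imp_continuous_on ballI) (blast intro: has_derivative_continuous)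

lemma continuous_f: "continuous_on (edom r) f"
  using GDERIV_f unfolding gderiv_def
  by (intro continuous_at_imp_continuous_on ballI) (blast intro: has_derivative_continuous)

lemma continuous_grad_F: "z \<in> space D \<Longrightarrow> continuous_on (edom r) (grad (\<lambda>y. F y z))"
  using lipschitz_F by (intro lipschitz_on_continuous_on) auto

lemma measurable_edom_continuous:
  fixes h :: "'a \<Rightarrow> 'b::metric_space"
  assumes "continuous_on (edom r) h" "a \<in> borel_measurable Q" "\<And>w. w \<in> space Q \<Longrightarrow> a w \<in> edom r"
  shows "(\<lambda>w. h (a w)) \<in> borel_measurable Q"
  using borel_measurable_continuous_fst_compose[of "edom r" "\<lambda>x _. h x" "count_space UNIV" a Q "\<lambda>_. ()"] assms
  by simp

lemma measurable_F:
  assumes "a \<in> borel_measurable Q" "\<And>w. w \<in> space Q \<Longrightarrow> a w \<in> edom r" "b \<in> measurable Q D"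
  shows "(\<lambda>w. F (a w) (b w)) \<in> borel_measurable Q"
  by (rule borel_measurable_continuous_fst_compose[OF F_measurable continuous_F assms])

lemma measurable_grad_F:
  assumes "a \<in> borel_measurable Q" "\<And>w. w \<in> space Q \<Longrightarrow> a w \<in> edom r" "b \<in> measurable Q D"
  shows "(\<lambda>w. grad (\<lambda>y. F y (b w)) (a w)) \<in> borel_measurable Q"
  by (rule borel_measurable_continuous_fst_compose[OF borel_measurable_grad[OF F_measurable GDERIV_F]
      continuous_grad_F assms])

lemma measurable_f:
  assumes "a \<in> borel_measurable Q" "\<And>w. w \<in> space Q \<Longrightarrow> a w \<in> edom r"
  shows "(\<lambda>w. f (a w)) \<in> borel_measurable Q"
  by (rule measurable_edom_continuous[OF continuous_f assms])

lemma measurable_g: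
  assumes "a \<in> borel_measurable Q" "\<And>w. w \<in> space Q \<Longrightarrow> a w \<in> edom r"
  shows "(\<lambda>w. g (a w)) \<in> borel_measurable Q"
  by (rule measurable_edom_continuous[OF lipschitz_on_continuous_on[OF lipschitz_g] assms])

lemma measurable_\<rho>:
  assumes "a \<in> borel_measurable Q" "\<And>w. w \<in> space Q \<Longrightarrow> a w \<in> edom r"
  shows "(\<lambda>w. \<rho> (a w)) \<in> borel_measurable Q"
  by (rule measurable_edom_continuous[OF lipschitz_on_continuous_on[OF lipschitz] assms])

lemma measurable_step:
  assumes "0 < t" and [measurable]: "d \<in> borel_measurable Q" "a \<in> borel_measurable Q"
  shows "(\<lambda>w. step (d w) (a w) t) \<in> borel_measurable Q"
proof -
  have "1-lipschitz_on UNIV (prox t r)"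
    using prox_nonexpansive[OF assms(1)] by (auto intro!: lipschitz_onI simp: dist_norm)
  then have "continuous_on UNIV (prox t r)"
    by (rule lipschitz_on_continuous_on)
  then show ?thesis
    unfolding step_def by (rule borel_measurable_continuous_on) measurable
qed

text \<open>
  The sample arrays considered here are measurable images of a general measure space, so that the
  result applies both to the whole space and to the finitely many samples of the past. All step
  sizes have the form \<open>\<beta>\<^sup>m s\<close>, and it is the natural exponent that is tracked: a statement about
  each of countably many exponents then suffices.
\<close>

definition measurable_array :: "'q measure \<Rightarrow> ('q \<Rightarrow> nat \<Rightarrow> nat \<Rightarrow> 'd) \<Rightarrow> bool" where
  "measurable_array Q Y \<longleftrightarrow> (\<forall>k. \<forall>i\<in>{1..N k}. (\<lambda>w. Y w k i) \<in> measurable Q D)"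

context
  fixes Q :: "'q measure" and Y
  assumes Y: "measurable_array Q Y"
begin

lemma admissible_array: "w \<in> space Q \<Longrightarrow> admissible (Y w)"
  using Y by (auto simp: admissible_def measurable_array_def dest: measurable_space)

lemma measurable_batch_fun:
  assumes "a \<in> borel_measurable Q" "\<And>w. w \<in> space Q \<Longrightarrow> a w \<in> edom r"
  shows "(\<lambda>w. batch_fun F N (Y w) k (a w)) \<in> borel_measurable Q"
  unfolding batch_fun_def using Y assms
  by (intro borel_measurable_times borel_measurable_const borel_measurable_sum measurable_F)
     (auto simp: measurable_array_def)

lemma measurable_batch_grad:
  assumes "a \<in> borel_measurable Q" "\<And>w. w \<in> space Q \<Longrightarrow> a w \<in> edom r"
  shows "(\<lambda>w. batch_grad F N (Y w) k (a w)) \<in> borel_measurable Q"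
  unfolding batch_grad_def using Y assms
  by (intro borel_measurable_scaleR borel_measurable_const borel_measurable_sum measurable_grad_F)
     (auto simp: measurable_array_def)

lemma measurable_state:
  "\<exists>m. m \<in> measurable Q (count_space UNIV) \<and> (\<forall>w\<in>space Q. snd (state (Y w) k) = \<beta> ^ m w * s)
     \<and> (\<lambda>w. iterate (Y w) k) \<in> borel_measurable Q"
proof (induction k)
  case 0
  show ?case
    by (rule exI[of _ "\<lambda>_. 0"]) (simp add: slam_def)
next
  case (Suc k)
  then obtain m where m: "m \<in> measurable Q (count_space UNIV)"
      "\<And>w. w \<in> space Q \<Longrightarrow> snd (state (Y w) k) = \<beta> ^ m w * s"
    and x: "(\<lambda>w. iterate (Y w) k) \<in> borel_measurable Q"
    by blast
  define x where "x w = iterate (Y w) k" for w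
  define d where "d w = batch_grad F N (Y w) k (x w)" for w
  define m0 where "m0 = (if cycle_start p k then (\<lambda>_. 0) else m)"
  define acc where "acc n w = sufficient_decrease r F N \<alpha> (Y w) k (x w) (\<beta> ^ n * s)" for n w
  define l where "l w = (LEAST j. acc (j + m0 w) w)" for w
  have x_meas: "x \<in> borel_measurable Q" and x_edom: "w \<in> space Q \<Longrightarrow> x w \<in> edom r" for w
    using x iterate_in_edom[OF admissible_array] by (simp_all add: x_def[abs_def])
  have d_meas: "d \<in> borel_measurable Q"
    unfolding d_def by (rule measurable_batch_grad[OF x_meas x_edom])
  have m0: "m0 \<in> measurable Q (count_space UNIV)"
    using m(1) by (simp add: m0_def)
  have init: "init_stepsize (Y w) k = \<beta> ^ m0 w * s" if "w \<in> space Q" for w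
    using m(2)[OF that] by (simp add: init_stepsize_def m0_def)
  have pos: "0 < \<beta> ^ n * s" for n
    using \<beta> s_pos by simp
  have acc: "Measurable.pred Q (acc n)" for n
  proof -
    define y where "y w = step (d w) (x w) (\<beta> ^ n * s)" for w
    have y: "y \<in> borel_measurable Q" "\<And>w. y w \<in> edom r"
      unfolding y_def using measurable_step[OF pos d_meas x_meas] step_in_edom[OF pos] by auto
    note [measurable] = x_meas y(1) measurable_batch_fun[OF y] measurable_batch_fun[OF x_meas x_edom]
      measurable_\<rho>[OF y] measurable_\<rho>[OF x_meas x_edom]
    have "Measurable.pred Q (\<lambda>w. batch_fun F N (Y w) k (y w) + \<rho> (y w)
          - (batch_fun F N (Y w) k (x w) + \<rho> (x w)) \<le> - (\<alpha> / (\<beta> ^ n * s)) * (norm (x w - y w))\<^sup>2)"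
      by measurable
    then show ?thesis
      by (rule measurable_cong[THEN iffD1, rotated])
         (simp only: acc_def sufficient_decrease_iff[OF pos x_edom] Let_def y_def d_def)
  qed
  have l: "l \<in> measurable Q (count_space UNIV)"
    unfolding l_def
  proof (rule measurable_Least)
    fix j
    show "(\<lambda>w. acc (j + m0 w) w) \<in> measurable Q (count_space UNIV)"
      by (rule measurable_compose_countable[OF acc]) (use m0 in measurable)
  qed
  have step: "stepsize (Y w) k = \<beta> ^ (l w + m0 w) * s" if "w \<in> space Q" for w
    unfolding stepsize_eq_backtrack backtrack_def init[OF that] x_def[symmetric]
    by (simp add: l_def acc_def power_add mult.assoc)
  have lm: "(\<lambda>w. l w + m0 w) \<in> measurable Q (count_space UNIV)"
    using l m0 by measurable
  have "(\<lambda>w. step (d w) (x w) (\<beta> ^ (l w + m0 w) * s)) \<in> borel_measurable Q"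
    by (rule measurable_compose_countable[OF measurable_step[OF pos d_meas x_meas] lm])
  then have "(\<lambda>w. iterate (Y w) (Suc k)) \<in> borel_measurable Q"
    by (rule measurable_cong[THEN iffD1, rotated])
       (simp add: iterate_Suc step d_def x_def)
  then show ?case
    using lm step by (intro exI[of _ "\<lambda>w. l w + m0 w"]) (simp add: stepsize_def)
qed

lemma measurable_iterate: "(\<lambda>w. iterate (Y w) k) \<in> borel_measurable Q"
  using measurable_state by blast

lemma measurable_reference_point: "(\<lambda>w. reference_point (Y w) k) \<in> borel_measurable Q"
proof -
  obtain m where m: "m \<in> measurable Q (count_space UNIV)"
      "\<And>w. w \<in> space Q \<Longrightarrow> snd (state (Y w) k) = \<beta> ^ m w * s"
    using measurable_state by blast
  define m0 where "m0 = (if cycle_start p k then (\<lambda>_. 0) else m)"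
  have m0: "m0 \<in> measurable Q (count_space UNIV)"
    using m(1) by (simp add: m0_def)
  have init: "init_stepsize (Y w) k = \<beta> ^ m0 w * s" if "w \<in> space Q" for w
    using m(2)[OF that] by (simp add: init_stepsize_def m0_def)
  have pos: "0 < \<beta> ^ n * s" for n
    using \<beta> s_pos by simp
  have "(\<lambda>w. step (g (iterate (Y w) k)) (iterate (Y w) k) (\<beta> ^ n * s)) \<in> borel_measurable Q" for n
    by (intro measurable_step pos measurable_g measurable_iterate iterate_in_edom admissible_array)
  then have "(\<lambda>w. step (g (iterate (Y w) k)) (iterate (Y w) k) (\<beta> ^ m0 w * s)) \<in> borel_measurable Q"
    by (rule measurable_compose_countable[OF _ m0])
  then show ?thesis
    by (rule measurable_cong[THEN iffD1, rotated]) (simp add: reference_point_def init)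
qed

lemma measurable_residual: "(\<lambda>w. residual (iterate (Y w) k)) \<in> borel_measurable Q"
proof -
  have [measurable]: "(\<lambda>w. step (g (iterate (Y w) k)) (iterate (Y w) k) s) \<in> borel_measurable Q"
    by (intro measurable_step s_pos measurable_g measurable_iterate iterate_in_edom admissible_array)
  note measurable_iterate[measurable]
  show ?thesis
    unfolding residual_eq by measurable
qed

end

lemma measurable_array_samples: "measurable_array P samples"
  using X_measurable by (simp add: measurable_array_def samples_def)

lemma state_cong:
  assumes "\<And>j i. j < k \<Longrightarrow> i \<in> {1..N j} \<Longrightarrow> z j i = z' j i"
  shows "state z k = state z' k"
  using assms
proof (induction k)
  case (Suc k)
  have 1: "state z k = state z' k"
    by (rule Suc.IH) (use Suc.prems in simp)
  have 2: "batch_fun F N z k = batch_fun F N z' k" "batch_grad F N z k = batch_grad F N z' k"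
    unfolding batch_fun_def batch_grad_def using Suc.prems[of k] by (auto simp: fun_eq_iff)
  show ?case
    unfolding slam_state.simps 1 backtrack_def sufficient_decrease_def batch_obj_def trial_point_def 2 ..
qed simp

lemma iterate_cong:
  assumes "\<And>j i. j < k \<Longrightarrow> i \<in> {1..N j} \<Longrightarrow> z j i = z' j i"
  shows "iterate z k = iterate z' k" and "reference_point z k = reference_point z' k"
  using state_cong[of k z z'] assms
  by (simp_all add: slam_def reference_point_def init_stepsize_def)

definition past :: "nat \<Rightarrow> (nat \<times> nat) set" where
  "past k = {(j, i). j < k \<and> i \<in> {1..N j}}"

text \<open>Indices outside \<open>A\<close> receive an arbitrary admissible sample, so that the array is total.\<close>

definition fill :: "(nat \<times> nat) set \<Rightarrow> (nat \<times> nat \<Rightarrow> 'd) \<Rightarrow> nat \<Rightarrow> nat \<Rightarrow> 'd" where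
  "fill A u j i = (if (j, i) \<in> A then u (j, i) else (SOME z. z \<in> space D))"

lemma measurable_array_fill: "measurable_array (Pi\<^sub>M A (\<lambda>_. D)) (fill A)"
  unfolding measurable_array_def
proof (intro allI ballI)
  fix k i
  have "space D \<noteq> {}"
    using D by (rule prob_space.not_empty)
  then have "(SOME z. z \<in> space D) \<in> space D"
    by (rule some_in_eq[THEN iffD2])
  then show "(\<lambda>u. fill A u k i) \<in> measurable (Pi\<^sub>M A (\<lambda>_. D)) D"
    by (cases "(k, i) \<in> A") (simp_all add: fill_def)
qed

lemma fill_restrict:
  assumes "past k \<subseteq> A"
  shows "iterate (fill A (restrict (\<lambda>(j, i). X j i w) A)) k = iterate (samples w) k"
    and "reference_point (fill A (restrict (\<lambda>(j, i). X j i w) A)) k = reference_point (samples w) k"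
  using assms by (intro iterate_cong; force simp: fill_def samples_def past_def)+

end

section \<open>Moments of the sampling errors\<close>

context slam_sampling
begin

definition sample_error :: "'a \<Rightarrow> 'd \<Rightarrow> 'a" where
  "sample_error x z = g x - grad (\<lambda>y. F y z) x"

lemma sample_error_moments:
  assumes x: "x \<in> edom r"
  shows "integrable D (sample_error x)" and "(\<integral>z. sample_error x z \<partial>D) = 0"
    and "integrable D (\<lambda>z. (norm (sample_error x z))\<^sup>2)"
    and "(\<integral>z. (norm (sample_error x z))\<^sup>2 \<partial>D) \<le> \<sigma>\<^sup>2"
proof -
  interpret D: prob_space D
    by (rule D)
  show "integrable D (sample_error x)" "(\<integral>z. sample_error x z \<partial>D) = 0"
    unfolding sample_error_def using grad_mean[OF x] by (simp_all add: D.prob_space)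
  show "integrable D (\<lambda>z. (norm (sample_error x z))\<^sup>2)"
    "(\<integral>z. (norm (sample_error x z))\<^sup>2 \<partial>D) \<le> \<sigma>\<^sup>2"
    using grad_variance[OF x] unfolding sample_error_def by (simp_all add: norm_minus_commute)
qed

lemma measurable_sample_error:
  assumes "a \<in> borel_measurable Q" "\<And>w. w \<in> space Q \<Longrightarrow> a w \<in> edom r" "b \<in> measurable Q D"
  shows "(\<lambda>w. sample_error (a w) (b w)) \<in> borel_measurable Q"
  unfolding sample_error_def
  by (intro borel_measurable_diff measurable_g measurable_grad_F assms)

definition sample_value_error :: "'a \<Rightarrow> 'a \<Rightarrow> 'd \<Rightarrow> real" where
  "sample_value_error x y z = (f y - f x) - (F y z - F x z)"

lemma measurable_sample_value_error:
  assumes "a \<in> borel_measurable Q" "\<And>w. w \<in> space Q \<Longrightarrow> a w \<in> edom r"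
    "a' \<in> borel_measurable Q" "\<And>w. w \<in> space Q \<Longrightarrow> a' w \<in> edom r" "b \<in> measurable Q D"
  shows "(\<lambda>w. sample_value_error (a w) (a' w) (b w)) \<in> borel_measurable Q"
  unfolding sample_value_error_def
  by (intro borel_measurable_diff measurable_f measurable_F assms)

text \<open>
  The absolute moments of \<open>F x\<close> may be unbounded over the domain, but those of its increments over a
  bounded distance are not, by the descent lemma and the variance bound for the gradient.
\<close>

lemma sample_value_error_moments:
  assumes x: "x \<in> edom r" and y: "y \<in> edom r" and d: "norm (y - x) \<le> d"
  shows "integrable D (sample_value_error x y)" and "(\<integral>z. sample_value_error x y z \<partial>D) = 0"
    and "(\<integral>z. \<bar>sample_value_error x y z\<bar> \<partial>D) \<le> d * (1 + \<sigma>\<^sup>2) + L * d\<^sup>2"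
proof -
  interpret D: prob_space D
    by (rule D)
  show int: "integrable D (sample_value_error x y)"
    and "(\<integral>z. sample_value_error x y z \<partial>D) = 0"
    unfolding sample_value_error_def using F_mean[OF x] F_mean[OF y] by (simp_all add: D.prob_space)
  have d0: "0 \<le> d"
    using d norm_ge_zero[of "y - x"] by linarith
  have bound: "\<bar>sample_value_error x y z\<bar> \<le> d * (1 + (norm (sample_error x z))\<^sup>2) + L * d\<^sup>2"
    if z: "z \<in> space D" for z
  proof -
    define E where "E u = f u - F u z" for u
    have deriv: "GDERIV E u :> sample_error u z" if "u \<in> edom r" for u
      unfolding E_def sample_error_def by (intro GDERIV_diff GDERIV_f GDERIV_F that z)
    have lip: "(2 * L)-lipschitz_on (edom r) (\<lambda>u. sample_error u z)"
      unfolding sample_error_def using lipschitz_on_diff[OF lipschitz_g lipschitz_F[OF z]] by simp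
    have deriv': "GDERIV (\<lambda>u. - E u) u :> - sample_error u z" if "u \<in> edom r" for u
      by (intro GDERIV_minus deriv that)
    have lip': "(2 * L)-lipschitz_on (edom r) (\<lambda>u. - sample_error u z)"
      using lip by (simp add: lipschitz_on_minus)
    have "\<bar>E y - E x\<bar> \<le> \<bar>(y - x) \<bullet> sample_error x z\<bar> + L * (norm (y - x))\<^sup>2"
      using descent_lemma[OF convex_edom deriv lip x y] descent_lemma[OF convex_edom deriv' lip' x y]
        abs_ge_self[of "(y - x) \<bullet> sample_error x z"] abs_ge_minus_self[of "(y - x) \<bullet> sample_error x z"]
      by (intro abs_leI) simp_all
    also have "\<dots> \<le> norm (y - x) * norm (sample_error x z) + L * (norm (y - x))\<^sup>2"
      using Cauchy_Schwarz_ineq2 by (simp add: mult.commute)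
    also have "\<dots> \<le> d * (1 + (norm (sample_error x z))\<^sup>2) + L * d\<^sup>2"
    proof (intro add_mono mult_mono mult_left_mono power_mono d)
      show "norm (sample_error x z) \<le> 1 + (norm (sample_error x z))\<^sup>2"
        using sum_squares_bound[of "norm (sample_error x z)" 1] norm_ge_zero[of "sample_error x z"]
        unfolding one_power2 by linarith
    qed (use d0 L_pos in auto)
    finally show ?thesis
      by (simp add: E_def sample_value_error_def algebra_simps)
  qed
  have "(\<integral>z. \<bar>sample_value_error x y z\<bar> \<partial>D)
      \<le> (\<integral>z. d * (1 + (norm (sample_error x z))\<^sup>2) + L * d\<^sup>2 \<partial>D)"
    using int sample_error_moments(3)[OF x] bound by (intro integral_mono) auto
  also have "\<dots> = d * (1 + (\<integral>z. (norm (sample_error x z))\<^sup>2 \<partial>D)) + L * d\<^sup>2"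
    using sample_error_moments(3)[OF x] by (simp add: D.prob_space)
  also have "\<dots> \<le> d * (1 + \<sigma>\<^sup>2) + L * d\<^sup>2"
    using sample_error_moments(4)[OF x] d0 L_pos by (intro add_mono mult_left_mono) auto
  finally show "(\<integral>z. \<bar>sample_value_error x y z\<bar> \<partial>D) \<le> d * (1 + \<sigma>\<^sup>2) + L * d\<^sup>2" .
qed

definition observed :: "(nat \<times> nat) set \<Rightarrow> 'p \<Rightarrow> nat \<times> nat \<Rightarrow> 'd" where
  "observed A w = restrict (\<lambda>(j, i). X j i w) A"

lemma observed_joint_law:
  assumes A: "A \<subseteq> sample_index N" and i: "i \<in> {1..N k}" "(k, i) \<notin> A"
  shows "observed A \<in> measurable P (Pi\<^sub>M A (\<lambda>_. D))"
    and "distr P (Pi\<^sub>M A (\<lambda>_. D) \<Otimes>\<^sub>M D) (\<lambda>w. (observed A w, X k i w))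
         = distr P (Pi\<^sub>M A (\<lambda>_. D)) (observed A) \<Otimes>\<^sub>M D"
proof -
  have eq: "observed A = (\<lambda>w. restrict (\<lambda>q. (case q of (k, i) \<Rightarrow> X k i) w) A)"
    by (auto simp: observed_def fun_eq_iff restrict_def)
  have q: "(k, i) \<in> sample_index N"
    using i by (simp add: in_sample_index)
  show "observed A \<in> measurable P (Pi\<^sub>M A (\<lambda>_. D))"
    "distr P (Pi\<^sub>M A (\<lambda>_. D) \<Otimes>\<^sub>M D) (\<lambda>w. (observed A w, X k i w))
         = distr P (Pi\<^sub>M A (\<lambda>_. D)) (observed A) \<Otimes>\<^sub>M D"
    using indep_vars_joint_law[OF indep_samples A q i(2)] distr_samples[OF i(1)]
    unfolding eq by simp_all
qed

text \<open>
  A point \<open>a\<close> that depends only on samples with index in \<open>A\<close> may be treated as a constant when the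
  moments of the error of a sample outside \<open>A\<close> are computed.
\<close>

context
  fixes A :: "(nat \<times> nat) set" and a :: "(nat \<times> nat \<Rightarrow> 'd) \<Rightarrow> 'a"
  assumes A: "A \<subseteq> sample_index N"
    and a: "a \<in> borel_measurable (Pi\<^sub>M A (\<lambda>_. D))"
    and a_edom: "\<And>u. u \<in> space (Pi\<^sub>M A (\<lambda>_. D)) \<Longrightarrow> a u \<in> edom r"
begin

lemma measurable_pair_point:
  "(\<lambda>x. a (fst x)) \<in> borel_measurable (Pi\<^sub>M A (\<lambda>_. D) \<Otimes>\<^sub>M D)"
  "x \<in> space (Pi\<^sub>M A (\<lambda>_. D) \<Otimes>\<^sub>M D) \<Longrightarrow> a (fst x) \<in> edom r"
  using measurable_compose[OF measurable_fst a] a_edom by (auto simp: space_pair_measure)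

lemma expected_square_sample_error:
  assumes i: "i \<in> {1..N k}" "(k, i) \<notin> A"
  shows "integrable P (\<lambda>w. (norm (sample_error (a (observed A w)) (X k i w)))\<^sup>2)"
    and "(\<integral>w. (norm (sample_error (a (observed A w)) (X k i w)))\<^sup>2 \<partial>P) \<le> \<sigma>\<^sup>2"
proof -
  note [measurable] = measurable_sample_error[OF measurable_pair_point measurable_snd]
  have "(\<lambda>x. (norm (sample_error (a (fst x)) (snd x)))\<^sup>2) \<in> borel_measurable (Pi\<^sub>M A (\<lambda>_. D) \<Otimes>\<^sub>M D)"
    by measurable
  then have meas: "(\<lambda>(u, v). (norm (sample_error (a u) v))\<^sup>2) \<in> borel_measurable (Pi\<^sub>M A (\<lambda>_. D) \<Otimes>\<^sub>M D)"
    by (simp add: case_prod_beta')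
  show "integrable P (\<lambda>w. (norm (sample_error (a (observed A w)) (X k i w)))\<^sup>2)"
    "(\<integral>w. (norm (sample_error (a (observed A w)) (X k i w)))\<^sup>2 \<partial>P) \<le> \<sigma>\<^sup>2"
    using joint_law_product_integral_le[OF observed_joint_law(1)[OF A i] X_measurable[OF i(1)]
        distr_samples[OF i(1)] observed_joint_law(2)[OF A i] meas, where b = "\<sigma>\<^sup>2"]
      sample_error_moments(3,4)[OF a_edom]
    by simp_all
qed

lemma measurable_sample_error_observed:
  assumes i: "i \<in> {1..N k}" "(k, i) \<notin> A"
  shows "(\<lambda>w. sample_error (a (observed A w)) (X k i w)) \<in> borel_measurable P"
  using observed_joint_law(1)[OF A i] a a_edom
  by (intro measurable_sample_error X_measurable i(1)) (auto dest: measurable_space)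

end

text \<open>
  Two samples of one batch are treated in turn: the sample \<open>j\<close> joins the observed ones, and the
  error of the sample \<open>i\<close> then has mean zero with the other factor held fixed. Integrability comes from
  the second moments, since the factor held fixed may be unbounded.
\<close>

lemma expected_product_sample_error:
  assumes A: "A \<subseteq> sample_index N" and a: "a \<in> borel_measurable (Pi\<^sub>M A (\<lambda>_. D))"
    and a_edom: "\<And>u. u \<in> space (Pi\<^sub>M A (\<lambda>_. D)) \<Longrightarrow> a u \<in> edom r"
    and i: "i \<in> {1..N k}" "(k, i) \<notin> A" and j: "j \<in> {1..N k}" "(k, j) \<notin> A" and ij: "i \<noteq> j"
  shows "integrable P (\<lambda>w. sample_error (a (observed A w)) (X k j w) \<bullet> sample_error (a (observed A w)) (X k i w))"
    and "(\<integral>w. sample_error (a (observed A w)) (X k j w) \<bullet> sample_error (a (observed A w)) (X k i w) \<partial>P) = 0"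
proof -
  let ?ei = "\<lambda>w. sample_error (a (observed A w)) (X k i w)"
  let ?ej = "\<lambda>w. sample_error (a (observed A w)) (X k j w)"
  note [measurable] = measurable_sample_error_observed[OF A a a_edom i]
    measurable_sample_error_observed[OF A a a_edom j]
  have "integrable P (\<lambda>w. (norm (?ej w))\<^sup>2 + (norm (?ei w))\<^sup>2)"
    by (intro Bochner_Integration.integrable_add expected_square_sample_error[OF A a a_edom] i j)
  then show int: "integrable P (\<lambda>w. ?ej w \<bullet> ?ei w)"
  proof (rule Bochner_Integration.integrable_bound)
    show "AE w in P. norm (?ej w \<bullet> ?ei w) \<le> norm ((norm (?ej w))\<^sup>2 + (norm (?ei w))\<^sup>2)"
    proof (intro AE_I2)
      fix w
      have "\<bar>?ej w \<bullet> ?ei w\<bar> \<le> norm (?ej w) * norm (?ei w)"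
        by (rule Cauchy_Schwarz_ineq2)
      also have "\<dots> \<le> (norm (?ej w))\<^sup>2 + (norm (?ei w))\<^sup>2"
        using sum_squares_bound[of "norm (?ej w)" "norm (?ei w)"]
          mult_nonneg_nonneg[OF norm_ge_zero[of "?ej w"] norm_ge_zero[of "?ei w"]] by linarith
      finally show "norm (?ej w \<bullet> ?ei w) \<le> norm ((norm (?ej w))\<^sup>2 + (norm (?ei w))\<^sup>2)"
        by simp
    qed
  qed measurable
  define A' where "A' = insert (k, j) A"
  define T where "T = Pi\<^sub>M A' (\<lambda>_. D)"
  have A': "A' \<subseteq> sample_index N" "(k, i) \<notin> A'"
    using A i j ij by (auto simp: A'_def in_sample_index)
  have restr: "(\<lambda>u. restrict u A) \<in> measurable T (Pi\<^sub>M A (\<lambda>_. D))"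
    unfolding T_def by (rule measurable_restrict_subset) (auto simp: A'_def)
  define b where "b u = a (restrict u A)" for u
  have b: "b \<in> borel_measurable T" and b_edom: "u \<in> space T \<Longrightarrow> b u \<in> edom r" for u
    unfolding b_def using measurable_compose[OF restr a] a_edom measurable_space[OF restr] by auto
  have comp: "(\<lambda>u. u (k, j)) \<in> measurable T D"
    unfolding T_def by (rule measurable_component_singleton) (simp add: A'_def)
  have b_obs: "b (observed A' w) = a (observed A w)" for w
  proof -
    have "A' \<inter> A = A"
      by (auto simp: A'_def)
    then show ?thesis
      by (simp only: b_def observed_def restrict_restrict)
  qed
  have [measurable]: "(\<lambda>x. b (fst x)) \<in> borel_measurable (T \<Otimes>\<^sub>M D)"
    using measurable_compose[OF measurable_fst b] .
  have b_edom': "x \<in> space (T \<Otimes>\<^sub>M D) \<Longrightarrow> b (fst x) \<in> edom r" for x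
    using b_edom by (auto simp: space_pair_measure)
  have "(\<lambda>x. sample_error (b (fst x)) (fst x (k, j)) \<bullet> sample_error (b (fst x)) (snd x))
      \<in> borel_measurable (T \<Otimes>\<^sub>M D)"
    by (intro borel_measurable_inner measurable_sample_error b_edom' measurable_compose[OF measurable_fst comp]
        measurable_snd) measurable
  then have meas: "(\<lambda>(u, v). sample_error (b u) (u (k, j)) \<bullet> sample_error (b u) v)
      \<in> borel_measurable (T \<Otimes>\<^sub>M D)"
    by (simp add: case_prod_beta')
  have obs_j: "observed A' w (k, j) = X k j w" for w
    by (simp add: observed_def A'_def)
  have "(\<integral>w. sample_error (b (observed A' w)) (observed A' w (k, j))
      \<bullet> sample_error (b (observed A' w)) (X k i w) \<partial>P) = 0"
  proof (rule joint_law_product_integral_zero[where T = T and D = D and U = "observed A'" and V = "X k i"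
        and \<Psi> = "\<lambda>u v. sample_error (b u) (u (k, j)) \<bullet> sample_error (b u) v"])
    show "observed A' \<in> measurable P T" "distr P (T \<Otimes>\<^sub>M D) (\<lambda>w. (observed A' w, X k i w))
         = distr P T (observed A') \<Otimes>\<^sub>M D"
      unfolding T_def using observed_joint_law[OF A'(1) i(1) A'(2)] by auto
    show "X k i \<in> measurable P D" "distr P D (X k i) = D"
      using X_measurable distr_samples i by auto
    show "integrable P (\<lambda>w. sample_error (b (observed A' w)) (observed A' w (k, j))
        \<bullet> sample_error (b (observed A' w)) (X k i w))"
      using int by (simp add: b_obs obs_j)
    show "(\<integral>v. sample_error (b u) (u (k, j)) \<bullet> sample_error (b u) v \<partial>D) = 0" if "u \<in> space T" for u
      using sample_error_moments[OF b_edom[OF that]] by simp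
  qed (rule meas)
  then show "(\<integral>w. ?ej w \<bullet> ?ei w \<partial>P) = 0"
    by (simp add: b_obs obs_j)
qed

text \<open>The errors of the samples of a batch are uncorrelated, so their variances add up.\<close>

lemma expected_square_batch_grad_error:
  assumes A: "A \<subseteq> sample_index N" and a: "a \<in> borel_measurable (Pi\<^sub>M A (\<lambda>_. D))"
    and a_edom: "\<And>u. u \<in> space (Pi\<^sub>M A (\<lambda>_. D)) \<Longrightarrow> a u \<in> edom r"
    and new: "\<And>i. (k, i) \<notin> A"
  shows "integrable P (\<lambda>w. (norm (batch_grad_error (samples w) k (a (observed A w))))\<^sup>2)"
    and "(\<integral>w. (norm (batch_grad_error (samples w) k (a (observed A w))))\<^sup>2 \<partial>P) \<le> \<sigma>\<^sup>2 / N k"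
proof -
  let ?e = "\<lambda>w i. sample_error (a (observed A w)) (X k i w)"
  let ?n = "real (N k)"
  have n: "0 < ?n"
    using N_pos by simp
  have "batch_grad_error (samples w) k x = (1 / ?n) *\<^sub>R (\<Sum>i = 1..N k. sample_error x (X k i w))" for w x
    using n by (simp add: batch_grad_error_def batch_grad_def samples_def sample_error_def
        sum_subtractf scaleR_diff_right sum_constant_scaleR)
  moreover have "(norm (\<Sum>j = 1..N k. ?e w j))\<^sup>2 = (\<Sum>j = 1..N k. \<Sum>i = 1..N k. ?e w j \<bullet> ?e w i)" for w
    by (simp only: power2_norm_eq_inner inner_sum_left) (simp only: inner_sum_right)
  ultimately have eq: "(norm (batch_grad_error (samples w) k (a (observed A w))))\<^sup>2
      = 1 / ?n\<^sup>2 * (\<Sum>j = 1..N k. \<Sum>i = 1..N k. ?e w j \<bullet> ?e w i)" for w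
    by (simp add: power_divide)
  have int: "integrable P (\<lambda>w. ?e w j \<bullet> ?e w i)" if "i \<in> {1..N k}" "j \<in> {1..N k}" for i j
    using expected_product_sample_error(1)[OF A a a_edom that(1) new that(2) new]
      expected_square_sample_error(1)[OF A a a_edom that(1) new]
    by (cases "i = j") (auto simp: power2_norm_eq_inner)
  show "integrable P (\<lambda>w. (norm (batch_grad_error (samples w) k (a (observed A w))))\<^sup>2)"
    unfolding eq by (intro integrable_mult_right Bochner_Integration.integrable_sum int)
  have "(\<integral>w. (norm (batch_grad_error (samples w) k (a (observed A w))))\<^sup>2 \<partial>P)
      = 1 / ?n\<^sup>2 * (\<Sum>j = 1..N k. \<Sum>i = 1..N k. \<integral>w. ?e w j \<bullet> ?e w i \<partial>P)"
  proof -
    have "(\<integral>w. (\<Sum>j = 1..N k. \<Sum>i = 1..N k. ?e w j \<bullet> ?e w i) \<partial>P)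
        = (\<Sum>j = 1..N k. \<integral>w. (\<Sum>i = 1..N k. ?e w j \<bullet> ?e w i) \<partial>P)"
      by (intro Bochner_Integration.integral_sum Bochner_Integration.integrable_sum int)
    also have "\<dots> = (\<Sum>j = 1..N k. \<Sum>i = 1..N k. \<integral>w. ?e w j \<bullet> ?e w i \<partial>P)"
      by (intro sum.cong refl Bochner_Integration.integral_sum int)
    finally show ?thesis
      unfolding eq by simp
  qed
  also have "\<dots> \<le> 1 / ?n\<^sup>2 * (\<Sum>j = 1..N k. \<Sum>i = 1..N k. if i = j then \<sigma>\<^sup>2 else 0)"
  proof (intro mult_left_mono sum_mono)
    fix i j assume ij: "j \<in> {1..N k}" "i \<in> {1..N k}"
    show "(\<integral>w. ?e w j \<bullet> ?e w i \<partial>P) \<le> (if i = j then \<sigma>\<^sup>2 else 0)"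
      using expected_product_sample_error(2)[OF A a a_edom ij(2) new ij(1) new]
        expected_square_sample_error(2)[OF A a a_edom ij(2) new]
      by (auto simp: power2_norm_eq_inner)
  qed simp
  also have "\<dots> = \<sigma>\<^sup>2 / ?n"
    using n by (simp add: power2_eq_square)
  finally show "(\<integral>w. (norm (batch_grad_error (samples w) k (a (observed A w))))\<^sup>2 \<partial>P) \<le> \<sigma>\<^sup>2 / N k" .
qed

text \<open>The bound \<open>d\<close> on the distance of the two points makes the absolute moments uniformly bounded.\<close>

lemma expected_batch_error_increment:
  assumes A: "A \<subseteq> sample_index N"
    and a: "a \<in> borel_measurable (Pi\<^sub>M A (\<lambda>_. D))" "b \<in> borel_measurable (Pi\<^sub>M A (\<lambda>_. D))"
    and edom: "\<And>u. u \<in> space (Pi\<^sub>M A (\<lambda>_. D)) \<Longrightarrow> a u \<in> edom r"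
      "\<And>u. u \<in> space (Pi\<^sub>M A (\<lambda>_. D)) \<Longrightarrow> b u \<in> edom r"
    and d: "\<And>u. u \<in> space (Pi\<^sub>M A (\<lambda>_. D)) \<Longrightarrow> norm (b u - a u) \<le> d"
    and new: "\<And>i. (k, i) \<notin> A"
  shows "integrable P (\<lambda>w. batch_error (samples w) k (b (observed A w))
                         - batch_error (samples w) k (a (observed A w)))"
    and "(\<integral>w. batch_error (samples w) k (b (observed A w))
            - batch_error (samples w) k (a (observed A w)) \<partial>P) = 0"
proof -
  let ?T = "Pi\<^sub>M A (\<lambda>_. D)"
  let ?e = "\<lambda>w i. sample_value_error (a (observed A w)) (b (observed A w)) (X k i w)"
  have n: "0 < real (N k)"
    using N_pos by simp
  have eq: "batch_error (samples w) k y - batch_error (samples w) k x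
      = 1 / real (N k) * (\<Sum>i = 1..N k. sample_value_error x y (X k i w))" for w x y
  proof -
    have S: "(\<Sum>i = 1..N k. sample_value_error x y (X k i w)) = real (N k) * (f y - f x)
        - ((\<Sum>i = 1..N k. F y (X k i w)) - (\<Sum>i = 1..N k. F x (X k i w)))"
      by (simp add: sample_value_error_def sum_subtractf)
    show ?thesis
      unfolding S batch_error_def batch_fun_def samples_def
      using n by (simp add: right_diff_distrib diff_divide_distrib)
  qed
  note pair_a = measurable_pair_point[OF A a(1) edom(1)]
    and pair_b = measurable_pair_point[OF A a(2) edom(2)]
  have e: "integrable P (\<lambda>w. ?e w i) \<and> (\<integral>w. ?e w i \<partial>P) = 0" if i: "i \<in> {1..N k}" for i
  proof
    have "(\<lambda>x. sample_value_error (a (fst x)) (b (fst x)) (snd x)) \<in> borel_measurable (?T \<Otimes>\<^sub>M D)"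
      by (rule measurable_sample_value_error[OF pair_a pair_b measurable_snd])
    then have meas: "case_prod (\<lambda>u. sample_value_error (a u) (b u)) \<in> borel_measurable (?T \<Otimes>\<^sub>M D)"
      by (simp add: case_prod_beta')
    have "(\<lambda>x. \<bar>sample_value_error (a (fst x)) (b (fst x)) (snd x)\<bar>) \<in> borel_measurable (?T \<Otimes>\<^sub>M D)"
      by (intro borel_measurable_abs measurable_sample_value_error[OF pair_a pair_b measurable_snd])
    then have meas': "(\<lambda>(u, v). \<bar>sample_value_error (a u) (b u) v\<bar>) \<in> borel_measurable (?T \<Otimes>\<^sub>M D)"
      by (simp add: case_prod_beta')
    have obs: "observed A \<in> measurable P ?T"
      by (rule observed_joint_law(1)[OF A i new])
    have m: "(\<lambda>w. ?e w i) \<in> borel_measurable P"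
      by (rule measurable_sample_value_error[OF measurable_compose[OF obs a(1)] edom(1)[OF measurable_space[OF obs]]
            measurable_compose[OF obs a(2)] edom(2)[OF measurable_space[OF obs]] X_measurable[OF i]])
    have moments: "integrable D (sample_value_error (a u) (b u))"
        "(\<integral>v. sample_value_error (a u) (b u) v \<partial>D) = 0"
        "(\<integral>v. \<bar>sample_value_error (a u) (b u) v\<bar> \<partial>D) \<le> d * (1 + \<sigma>\<^sup>2) + L * d\<^sup>2"
      if "u \<in> space ?T" for u
      by (rule sample_value_error_moments[OF edom(1)[OF that] edom(2)[OF that] d[OF that]])+
    obtain w where "w \<in> space P"
      using not_empty by blast
    then have u: "observed A w \<in> space ?T"
      by (rule measurable_space[OF obs])
    have "0 \<le> (\<integral>v. \<bar>sample_value_error (a (observed A w)) (b (observed A w)) v\<bar> \<partial>D)"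
      by simp
    then have bound: "0 \<le> d * (1 + \<sigma>\<^sup>2) + L * d\<^sup>2"
      using moments(3)[OF u] by (rule order_trans)
    have "integrable P (\<lambda>w. \<bar>?e w i\<bar>)"
      by (rule joint_law_product_integral_le(1)[OF obs X_measurable[OF i] distr_samples[OF i]
            observed_joint_law(2)[OF A i new] meas' _ _ moments(3) bound])
         (simp, rule integrable_abs[OF moments(1)])
    then show int: "integrable P (\<lambda>w. ?e w i)"
      using m by (rule integrable_abs_cancel)
    show "(\<integral>w. ?e w i \<partial>P) = 0"
      by (rule joint_law_product_integral_zero[where \<Psi> = "\<lambda>u. sample_value_error (a u) (b u)",
            OF obs X_measurable[OF i] distr_samples[OF i] observed_joint_law(2)[OF A i new] meas int moments(2)])
  qed
  show "integrable P (\<lambda>w. batch_error (samples w) k (b (observed A w))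
                         - batch_error (samples w) k (a (observed A w)))"
    unfolding eq using e by (intro integrable_mult_right Bochner_Integration.integrable_sum) auto
  show "(\<integral>w. batch_error (samples w) k (b (observed A w))
            - batch_error (samples w) k (a (observed A w)) \<partial>P) = 0"
    unfolding eq using e by (simp add: Bochner_Integration.integral_sum)
qed

section \<open>The bound on the mean squared residual\<close>

lemma iteration_moments:
  fixes k
  defines "x \<equiv> \<lambda>w. iterate (samples w) k" and "y \<equiv> \<lambda>w. reference_point (samples w) k"
  shows "integrable P (\<lambda>w. batch_error (samples w) k (y w) - batch_error (samples w) k (x w))"
    and "(\<integral>w. batch_error (samples w) k (y w) - batch_error (samples w) k (x w) \<partial>P) = 0"
    and "integrable P (\<lambda>w. (norm (batch_grad_error (samples w) k (x w)))\<^sup>2)"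
    and "(\<integral>w. (norm (batch_grad_error (samples w) k (x w)))\<^sup>2 \<partial>P) \<le> \<sigma>\<^sup>2 / N k"
    and "integrable P (\<lambda>w. (norm (batch_grad_error (samples w) k (y w)))\<^sup>2)"
    and "(\<integral>w. (norm (batch_grad_error (samples w) k (y w)))\<^sup>2 \<partial>P) \<le> \<sigma>\<^sup>2 / N k"
proof -
  let ?T = "Pi\<^sub>M (past k) (\<lambda>_. D)"
  define a where "a u = iterate (fill (past k) u) k" for u
  define b where "b u = reference_point (fill (past k) u) k" for u
  have A: "past k \<subseteq> sample_index N" and new: "(k, i) \<notin> past k" for i
    by (auto simp: past_def sample_index_def)
  have meas: "a \<in> borel_measurable ?T" "b \<in> borel_measurable ?T"
    unfolding a_def b_def
    by (intro measurable_iterate measurable_reference_point measurable_array_fill)+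
  have edom: "a u \<in> edom r" "b u \<in> edom r" if "u \<in> space ?T" for u
    unfolding a_def b_def using admissible_array[OF measurable_array_fill that]
    by (intro iterate_in_edom reference_point_in_edom, assumption)+
  have dist: "norm (b u - a u) \<le> s * (L\<^sub>r + B\<^sub>g)" if u: "u \<in> space ?T" for u
  proof -
    have adm: "admissible (fill (past k) u)"
      by (rule admissible_array[OF measurable_array_fill u])
    let ?t = "init_stepsize (fill (past k) u) k"
    have "norm (a u - b u) \<le> ?t * (L\<^sub>r + norm (g (a u)))"
      using step_length_le[OF init_stepsize_bounds(3)[OF adm] edom(1)[OF u]]
      by (simp add: a_def b_def reference_point_def)
    also have "\<dots> \<le> s * (L\<^sub>r + B\<^sub>g)"
      using init_stepsize_bounds[OF adm, of k] norm_g_le[OF edom(1)[OF u]] L\<^sub>r_nonneg s_pos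
      by (intro mult_mono) auto
    finally show ?thesis
      by (simp add: norm_minus_commute)
  qed
  have ab: "a (observed (past k) w) = x w" "b (observed (past k) w) = y w" for w
    using fill_restrict[OF order_refl] by (simp_all add: a_def b_def x_def y_def observed_def)
  show "integrable P (\<lambda>w. batch_error (samples w) k (y w) - batch_error (samples w) k (x w))"
    "(\<integral>w. batch_error (samples w) k (y w) - batch_error (samples w) k (x w) \<partial>P) = 0"
    using expected_batch_error_increment[OF A meas edom dist new] unfolding ab by simp_all
  show "integrable P (\<lambda>w. (norm (batch_grad_error (samples w) k (x w)))\<^sup>2)"
    "(\<integral>w. (norm (batch_grad_error (samples w) k (x w)))\<^sup>2 \<partial>P) \<le> \<sigma>\<^sup>2 / N k"
    using expected_square_batch_grad_error[OF A meas(1) edom(1) new] unfolding ab by simp_all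
  show "integrable P (\<lambda>w. (norm (batch_grad_error (samples w) k (y w)))\<^sup>2)"
    "(\<integral>w. (norm (batch_grad_error (samples w) k (y w)))\<^sup>2 \<partial>P) \<le> \<sigma>\<^sup>2 / N k"
    using expected_square_batch_grad_error[OF A meas(2) edom(2) new] unfolding ab by simp_all
qed

lemma integrable_square_residual: "integrable P (\<lambda>w. (residual (iterate (samples w) k))\<^sup>2)"
proof (rule integrable_const_bound)
  show "AE w in P. norm ((residual (iterate (samples w) k))\<^sup>2) \<le> (L\<^sub>r + B\<^sub>g)\<^sup>2"
    using residual_le[OF iterate_in_edom[OF admissible_samples]]
    by (intro AE_I2) (simp add: residual_def power_mono)
  show "(\<lambda>w. (residual (iterate (samples w) k))\<^sup>2) \<in> borel_measurable P"
    using measurable_residual[OF measurable_array_samples] by measurable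
qed

text \<open>
  Summing the one-step inequalities telescopes the objective values. Taking expectations removes
  the increments of the value error and turns the squared gradient errors into variances.
\<close>

lemma sum_expected_square_residual_le:
  assumes inf: "\<And>x. x \<in> edom r \<Longrightarrow> \<phi>inf \<le> f x + \<rho> x"
    and b: "\<And>n. 2 * (1 - \<alpha>) / L < s * \<beta> ^ n \<Longrightarrow> n < b"
  shows "\<alpha> * c / 2 * (\<Sum>k<K. \<integral>w. (residual (iterate (samples w) k))\<^sup>2 \<partial>P)
    \<le> (f x0 + \<rho> x0 - \<phi>inf) + (1 / (2 * L) + 3 * L * s\<^sup>2 + \<alpha> * c) * \<sigma>\<^sup>2 * (\<Sum>k<K. 1 / N k)
      + 3 * L * (s - c)\<^sup>2 * (L\<^sub>r + B\<^sub>g)\<^sup>2 * (card {k. k < K \<and> cycle_start p k} * b)"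
proof -
  define G where "G k w = (residual (iterate (samples w) k))\<^sup>2" for k w
  define V where "V k w = batch_error (samples w) k (reference_point (samples w) k)
    - batch_error (samples w) k (iterate (samples w) k)" for k w
  define E where "E k w = (norm (batch_grad_error (samples w) k (iterate (samples w) k)))\<^sup>2" for k w
  define E' where "E' k w = (norm (batch_grad_error (samples w) k (reference_point (samples w) k)))\<^sup>2" for k w
  define C1 where "C1 = 1 / (2 * L)"
  define C2 where "C2 = 3 * L * s\<^sup>2 + \<alpha> * c"
  define C3 where "C3 = 3 * L * (s - c)\<^sup>2 * (L\<^sub>r + B\<^sub>g)\<^sup>2"
  define n where "n = card {k. k < K \<and> cycle_start p k} * b"
  have C: "0 \<le> C1" "0 \<le> C2" "0 \<le> C3"
    using L_pos \<alpha> c_pos by (simp_all add: C1_def C2_def C3_def)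
  have pathwise: "(\<Sum>k<K. \<alpha> * c / 2 * G k w)
      \<le> (f x0 + \<rho> x0 - \<phi>inf) + (\<Sum>k<K. V k w + C1 * E' k w + C2 * E k w) + C3 * n"
    if w: "w \<in> space P" for w
  proof -
    let ?z = "samples w"
    have adm: "admissible ?z"
      by (rule admissible_samples[OF w])
    define \<Phi> where "\<Phi> k = f (iterate ?z k) + \<rho> (iterate ?z k)" for k
    define red where "red k = (of_bool (stepsize ?z k \<noteq> init_stepsize ?z k) :: real)" for k
    have "(\<Sum>k<K. \<alpha> * c / 2 * G k w)
        \<le> (\<Sum>k<K. (\<Phi> k - \<Phi> (Suc k)) + (V k w + C1 * E' k w + C2 * E k w) + C3 * red k)"
    proof (intro sum_mono)
      fix k
      show "\<alpha> * c / 2 * G k w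
          \<le> (\<Phi> k - \<Phi> (Suc k)) + (V k w + C1 * E' k w + C2 * E k w) + C3 * red k"
        using one_iteration[OF adm, of k]
        unfolding G_def \<Phi>_def V_def E_def E'_def C1_def C2_def C3_def red_def by linarith
    qed
    also have "\<dots> = (\<Phi> 0 - \<Phi> K) + (\<Sum>k<K. V k w + C1 * E' k w + C2 * E k w) + C3 * (\<Sum>k<K. red k)"
      by (simp only: sum.distrib sum_distrib_left sum_lessThan_telescope')
    also have "(\<Sum>k<K. red k) = real (card {k. k < K \<and> stepsize ?z k \<noteq> init_stepsize ?z k})"
    proof -
      have "{..<K} \<inter> {k. stepsize ?z k \<noteq> init_stepsize ?z k}
          = {k. k < K \<and> stepsize ?z k \<noteq> init_stepsize ?z k}"
        by auto
      then show ?thesis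
        unfolding red_def by (simp add: sum_of_bool_eq)
    qed
    also have "C3 * \<dots> \<le> C3 * real n"
      using card_reductions_le[OF adm b, of K] C(3) unfolding n_def[symmetric]
      by (intro mult_left_mono) (simp_all only: of_nat_le_iff)
    also have "\<Phi> 0 - \<Phi> K \<le> f x0 + \<rho> x0 - \<phi>inf"
      using inf[OF iterate_in_edom[OF adm, of K]] by (simp add: \<Phi>_def iterate_0)
    finally show ?thesis
      by simp
  qed
  note int = iteration_moments[folded V_def E_def E'_def]
  have intG: "integrable P (G k)" for k
    unfolding G_def by (rule integrable_square_residual)
  have "\<alpha> * c / 2 * (\<Sum>k<K. \<integral>w. G k w \<partial>P) = (\<integral>w. (\<Sum>k<K. \<alpha> * c / 2 * G k w) \<partial>P)"
    using intG by (simp add: Bochner_Integration.integral_sum sum_distrib_left)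
  also have "\<dots> \<le> (\<integral>w. (f x0 + \<rho> x0 - \<phi>inf) + (\<Sum>k<K. V k w + C1 * E' k w + C2 * E k w) + C3 * n \<partial>P)"
    using pathwise intG int by (intro integral_mono) auto
  also have "\<dots> = (f x0 + \<rho> x0 - \<phi>inf)
      + (\<Sum>k<K. (\<integral>w. V k w \<partial>P) + C1 * (\<integral>w. E' k w \<partial>P) + C2 * (\<integral>w. E k w \<partial>P)) + C3 * n"
    using int by (simp add: Bochner_Integration.integral_sum prob_space)
  also have "(\<Sum>k<K. (\<integral>w. V k w \<partial>P) + C1 * (\<integral>w. E' k w \<partial>P) + C2 * (\<integral>w. E k w \<partial>P))
      \<le> (\<Sum>k<K. 0 + C1 * (\<sigma>\<^sup>2 / N k) + C2 * (\<sigma>\<^sup>2 / N k))"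
    using int C by (intro sum_mono add_mono mult_left_mono) auto
  also have "\<dots> = (C1 + C2) * \<sigma>\<^sup>2 * (\<Sum>k<K. 1 / N k)"
  proof -
    have "0 + C1 * (\<sigma>\<^sup>2 / N k) + C2 * (\<sigma>\<^sup>2 / N k) = (C1 + C2) * \<sigma>\<^sup>2 * (1 / N k)" for k
      by (simp add: distrib_right add_divide_distrib)
    then show ?thesis
      by (simp only: sum_distrib_left)
  qed
  finally show ?thesis
    by (simp add: G_def C1_def C2_def C3_def n_def add.assoc)
qed

end

section \<open>Orders of magnitude\<close>

lemma ln_add_one_over_in_bigo:
  fixes h :: "nat \<Rightarrow> real"
  assumes h: "\<And>K. 1 \<le> K \<Longrightarrow> 0 \<le> h K" "\<And>K. 1 \<le> K \<Longrightarrow> h K \<le> A * (ln K + 1) / K" and \<Phi>: "0 < \<Phi>"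
  shows "h \<in> O(\<lambda>K. \<Phi> * ln K / K)"
proof -
  have "h \<in> O(\<lambda>K. A * (ln K + 1) / K)"
  proof (rule bigoI[where c = 1])
    show "\<forall>\<^sub>F K in sequentially. norm (h K) \<le> 1 * norm (A * (ln (real K) + 1) / real K)"
      using eventually_ge_at_top[of 1]
    proof eventually_elim
      case (elim K)
      then show ?case
        using h(1)[of K] order_trans[OF h(2) abs_ge_self, of K]
        by (simp only: real_norm_def mult_1 abs_of_nonneg)
    qed
  qed
  also have "(\<lambda>K. A * (ln (real K) + 1) / real K) \<in> O(\<lambda>K. ln (real K) / real K)"
  proof -
    have "(\<lambda>K. (ln (real K) + 1) / real K) \<in> O(\<lambda>K. ln (real K) / real K)"
      by real_asymp
    then show ?thesis
      by (cases "A = 0") (simp_all add: divide_inverse mult.assoc)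
  qed
  also have "(\<lambda>K. ln (real K) / real K) \<in> O(\<lambda>K. \<Phi> * ln (real K) / real K)"
    using \<Phi> by (simp add: divide_inverse mult.assoc)
  finally show ?thesis .
qed

context
  fixes e :: "nat \<Rightarrow> real" and A \<Phi> :: real
  assumes e: "\<And>K. 1 \<le> K \<Longrightarrow> (e K)\<^sup>2 \<le> A * (ln K + 1) / K" and A: "0 < A" and \<Phi>: "0 < \<Phi>"
begin

lemma accuracy_reached:
  assumes "0 < \<epsilon>"
  shows "\<exists>K\<ge>1. e K \<le> \<epsilon>"
proof -
  have "(\<lambda>K. A * ((ln (real K) + 1) / real K)) \<longlonglongrightarrow> A * 0"
    by (intro tendsto_mult_left) real_asymp
  then have "\<forall>\<^sub>F K in sequentially. A * ((ln (real K) + 1) / real K) < \<epsilon>\<^sup>2"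
    using assms by (intro order_tendstoD(2)) auto
  then have "\<forall>\<^sub>F K in sequentially. 1 \<le> K \<and> A * ((ln (real K) + 1) / real K) < \<epsilon>\<^sup>2"
    using eventually_ge_at_top[of 1] by eventually_elim simp
  then obtain K where K: "1 \<le> K" "A * ((ln (real K) + 1) / real K) < \<epsilon>\<^sup>2"
    using eventually_happens'[OF sequentially_bot] by blast
  then have "(e K)\<^sup>2 \<le> \<epsilon>\<^sup>2"
    using e[OF K(1)] by simp
  then show ?thesis
    using K(1) assms by (meson less_imp_le power2_le_imp_le)
qed

text \<open>
  With \<open>u = \<Phi> / \<epsilon>\<^sup>2\<close>, about \<open>(4 A / \<Phi>) u ln u\<close> iterations suffice: for this number of iterations the
  logarithm in the error bound is at most \<open>4 ln u\<close> once \<open>u\<close> is large.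
\<close>

lemma iteration_complexity_le:
  defines "B \<equiv> 4 * A / \<Phi>"
  shows "\<forall>\<^sub>F \<epsilon> in at_right 0.
    0 < \<epsilon> \<and> 0 < ln (\<Phi> / \<epsilon>\<^sup>2) \<and> real (iteration_complexity e \<epsilon>) \<le> 2 * B * (ln (\<Phi> / \<epsilon>\<^sup>2) * (\<Phi> / \<epsilon>\<^sup>2))"
proof -
  have B: "0 < B"
    using A \<Phi> by (simp add: B_def)
  have "\<forall>\<^sub>F u in at_top. 1 < u \<and> 0 < ln u \<and> 1 \<le> B * u * ln u \<and> ln (B * u * ln u + 1) + 1 \<le> 4 * ln u"
    using B by (intro eventually_conj; real_asymp)
  moreover have "filterlim (\<lambda>\<epsilon>. \<Phi> / \<epsilon>\<^sup>2) at_top (at_right 0)"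
    using \<Phi> by real_asymp
  ultimately have "\<forall>\<^sub>F \<epsilon> in at_right 0. 1 < \<Phi> / \<epsilon>\<^sup>2 \<and> 0 < ln (\<Phi> / \<epsilon>\<^sup>2)
      \<and> 1 \<le> B * (\<Phi> / \<epsilon>\<^sup>2) * ln (\<Phi> / \<epsilon>\<^sup>2)
      \<and> ln (B * (\<Phi> / \<epsilon>\<^sup>2) * ln (\<Phi> / \<epsilon>\<^sup>2) + 1) + 1 \<le> 4 * ln (\<Phi> / \<epsilon>\<^sup>2)"
    by (rule eventually_compose_filterlim)
  moreover have "\<forall>\<^sub>F \<epsilon> in at_right (0::real). 0 < \<epsilon>"
    by (rule eventually_at_right_less)
  ultimately show ?thesis
  proof eventually_elim
    case (elim \<epsilon>)
    define u where "u = \<Phi> / \<epsilon>\<^sup>2"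
    define x where "x = B * u * ln u"
    have u: "1 < u" "0 < ln u" "1 \<le> x" "ln (x + 1) + 1 \<le> 4 * ln u"
      using elim by (auto simp: u_def x_def)
    define K where "K = nat \<lceil>x\<rceil>"
    have K: "1 \<le> K" "x \<le> real K" "real K \<le> x + 1"
      using u(3) unfolding K_def by linarith+
    have "(e K)\<^sup>2 \<le> A * (ln K + 1) / K"
      by (rule e[OF K(1)])
    also have "\<dots> \<le> A * (4 * ln u) / x"
    proof (rule frac_le)
      have "ln (real K) \<le> ln (x + 1)"
        using K by simp
      then show "A * (ln (real K) + 1) \<le> A * (4 * ln u)"
        using u(4) A by (intro mult_left_mono) auto
    qed (use A u K in auto)
    also have "\<dots> = \<Phi> / u"
      using A \<Phi> u(1,2) by (simp add: x_def B_def field_simps)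
    also have "\<dots> = \<epsilon>\<^sup>2"
      using \<Phi> elim by (simp add: u_def)
    finally have "e K \<le> \<epsilon>"
      using elim by (meson less_imp_le power2_le_imp_le)
    then have "iteration_complexity e \<epsilon> \<le> K"
      using K(1) unfolding iteration_complexity_def by (intro Least_le) simp
    then have "real (iteration_complexity e \<epsilon>) \<le> 2 * x"
      using K u(3) by linarith
    then show ?case
      using elim by (simp add: x_def u_def mult_ac)
  qed
qed

lemma iteration_complexity_in_bigo:
  "(\<lambda>\<epsilon>. real (iteration_complexity e \<epsilon>)) \<in> O[at_right 0](\<lambda>\<epsilon>. ln (\<Phi> / \<epsilon>\<^sup>2) * (\<Phi> / \<epsilon>\<^sup>2))"
proof (rule bigoI)
  show "\<forall>\<^sub>F \<epsilon> in at_right 0. norm (real (iteration_complexity e \<epsilon>))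
      \<le> 2 * (4 * A / \<Phi>) * norm (ln (\<Phi> / \<epsilon>\<^sup>2) * (\<Phi> / \<epsilon>\<^sup>2))"
    using iteration_complexity_le
  proof eventually_elim
    case (elim \<epsilon>)
    then have "0 < ln (\<Phi> / \<epsilon>\<^sup>2)"
      by blast
    then have "norm (ln (\<Phi> / \<epsilon>\<^sup>2) * (\<Phi> / \<epsilon>\<^sup>2)) = ln (\<Phi> / \<epsilon>\<^sup>2) * (\<Phi> / \<epsilon>\<^sup>2)"
      using \<Phi> by (simp add: abs_mult)
    then show ?case
      using elim by simp
  qed
qed

lemma sample_complexity_in_bigo:
  "(\<lambda>\<epsilon>. real (sample_complexity (\<lambda>k. k + 1) e \<epsilon>))
     \<in> O[at_right 0](\<lambda>\<epsilon>. (ln (\<Phi> / \<epsilon>\<^sup>2))\<^sup>2 * (\<Phi>\<^sup>2 / \<epsilon> ^ 4))"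
proof -
  have le: "sample_complexity (\<lambda>k. k + 1) e \<epsilon> \<le> (iteration_complexity e \<epsilon>)\<^sup>2" for \<epsilon>
  proof -
    have "(\<Sum>k<n. k + 1) \<le> (\<Sum>k<n. n)" for n :: nat
      by (intro sum_mono) simp
    then show ?thesis
      by (simp add: sample_complexity_def power2_eq_square)
  qed
  have "(\<lambda>\<epsilon>. real (sample_complexity (\<lambda>k. k + 1) e \<epsilon>))
      \<in> O[at_right 0](\<lambda>\<epsilon>. (real (iteration_complexity e \<epsilon>))\<^sup>2)"
    using le by (intro bigoI[where c = 1] always_eventually allI) (simp flip: of_nat_power)
  also have "(\<lambda>\<epsilon>. (real (iteration_complexity e \<epsilon>))\<^sup>2)
      \<in> O[at_right 0](\<lambda>\<epsilon>. (ln (\<Phi> / \<epsilon>\<^sup>2) * (\<Phi> / \<epsilon>\<^sup>2))\<^sup>2)"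
    by (rule landau_o.big_power[OF iteration_complexity_in_bigo])
  also have "(\<lambda>\<epsilon>. (ln (\<Phi> / \<epsilon>\<^sup>2) * (\<Phi> / \<epsilon>\<^sup>2))\<^sup>2) = (\<lambda>\<epsilon>. (ln (\<Phi> / \<epsilon>\<^sup>2))\<^sup>2 * (\<Phi>\<^sup>2 / \<epsilon> ^ 4))"
    by (simp add: power_mult_distrib power_divide)
  finally show ?thesis .
qed

end

section \<open>Counting samples and cycles\<close>

lemma sum_inverse_le_ln:
  assumes "1 \<le> K"
  shows "(\<Sum>k<K. 1 / real (k + 1)) \<le> ln (real K) + 1"
  using assms
proof (induction K rule: nat_induct_at_least)
  case (Suc K)
  have "ln (real K / real (Suc K)) \<le> real K / real (Suc K) - 1"
    using Suc.hyps by (intro ln_le_minus_one) simp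
  also have "\<dots> = - 1 / real (Suc K)"
    by (simp add: field_simps)
  finally have "ln (real K) + 1 / real (Suc K) \<le> ln (real (Suc K))"
    using Suc.hyps by (simp add: ln_div)
  then show ?case
    using Suc.IH by simp
qed simp

text \<open>The cycle \<open>j\<close> starts at \<open>(2\<^sup>j - 1) l0\<close>, which is less than \<open>K\<close> iff \<open>2\<^sup>j < (l0 + K) / l0\<close>.\<close>

lemma card_doubling_cycle_starts_le:
  fixes l0 K :: nat
  assumes l0: "0 < l0"
  shows "card {k. k < K \<and> cycle_start (\<lambda>j. 2 ^ j * l0) k} \<le> nat \<lceil>log 2 ((l0 + K) / l0)\<rceil>"
proof -
  let ?start = "\<lambda>j::nat. \<Sum>i<j. 2 ^ i * l0"
  have start: "?start j + l0 = 2 ^ j * l0" for j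
    by (induction j) auto
  have "{k. k < K \<and> cycle_start (\<lambda>j. 2 ^ j * l0) k} \<subseteq> ?start ` {..<nat \<lceil>log 2 ((l0 + K) / l0)\<rceil>}"
  proof
    fix k assume "k \<in> {k. k < K \<and> cycle_start (\<lambda>j. 2 ^ j * l0) k}"
    then obtain j where j: "k = ?start j" "?start j < K"
      by (auto simp: cycle_start_def)
    then have "2 ^ j * l0 < l0 + K"
      using start[of j] by linarith
    then have "real (2 ^ j * l0) < real (l0 + K)"
      by (simp only: of_nat_less_iff)
    then have "2 ^ j < real (l0 + K) / l0"
      using l0 by (simp add: pos_less_divide_eq)
    then have "real j < log 2 ((l0 + K) / l0)"
      by (intro less_log_of_power) auto
    then have "j < nat \<lceil>log 2 ((l0 + K) / l0)\<rceil>"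
      by linarith
    then show "k \<in> ?start ` {..<nat \<lceil>log 2 ((l0 + K) / l0)\<rceil>}"
      using j(1) by blast
  qed
  from card_mono[OF _ this] card_image_le[of "{..<nat \<lceil>log 2 ((l0 + K) / l0)\<rceil>}" ?start]
  show ?thesis
    by simp
qed

lemma log_cycle_count_le:
  fixes l0 K :: nat
  assumes "0 < l0" "1 \<le> K"
  shows "real_of_int \<lceil>log 2 ((l0 + K) / l0)\<rceil> \<le> 2 * (ln K + 1)"
proof -
  have "real (l0 + K) / l0 = 1 + K / l0"
    using assms by (simp add: field_simps)
  also have "\<dots> \<le> 2 * K"
    using assms divide_left_mono[of 1 "real l0" "real K"] by simp
  finally have "log 2 ((l0 + K) / l0) \<le> log 2 (2 * K)"
    using assms by (subst log_le_cancel_iff) auto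
  also have "\<dots> = 1 + ln K / ln 2"
    using assms by (simp add: log_def ln_mult add_divide_distrib)
  also have "1 + ln K / ln 2 \<le> 1 + 2 * ln K"
  proof -
    have "1 / 2 \<le> ln (2::real)"
      using ln_le_minus_one[of "1 / 2 :: real"] by (simp add: ln_div)
    then have "ln K * 1 \<le> ln K * (2 * ln 2)"
      using assms by (intro mult_left_mono) auto
    then show ?thesis
      by (simp add: divide_le_eq)
  qed
  finally have "log 2 ((l0 + K) / l0) + 1 \<le> 2 * (ln K + 1)"
    by (simp add: distrib_left)
  with of_int_ceiling_le_add_one show ?thesis
    by (rule order_trans)
qed

section \<open>The uniformly chosen output\<close>

lemma (in prob_space) square_expectation_le:
  fixes Y :: "'a \<Rightarrow> real"
  assumes "integrable M Y" "integrable M (\<lambda>w. (Y w)\<^sup>2)"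
  shows "(\<integral>w. Y w \<partial>M)\<^sup>2 \<le> (\<integral>w. (Y w)\<^sup>2 \<partial>M)"
  using variance_positive[of Y] variance_eq[OF assms] by simp

context slam_sampling
begin

text \<open>
  The indicator of \<open>R = k\<close> and the squared residual at step \<open>k\<close> are measurable with respect to the two
  independent sigma-algebras, so the expectation of their product factors.
\<close>

lemma expected_residual_on_index:
  assumes R: "uniform_index D N P X K R" and k: "k < K"
  shows "integrable P (\<lambda>w. indicator {k} (R w) * (residual (iterate (samples w) k))\<^sup>2)"
    and "(\<integral>w. indicator {k} (R w) * (residual (iterate (samples w) k))\<^sup>2 \<partial>P)
       = 1 / K * (\<integral>w. (residual (iterate (samples w) k))\<^sup>2 \<partial>P)"
proof -
  let ?T = "Pi\<^sub>M (sample_index N) (\<lambda>_. D)"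
  let ?VR = "vimage_algebra (space P) R (count_space UNIV)"
  let ?VX = "vimage_algebra (space P) (observed (sample_index N)) ?T"
  let ?I = "\<lambda>w. indicator {k} (R w) :: real"
  define h where "h u = (residual (iterate (fill (sample_index N) u) k))\<^sup>2" for u
  define G where "G w = (residual (iterate (samples w) k))\<^sup>2" for w
  have ind: "indep_set (sets ?VR) (sets ?VX)"
    and distr: "distr P (count_space UNIV) R = measure_pmf (pmf_of_set {0..<K})"
    using R by (simp_all add: uniform_index_def observed_def[abs_def])
  have h: "h \<in> borel_measurable ?T"
    unfolding h_def by (intro borel_measurable_power measurable_residual measurable_array_fill)
  have "past k \<subseteq> sample_index N"
    by (auto simp: past_def sample_index_def)
  then have G: "G = (\<lambda>w. h (observed (sample_index N) w))"
    using fill_restrict(1)[of k "sample_index N"] by (auto simp: G_def h_def observed_def)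
  have obs: "observed (sample_index N) \<in> space P \<rightarrow> space ?T"
    by (auto simp: observed_def space_PiM PiE_def extensional_def in_sample_index
        intro!: measurable_space[OF X_measurable])
  have GV: "G \<in> borel_measurable ?VX"
    unfolding G by (rule measurable_compose[OF measurable_vimage_algebra1[OF obs] h])
  have IV: "?I \<in> borel_measurable ?VR"
    by (rule measurable_compose[OF measurable_vimage_algebra1]) auto
  have sets_sub: "sigma_sets (space P) {Y -` A \<inter> space P |A. A \<in> sets borel} \<subseteq> sets V"
    if "Y \<in> borel_measurable V" "space V = space P" for Y :: "'p \<Rightarrow> real" and V
    using sets.sigma_sets_subset[of "{Y -` A \<inter> space P |A. A \<in> sets borel}" V] measurable_sets[OF that(1)] that(2)
    by auto
  have sub: "sets ?VR \<subseteq> events" "sets ?VX \<subseteq> events"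
    using indep_setD_ev1[OF ind] indep_setD_ev2[OF ind] .
  have meas_sub: "Y \<in> borel_measurable P"
    if "Y \<in> borel_measurable V" "space V = space P" "sets V \<subseteq> events" for Y :: "'p \<Rightarrow> real" and V
    using that by (auto simp: measurable_def)
  have ind': "indep_var borel ?I borel G"
    unfolding indep_var_eq
  proof (intro conjI)
    show "?I \<in> borel_measurable P"
      by (rule meas_sub[OF IV _ sub(1)]) simp
    show "G \<in> borel_measurable P"
      by (rule meas_sub[OF GV _ sub(2)]) simp
    show "indep_set (sigma_sets (space P) {?I -` A \<inter> space P |A. A \<in> sets borel})
      (sigma_sets (space P) {G -` A \<inter> space P |A. A \<in> sets borel})"
      using ind sets_sub[OF IV] sets_sub[OF GV] unfolding indep_set_def
      by (elim indep_sets_mono_sets) (auto split: bool.split)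
  qed
  have int_G: "integrable P G"
    unfolding G_def by (rule integrable_square_residual)
  have int_I: "integrable P ?I"
  proof (rule integrable_const_bound[where B = 1])
    show "AE w in P. norm (?I w) \<le> 1"
      by (simp add: indicator_def)
    show "?I \<in> borel_measurable P"
      by (rule meas_sub[OF IV _ sub(1)]) simp
  qed
  note indep_var_integrable[OF ind' int_I int_G] indep_var_lebesgue_integral[OF ind' int_I int_G]
  moreover have "(\<integral>w. ?I w \<partial>P) = 1 / K"
  proof -
    have Rm: "R \<in> measurable P (count_space UNIV)"
      using sub(1) by (auto simp: measurable_def intro!: in_vimage_algebra[THEN subsetD[OF sub(1)]])
    have "(\<integral>w. ?I w \<partial>P) = (\<integral>y. indicator {k} y \<partial>distr P (count_space UNIV) R)"
      using Rm by (subst integral_distr) auto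
    also have "\<dots> = pmf (pmf_of_set {0..<K}) k"
      unfolding distr by (simp add: pmf.rep_eq)
    also have "\<dots> = 1 / K"
      using k by (subst pmf_of_set) auto
    finally show ?thesis .
  qed
  ultimately show "integrable P (\<lambda>w. indicator {k} (R w) * (residual (iterate (samples w) k))\<^sup>2)"
    "(\<integral>w. indicator {k} (R w) * (residual (iterate (samples w) k))\<^sup>2 \<partial>P)
       = 1 / K * (\<integral>w. (residual (iterate (samples w) k))\<^sup>2 \<partial>P)"
    by (simp_all add: G_def)
qed

lemma
  assumes R: "uniform_index D N P X K R" and K: "1 \<le> K"
  shows integrable_output_residual: "integrable P (\<lambda>w. residual (iterate (samples w) (R w)))"
    and integrable_square_output_residual: "integrable P (\<lambda>w. (residual (iterate (samples w) (R w)))\<^sup>2)"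
    and expected_square_output_residual:
      "(\<integral>w. (residual (iterate (samples w) (R w)))\<^sup>2 \<partial>P)
       = 1 / K * (\<Sum>k<K. \<integral>w. (residual (iterate (samples w) k))\<^sup>2 \<partial>P)"
proof -
  define G where "G k w = residual (iterate (samples w) k)" for k w
  have Rm: "R \<in> measurable P (count_space UNIV)"
    using R indep_setD_ev1[of "sets (vimage_algebra (space P) R (count_space UNIV))"] in_vimage_algebra[of _ "count_space UNIV" R "space P"]
    unfolding uniform_index_def measurable_def by auto
  have "G k \<in> borel_measurable P" for k
    unfolding G_def by (rule measurable_residual[OF measurable_array_samples])
  then have meas: "(\<lambda>w. G (R w) w) \<in> borel_measurable P"
    by (rule measurable_compose_countable[OF _ Rm])
  have bound: "0 \<le> G k w" "w \<in> space P \<Longrightarrow> G k w \<le> L\<^sub>r + B\<^sub>g" for k w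
    using residual_le[OF iterate_in_edom[OF admissible_samples]] by (simp_all add: G_def residual_def)
  show "integrable P (\<lambda>w. residual (iterate (samples w) (R w)))"
    using bound meas by (intro integrable_const_bound[where B = "L\<^sub>r + B\<^sub>g"]) (auto simp: G_def[symmetric])
  show "integrable P (\<lambda>w. (residual (iterate (samples w) (R w)))\<^sup>2)"
    using bound meas by (intro integrable_const_bound[where B = "(L\<^sub>r + B\<^sub>g)\<^sup>2"])
      (auto simp: G_def[symmetric] power_mono)
  have "AE k in distr P (count_space UNIV) R. k < K"
  proof -
    have "set_pmf (pmf_of_set {0..<K}) = {0..<K}"
      using K by (intro set_pmf_of_set) auto
    then have "AE k in measure_pmf (pmf_of_set {0..<K}). k < K"
      using AE_measure_pmf[of "pmf_of_set {0..<K}"] by simp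
    moreover have "distr P (count_space UNIV) R = measure_pmf (pmf_of_set {0..<K})"
      using R by (simp only: uniform_index_def)
    ultimately show ?thesis
      by metis
  qed
  then have AE: "AE w in P. R w < K"
    using Rm by (subst (asm) AE_distr_iff) auto
  have "(\<integral>w. (G (R w) w)\<^sup>2 \<partial>P) = (\<integral>w. (\<Sum>k<K. indicator {k} (R w) * (G k w)\<^sup>2) \<partial>P)"
  proof (rule integral_cong_AE)
    show "AE w in P. (G (R w) w)\<^sup>2 = (\<Sum>k<K. indicator {k} (R w) * (G k w)\<^sup>2)"
      using AE
    proof eventually_elim
      case (elim w)
      have "(\<Sum>k<K. indicator {k} (R w) * (G k w)\<^sup>2) = (\<Sum>k<K. if k = R w then (G k w)\<^sup>2 else 0)"
        by (intro sum.cong) auto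
      then show ?case
        using elim by simp
    qed
    show "(\<lambda>w. \<Sum>k<K. indicator {k} (R w) * (G k w)\<^sup>2) \<in> borel_measurable P"
      using expected_residual_on_index(1)[OF R]
      by (intro borel_measurable_sum) (auto simp: G_def)
  qed (use meas in measurable)
  also have "\<dots> = (\<Sum>k<K. \<integral>w. indicator {k} (R w) * (G k w)\<^sup>2 \<partial>P)"
    using expected_residual_on_index(1)[OF R] by (intro Bochner_Integration.integral_sum) (auto simp: G_def)
  also have "\<dots> = 1 / K * (\<Sum>k<K. \<integral>w. (G k w)\<^sup>2 \<partial>P)"
    unfolding sum_distrib_left using expected_residual_on_index(2)[OF R] by (intro sum.cong) (auto simp: G_def)
  finally show "(\<integral>w. (residual (iterate (samples w) (R w)))\<^sup>2 \<partial>P)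
       = 1 / K * (\<Sum>k<K. \<integral>w. (residual (iterate (samples w) k))\<^sup>2 \<partial>P)"
    by (simp add: G_def)
qed

text \<open>
  The batch sizes enter through a harmonic sum, the step size reductions through the logarithmic
  number of cycles and the bound per cycle. A reduction with \<open>n\<close> earlier ones in its cycle requires
  \<open>s \<beta>\<^sup>n > 2 (1 - \<alpha>) / L\<close>, so that \<open>n\<close> is below the logarithm in the bound.
\<close>

lemma expected_square_output_residual_le:
  fixes l0 :: nat
  assumes N: "N = (\<lambda>k. k + 1)" and p: "p = (\<lambda>j. 2 ^ j * l0)" and l0: "0 < l0"
    and inf: "\<And>x. x \<in> edom r \<Longrightarrow> \<phi>inf \<le> f x + \<rho> x"
    and R: "uniform_index D N P X K R" and K: "1 \<le> K"
  shows "(\<integral>w. (residual (iterate (samples w) (R w)))\<^sup>2 \<partial>P)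
    \<le> 2 * (f x0 + \<rho> x0 - \<phi>inf) / (\<alpha> * c * K)
      + (1 / L + 6 * L * s\<^sup>2 + 2 * \<alpha> * c) * \<sigma>\<^sup>2 * (ln K + 1) / (\<alpha> * c * K)
      + 6 * L * (s - c)\<^sup>2 * (L\<^sub>r + 3 * B\<^sub>g)\<^sup>2
          * real_of_int \<lceil>max (log (1 / \<beta>) (s * L / (2 * (1 - \<alpha>)))) 0 + 2\<rceil>
          * real_of_int \<lceil>log 2 ((l0 + K) / l0)\<rceil> / (\<alpha> * c * K)"
proof -
  define red where "red = \<lceil>max (log (1 / \<beta>) (s * L / (2 * (1 - \<alpha>)))) 0 + 2\<rceil>"
  define cyc where "cyc = \<lceil>log 2 ((l0 + K) / l0)\<rceil>"
  define gap where "gap = f x0 + \<rho> x0 - \<phi>inf"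
  define E where "E = (\<Sum>k<K. \<integral>w. (residual (iterate (samples w) k))\<^sup>2 \<partial>P)"
  have b: "n < nat red" if "2 * (1 - \<alpha>) / L < s * \<beta> ^ n" for n
  proof -
    have "(1 / \<beta>) ^ n < s * L / (2 * (1 - \<alpha>))"
      using that \<beta> \<alpha> L_pos by (simp add: field_simps)
    then have "real n < log (1 / \<beta>) (s * L / (2 * (1 - \<alpha>)))"
      using \<beta> by (intro less_log_of_power) auto
    then show ?thesis
      unfolding red_def by linarith
  qed
  have "0 \<le> red"
    unfolding red_def by linarith
  have "0 \<le> log 2 ((l0 + K) / l0)"
    using l0 by simp
  then have "0 \<le> cyc"
    unfolding cyc_def by linarith
  have "card {k. k < K \<and> cycle_start p k} \<le> nat cyc"
    unfolding p cyc_def by (rule card_doubling_cycle_starts_le[OF l0])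
  then have "real (card {k. k < K \<and> cycle_start p k} * nat red) \<le> real (nat cyc * nat red)"
    by (intro of_nat_mono mult_le_mono1)
  also have "\<dots> = red * cyc"
    using \<open>0 \<le> red\<close> \<open>0 \<le> cyc\<close> by simp
  finally have count: "real (card {k. k < K \<and> cycle_start p k} * nat red) \<le> red * cyc" .
  have square: "(L\<^sub>r + B\<^sub>g)\<^sup>2 \<le> (L\<^sub>r + 3 * B\<^sub>g)\<^sup>2"
    using L\<^sub>r_nonneg norm_g_le[OF x0] norm_ge_zero[of "g x0"] by (intro power_mono) linarith+
  have "\<alpha> * c / 2 * E \<le> gap + (1 / (2 * L) + 3 * L * s\<^sup>2 + \<alpha> * c) * \<sigma>\<^sup>2 * (\<Sum>k<K. 1 / real (N k))
      + 3 * L * (s - c)\<^sup>2 * (L\<^sub>r + B\<^sub>g)\<^sup>2 * (card {k. k < K \<and> cycle_start p k} * nat red)"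
    unfolding E_def gap_def using sum_expected_square_residual_le[OF inf b, of K] by simp
  also have "\<dots> \<le> gap + (1 / (2 * L) + 3 * L * s\<^sup>2 + \<alpha> * c) * \<sigma>\<^sup>2 * (ln K + 1)
      + 3 * L * (s - c)\<^sup>2 * (L\<^sub>r + 3 * B\<^sub>g)\<^sup>2 * (red * cyc)"
  proof (intro add_mono mult_left_mono mult_mono order_refl square count)
    show "(\<Sum>k<K. 1 / real (N k)) \<le> ln K + 1"
      unfolding N by (rule sum_inverse_le_ln[OF K])
  qed (use L_pos \<alpha> c_pos in auto)
  finally have main: "\<alpha> * c / 2 * E \<le> gap + (1 / (2 * L) + 3 * L * s\<^sup>2 + \<alpha> * c) * \<sigma>\<^sup>2 * (ln K + 1)
      + 3 * L * (s - c)\<^sup>2 * (L\<^sub>r + 3 * B\<^sub>g)\<^sup>2 * (red * cyc)" .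
  have pos: "0 < \<alpha> * c * K"
    using \<alpha> c_pos K by simp
  have "(\<integral>w. (residual (iterate (samples w) (R w)))\<^sup>2 \<partial>P) = 2 / (\<alpha> * c * K) * (\<alpha> * c / 2 * E)"
    using \<alpha> c_pos expected_square_output_residual[OF R K] by (simp add: E_def)
  also have "\<dots> \<le> 2 / (\<alpha> * c * K) * (gap + (1 / (2 * L) + 3 * L * s\<^sup>2 + \<alpha> * c) * \<sigma>\<^sup>2 * (ln K + 1)
      + 3 * L * (s - c)\<^sup>2 * (L\<^sub>r + 3 * B\<^sub>g)\<^sup>2 * (red * cyc))"
    using pos by (intro mult_left_mono main) simp
  also have "\<dots> = 2 * gap / (\<alpha> * c * K)
      + (2 * (1 / (2 * L) + 3 * L * s\<^sup>2 + \<alpha> * c)) * \<sigma>\<^sup>2 * (ln K + 1) / (\<alpha> * c * K)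
      + 6 * L * (s - c)\<^sup>2 * (L\<^sub>r + 3 * B\<^sub>g)\<^sup>2 * red * cyc / (\<alpha> * c * K)"
  proof -
    have "2 / d * (a + v * w * l + 3 * L * S * B * m) = 2 * a / d + 2 * v * w * l / d + 6 * L * S * B * red * cyc / d"
      if "m = real_of_int red * real_of_int cyc" for d a v w l S B m :: real
      using that by (simp add: distrib_left add_divide_distrib)
    then show ?thesis
      by (simp only: of_int_mult)
  qed
  also have "2 * (1 / (2 * L) + 3 * L * s\<^sup>2 + \<alpha> * c) = 1 / L + 6 * L * s\<^sup>2 + 2 * \<alpha> * c"
    by simp
  finally show ?thesis
    by (simp only: red_def cyc_def gap_def)
qed

end

section \<open>The complexity bounds\<close>

text \<open>
  The samples are described by their common law \<open>D\<close>. The exact gradient inherits the Lipschitz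
  constant of the sampled gradients, being their mean.
\<close>

lemma slam_samplingI:
  fixes r f :: "'a::euclidean_space \<Rightarrow> ereal" and F :: "'a \<Rightarrow> 'd \<Rightarrow> real"
  assumes M: "prob_space M" and \<xi>: "\<xi> \<in> measurable M S" and S: "space S = \<Xi>"
    and F: "\<And>y. F y \<in> borel_measurable S"
    and reg: "regular_problem r L\<^sub>r f B\<^sub>g" and smooth: "smooth_samples r f F \<Xi> L"
    and unbiased: "unbiased_bounded_variance r f F M \<xi> \<sigma>"
    and x0: "x0 \<in> edom r" and \<alpha>: "\<alpha> \<in> {0<..<1}" and \<beta>: "\<beta> \<in> {0<..<1}" and s: "0 < s"
    and N: "\<And>k. 0 < N k" and P: "prob_space P" and iid: "iid_copies M \<xi> S N P X"
  shows "slam_sampling r L\<^sub>r (\<lambda>y. real_of_ereal (f y)) (grad (\<lambda>y. real_of_ereal (f y))) B\<^sub>g F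
    (distr M S \<xi>) L N \<alpha> \<beta> s x0 P X \<sigma>"
proof -
  define fr where "fr = (\<lambda>y. real_of_ereal (f y))"
  define D where "D = distr M S \<xi>"
  have D: "prob_space D"
    unfolding D_def by (rule prob_space.prob_space_distr[OF M \<xi>])
  interpret D: prob_space D
    by (rule D)
  have space_D: "space D = \<Xi>" and sets_D: "sets D = sets S"
    by (simp_all add: D_def S)
  interpret convex_regularizer r L\<^sub>r
    using reg by unfold_locales (auto simp: regular_problem_def)
  have dom: "edom r \<subseteq> interior (edom f)"
    using reg by (simp add: regular_problem_def)
  have deriv_f: "GDERIV fr x :> grad fr x" if "x \<in> edom r" for x
    using reg dom that by (intro GDERIV_grad) (auto simp: regular_problem_def C1_on_def fr_def)
  have deriv_F: "GDERIV (\<lambda>y. F y z) x :> grad (\<lambda>y. F y z) x" if "z \<in> \<Xi>" "x \<in> edom r" for x z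
    using smooth dom that by (intro GDERIV_grad) (auto simp: smooth_samples_def C1_on_def)
  have lip_F: "L-lipschitz_on (edom r) (grad (\<lambda>y. F y z))" if "z \<in> \<Xi>" for z
    using smooth that by (simp add: smooth_samples_def)
  have L: "0 < L"
    using smooth by (simp add: smooth_samples_def)
  have F_D: "F y \<in> borel_measurable D" for y
    using F by (simp add: D_def)
  have grad_D: "(\<lambda>z. grad (\<lambda>y. F y z) x) \<in> borel_measurable D" if "x \<in> edom r" for x
    using deriv_F that by (intro borel_measurable_grad F_D) (simp add: space_D)
  note grad_S = grad_D[unfolded measurable_cong_sets[OF sets_D refl]]
  have moments: "integrable D (F x)" "(\<integral>z. F x z \<partial>D) = fr x"
      "integrable D (\<lambda>z. grad (\<lambda>y. F y z) x)" "(\<integral>z. grad (\<lambda>y. F y z) x \<partial>D) = grad fr x"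
      "integrable D (\<lambda>z. (norm (grad (\<lambda>y. F y z) x - grad fr x))\<^sup>2)"
      "(\<integral>z. (norm (grad (\<lambda>y. F y z) x - grad fr x))\<^sup>2 \<partial>D) \<le> \<sigma>\<^sup>2" if x: "x \<in> edom r" for x
  proof -
    note [measurable] = grad_S[OF x]
    have sq: "(\<lambda>z. (norm (grad (\<lambda>y. F y z) x - grad fr x))\<^sup>2) \<in> borel_measurable S"
      by measurable
    have *: "integrable M (\<lambda>w. F x (\<xi> w))" "ereal (\<integral>w. F x (\<xi> w) \<partial>M) = f x"
      "integrable M (\<lambda>w. grad (\<lambda>y. F y (\<xi> w)) x)" "(\<integral>w. grad (\<lambda>y. F y (\<xi> w)) x \<partial>M) = grad fr x"
      "integrable M (\<lambda>w. (norm (grad (\<lambda>y. F y (\<xi> w)) x - grad fr x))\<^sup>2)"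
      "(\<integral>w. (norm (grad (\<lambda>y. F y (\<xi> w)) x - grad fr x))\<^sup>2 \<partial>M) \<le> \<sigma>\<^sup>2"
      using unbiased x by (auto simp: unbiased_bounded_variance_def Let_def fr_def)
    show "integrable D (F x)" "integrable D (\<lambda>z. grad (\<lambda>y. F y z) x)"
      "integrable D (\<lambda>z. (norm (grad (\<lambda>y. F y z) x - grad fr x))\<^sup>2)"
      unfolding D_def using * by (simp_all add: integrable_distr_eq[OF \<xi>] F grad_S[OF x] sq)
    show "(\<integral>z. F x z \<partial>D) = fr x"
      unfolding D_def integral_distr[OF \<xi> F] fr_def *(2)[symmetric] by simp
    show "(\<integral>z. grad (\<lambda>y. F y z) x \<partial>D) = grad fr x"
      unfolding D_def integral_distr[OF \<xi> grad_S[OF x]] by (rule *(4))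
    show "(\<integral>z. (norm (grad (\<lambda>y. F y z) x - grad fr x))\<^sup>2 \<partial>D) \<le> \<sigma>\<^sup>2"
      unfolding D_def integral_distr[OF \<xi> sq] by (rule *(6))
  qed
  have lip_f: "L-lipschitz_on (edom r) (grad fr)"
  proof (rule lipschitz_onI)
    fix x y assume xy: "x \<in> edom r" "y \<in> edom r"
    have "norm (grad fr x - grad fr y) = norm (\<integral>z. grad (\<lambda>u. F u z) x - grad (\<lambda>u. F u z) y \<partial>D)"
      using moments(3,4)[OF xy(1)] moments(3,4)[OF xy(2)] by simp
    also have "\<dots> \<le> (\<integral>z. norm (grad (\<lambda>u. F u z) x - grad (\<lambda>u. F u z) y) \<partial>D)"
      by (rule integral_norm_bound)
    also have "\<dots> \<le> (\<integral>z. L * norm (x - y) \<partial>D)"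
      using lipschitz_onD[OF lip_F xy] moments(3)[OF xy(1)] moments(3)[OF xy(2)]
      by (intro integral_mono) (auto simp: dist_norm space_D)
    finally show "dist (grad fr x) (grad fr y) \<le> L * dist x y"
      by (simp add: dist_norm D.prob_space)
  qed (use L in simp)
  have g_le: "norm (grad fr x) \<le> B\<^sub>g" if "x \<in> edom r" for x
    using reg that by (simp add: regular_problem_def fr_def)
  have slam_method: "slam_method r L\<^sub>r fr (grad fr) B\<^sub>g F (space D) L N \<alpha> \<beta> s x0"
    using deriv_f g_le lip_f deriv_F lip_F L N \<alpha> \<beta> s x0
    by unfold_locales (auto simp: space_D)
  interpret P: prob_space P
    by (rule P)
  have indep: "P.indep_vars (\<lambda>_. D) (\<lambda>(k, i). X k i) (sample_index N)"
    using iid unfolding iid_copies_def P.indep_vars_def2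
    by (simp add: sets_D measurable_cong_sets[OF refl sets_D])
  have distr: "distr P D (X k i) = D" if "i \<in> {1..N k}" for k i
  proof -
    have "distr P D (X k i) = distr P S (X k i)"
      by (rule distr_cong) (simp_all add: sets_D)
    also have "\<dots> = D"
      using iid that by (auto simp: iid_copies_def sample_index_def D_def)
    finally show ?thesis .
  qed
  have "slam_sampling_axioms r fr (grad fr) F D N P X \<sigma>"
    using D F_D moments indep distr by unfold_locales
  then show ?thesis
    unfolding fr_def[symmetric] D_def[symmetric]
    by (intro slam_sampling.intro slam_method P)
qed

theorem corollary1:
  fixes r :: "real ^ 'n \<Rightarrow> ereal" and f :: "real ^ 'n \<Rightarrow> ereal"
    and F :: "real ^ 'n \<Rightarrow> real ^ 'd \<Rightarrow> real" and \<Xi> :: "(real ^ 'd) set"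
    and M :: "'w measure" and \<xi> :: "'w \<Rightarrow> real ^ 'd"
    and P :: "'p measure" and X :: "nat \<Rightarrow> nat \<Rightarrow> 'p \<Rightarrow> real ^ 'd" and R :: "nat \<Rightarrow> 'p \<Rightarrow> nat"
    and x0 :: "real ^ 'n" and L\<^sub>r B\<^sub>g L \<sigma> \<alpha> \<beta> s :: real and l0 :: nat
  defines "S \<equiv> restrict_space borel \<Xi>"
    and "N \<equiv> (\<lambda>k. k + 1)"
    and "p \<equiv> (\<lambda>j. 2 ^ j * l0)"
    and "g \<equiv> grad (\<lambda>y. real_of_ereal (f y))"
    and "\<phi> \<equiv> (\<lambda>y. f y + r y)"
  defines "x \<equiv> (\<lambda>k w. slam r F N p \<alpha> \<beta> s x0 (\<lambda>j i. X j i w) k)"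
    and "gap \<equiv> real_of_ereal (\<phi> x0) - real_of_ereal (INF y\<in>edom r. \<phi> y)"
    and "c \<equiv> min s (2 * (1 - \<alpha>) * \<beta> / L)"
  defines "res \<equiv> (\<lambda>K w. norm (prox_residual r g s (x (R K w) w)))"
    and "rhs1 \<equiv> (\<lambda>K::nat.
        2 * gap / (\<alpha> * c * K)
        + (1 / L + 6 * L * s\<^sup>2 + 2 * \<alpha> * c) * \<sigma>\<^sup>2 * (ln K + 1) / (\<alpha> * c * K)
        + 6 * L * (s - c)\<^sup>2 * (L\<^sub>r + 3 * B\<^sub>g)\<^sup>2
            * real_of_int \<lceil>max (log (1 / \<beta>) (s * L / (2 * (1 - \<alpha>)))) 0 + 2\<rceil>
            * real_of_int \<lceil>log 2 ((l0 + K) / l0)\<rceil> / (\<alpha> * c * K))"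
    and "\<Phi> \<equiv> gap / c + (1 / (L * c) + 6 * L * s\<^sup>2 / c + 2) * \<sigma>\<^sup>2
              + 6 * L * (s - c)\<^sup>2 * (L\<^sub>r + B\<^sub>g)\<^sup>2 / c * max (ln (s * L)) 0"
    and "rhs2 \<equiv> (\<lambda>\<zeta> (K::nat).
        L * gap / ((1 - \<alpha>) * \<beta> * \<zeta> * \<alpha> * K)
        + (1 / (2 * \<alpha> * (1 - \<alpha>) * \<beta> * \<zeta>) + 12 * (1 - \<alpha>) * \<beta> * \<zeta> / \<alpha> + 2)
            * \<sigma>\<^sup>2 * (ln K + 1) / K)"
    and "\<Phi>\<^sub>2 \<equiv> L * gap + \<sigma>\<^sup>2"
  assumes "prob_space M" and "\<xi> \<in> measurable M S"
    and "\<And>y. F y \<in> borel_measurable S"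
    and "f = mean_fun M \<xi> F"
    and "regular_problem r L\<^sub>r f B\<^sub>g"
    and "smooth_samples r f F \<Xi> L"
    and "unbiased_bounded_variance r f F M \<xi> \<sigma>"
    and "x0 \<in> edom r" and "\<alpha> \<in> {0<..<1}" and "\<beta> \<in> {0<..<1}" and "0 < s" and "0 < l0"
    and "prob_space P" and "iid_copies M \<xi> S N P X"
    and "\<And>K. 1 \<le> K \<Longrightarrow> uniform_index S N P X K (R K)"
  shows
    "(\<forall>K\<ge>1. integrable P (\<lambda>w. (res K w)\<^sup>2) \<and> (\<integral>w. (res K w)\<^sup>2 \<partial>P) \<le> rhs1 K)
     \<and> rhs1 \<in> O(\<lambda>K. \<Phi> * ln K / K)
     \<and> (let e = (\<lambda>K. \<integral>w. res K w \<partial>P) in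
          (\<forall>\<epsilon>>0. \<exists>K\<ge>1. e K \<le> \<epsilon>)
          \<and> (\<lambda>\<epsilon>. real (iteration_complexity e \<epsilon>))
               \<in> O[at_right 0](\<lambda>\<epsilon>. ln (\<Phi> / \<epsilon>\<^sup>2) * (\<Phi> / \<epsilon>\<^sup>2))
          \<and> (\<lambda>\<epsilon>. real (sample_complexity N e \<epsilon>))
               \<in> O[at_right 0](\<lambda>\<epsilon>. (ln (\<Phi> / \<epsilon>\<^sup>2))\<^sup>2 * (\<Phi>\<^sup>2 / \<epsilon> ^ 4)))
     \<and> (\<forall>\<zeta>. 0 < \<zeta> \<and> \<zeta> \<le> 1 \<and> s = 2 * (1 - \<alpha>) * \<beta> * \<zeta> / L \<longrightarrow>
          (\<forall>K\<ge>1. (\<integral>w. (res K w)\<^sup>2 \<partial>P) \<le> rhs2 \<zeta> K)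
          \<and> rhs2 \<zeta> \<in> O(\<lambda>K. \<Phi>\<^sub>2 * ln K / K))"
proof -
  note regular = \<open>regular_problem r L\<^sub>r f B\<^sub>g\<close>
    and unbiased = \<open>unbiased_bounded_variance r f F M \<xi> \<sigma>\<close>
    and uniform_index = \<open>\<And>K. 1 \<le> K \<Longrightarrow> uniform_index S N P X K (R K)\<close>
  define fr where "fr = (\<lambda>y. real_of_ereal (f y))"
  define D where "D = distr M S \<xi>"
  have space_S: "space S = \<Xi>"
    by (simp add: S_def space_restrict_space)
  have g: "g = grad fr"
    by (simp add: g_def fr_def)
  interpret slam: slam_sampling r L\<^sub>r fr g B\<^sub>g F D L N p \<alpha> \<beta> s x0 P X \<sigma>
    unfolding g fr_def D_def
  proof (rule slam_samplingI[OF _ _ space_S])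
    show "0 < N k" for k
      by (simp add: N_def)
  qed fact+
  have c: "slam.c = c"
    by (simp add: c_def slam.c_def)
  have res: "res K w = slam.residual (slam.iterate (slam.samples w) (R K w))" for K w
    by (simp add: res_def x_def slam.residual_def slam.samples_def)
  have "sets D = sets S"
    by (simp add: D_def)
  then have "sets (Pi\<^sub>M (sample_index N) (\<lambda>_. D)) = sets (Pi\<^sub>M (sample_index N) (\<lambda>_. S))"
    by (intro sets_PiM_cong) auto
  then have R: "uniform_index D N P X K (R K)" if "1 \<le> K" for K
    using uniform_index[OF that] by (simp add: uniform_index_def sets_vimage_algebra)

  define \<phi>inf where "\<phi>inf = real_of_ereal (INF y\<in>edom r. \<phi> y)"
  have \<phi>_eq: "\<phi> y = ereal (fr y + real_of_ereal (r y))" if y: "y \<in> edom r" for y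
  proof -
    have "f y = ereal (\<integral>w. F y (\<xi> w) \<partial>M)"
      using unbiased y by (auto simp: unbiased_bounded_variance_def Let_def)
    then have "f y = ereal (fr y)"
      by (simp add: fr_def)
    then show ?thesis
      using slam.r_eq[OF y] unfolding \<phi>_def by (metis plus_ereal.simps(1))
  qed
  \<comment> \<open>The infimum is finite, so that \<open>real_of_ereal\<close> does not return its default value 0.\<close>
  have inf: "\<phi>inf \<le> fr y + real_of_ereal (r y)" if y: "y \<in> edom r" for y
  proof -
    obtain b where b: "\<And>y. y \<in> edom r \<Longrightarrow> ereal b \<le> \<phi> y"
      using regular by (auto simp: regular_problem_def \<phi>_def)
    have "ereal b \<le> (INF y\<in>edom r. \<phi> y)"
      by (intro INF_greatest b)
    moreover have le: "(INF y\<in>edom r. \<phi> y) \<le> ereal (fr y + real_of_ereal (r y))"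
      using INF_lower[OF y, of \<phi>] \<phi>_eq[OF y] by simp
    ultimately have "(INF y\<in>edom r. \<phi> y) = ereal \<phi>inf"
      unfolding \<phi>inf_def by (cases "INF y\<in>edom r. \<phi> y") auto
    then show ?thesis
      using le by simp
  qed
  have gap: "gap = fr x0 + real_of_ereal (r x0) - \<phi>inf"
    unfolding gap_def \<phi>inf_def[symmetric] \<phi>_eq[OF \<open>x0 \<in> edom r\<close>] by simp
  have gap_nonneg: "0 \<le> gap"
    using inf[OF \<open>x0 \<in> edom r\<close>] by (simp add: gap)
  have \<sigma>: "0 < \<sigma>"
    using unbiased by (simp add: unbiased_bounded_variance_def)

  have bound: "(\<integral>w. (res K w)\<^sup>2 \<partial>P) \<le> rhs1 K" if "1 \<le> K" for K
    using slam.expected_square_output_residual_le[OF N_def[THEN meta_eq_to_obj_eq] p_def[THEN meta_eq_to_obj_eq] \<open>0 < l0\<close> inf R[OF that] that]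
    by (simp add: res c rhs1_def gap)
  have int: "integrable P (\<lambda>w. (res K w)\<^sup>2)" "integrable P (res K)" if "1 \<le> K" for K
    using slam.integrable_square_output_residual[OF R[OF that] that] slam.integrable_output_residual[OF R[OF that] that]
    by (simp_all add: res[abs_def])

  \<comment> \<open>Collecting the dependence on \<open>K\<close>, the right-hand side is a constant plus multiples of \<open>ln K + 1\<close>
    and of the number of cycles, all divided by \<open>K\<close>. The number of cycles is at most
    \<open>2 (ln K + 1)\<close>, whence the factor 2 in \<open>A\<close>.\<close>
  have c_pos': "0 < c"
    using slam.c_pos by (simp add: c)
  define a1 where "a1 = 2 * gap / (\<alpha> * c)"
  define a2 where "a2 = (1 / L + 6 * L * s\<^sup>2 + 2 * \<alpha> * c) * \<sigma>\<^sup>2 / (\<alpha> * c)"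
  define a3 where "a3 = 6 * L * (s - c)\<^sup>2 * (L\<^sub>r + 3 * B\<^sub>g)\<^sup>2
      * real_of_int \<lceil>max (log (1 / \<beta>) (s * L / (2 * (1 - \<alpha>)))) 0 + 2\<rceil> / (\<alpha> * c)"
  define A where "A = a1 + a2 + 2 * a3"
  have "0 \<le> real_of_int \<lceil>max (log (1 / \<beta>) (s * L / (2 * (1 - \<alpha>)))) 0 + 2\<rceil>"
    by linarith
  then have a: "0 \<le> a1" "0 < a2" "0 \<le> a3"
    using gap_nonneg slam.L_pos slam.\<alpha> c_pos' \<sigma>
    by (auto simp: a1_def a2_def a3_def intro!: divide_nonneg_pos divide_pos_pos mult_pos_pos add_pos_pos add_pos_nonneg)
  then have A: "0 < A"
    by (simp add: A_def)
  have rhs1_eq: "rhs1 K = (a1 + a2 * (ln K + 1) + a3 * real_of_int \<lceil>log 2 ((l0 + K) / l0)\<rceil>) / K" for K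
    by (simp add: rhs1_def a1_def a2_def a3_def add_divide_distrib)
  have ln_nonneg: "0 \<le> ln (real K)" if "1 \<le> K" for K
    using that by simp
  have rhs1_nonneg: "0 \<le> rhs1 K" if "1 \<le> K" for K
  proof -
    have "0 \<le> log 2 ((l0 + K) / l0)"
      using \<open>0 < l0\<close> by simp
    then have "0 \<le> real_of_int \<lceil>log 2 ((l0 + K) / l0)\<rceil>"
      by linarith
    then show ?thesis
      unfolding rhs1_eq using a ln_nonneg[OF that]
      by (intro divide_nonneg_nonneg add_nonneg_nonneg mult_nonneg_nonneg) auto
  qed
  have rhs1_le: "rhs1 K \<le> A * (ln K + 1) / K" if "1 \<le> K" for K
  proof -
    have "a1 * 1 \<le> a1 * (ln K + 1)"
      using a ln_nonneg[OF that] by (intro mult_left_mono) auto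
    moreover have "a3 * real_of_int \<lceil>log 2 ((l0 + K) / l0)\<rceil> \<le> a3 * (2 * (ln K + 1))"
      using a log_cycle_count_le[OF \<open>0 < l0\<close> that] by (intro mult_left_mono)
    ultimately have "a1 + a2 * (ln K + 1) + a3 * real_of_int \<lceil>log 2 ((l0 + K) / l0)\<rceil> \<le> A * (ln K + 1)"
      by (simp add: A_def algebra_simps)
    then show ?thesis
      unfolding rhs1_eq by (intro divide_right_mono) auto
  qed
  have \<Phi>_pos: "0 < \<Phi>"
    unfolding \<Phi>_def using gap_nonneg slam.L_pos c_pos' \<sigma>
    by (intro add_pos_nonneg add_nonneg_pos mult_pos_pos mult_nonneg_nonneg divide_nonneg_pos) auto

  let ?e = "\<lambda>K. \<integral>w. res K w \<partial>P"
  have e: "(?e K)\<^sup>2 \<le> A * (ln K + 1) / K" if "1 \<le> K" for K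
    using slam.square_expectation_le[OF int(2,1)[OF that]] bound[OF that] rhs1_le[OF that] by linarith

  have part2: "(\<forall>K\<ge>1. (\<integral>w. (res K w)\<^sup>2 \<partial>P) \<le> rhs2 \<zeta> K) \<and> rhs2 \<zeta> \<in> O(\<lambda>K. \<Phi>\<^sub>2 * ln K / K)"
    if \<zeta>: "0 < \<zeta>" "\<zeta> \<le> 1" and s_eq: "s = 2 * (1 - \<alpha>) * \<beta> * \<zeta> / L" for \<zeta>
  proof -
    have "2 * (1 - \<alpha>) * \<beta> * \<zeta> / L \<le> 2 * (1 - \<alpha>) * \<beta> * 1 / L"
      using slam.\<alpha> slam.\<beta> \<zeta> slam.L_pos by (intro divide_right_mono mult_left_mono) auto
    then have cs: "c = s"
      by (simp add: c_def s_eq)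
    have nz: "1 - \<alpha> \<noteq> 0" "\<beta> \<noteq> 0" "\<zeta> \<noteq> 0" "\<alpha> \<noteq> 0" "L \<noteq> 0"
      using slam.\<alpha> slam.\<beta> \<zeta> slam.L_pos by auto
    have a1: "a1 = L * gap / ((1 - \<alpha>) * \<beta> * \<zeta> * \<alpha>)"
      unfolding a1_def cs s_eq using nz by (simp add: divide_simps)
    have "a2 = (1 / (L * \<alpha> * s) + 6 * L * s / \<alpha> + 2) * \<sigma>\<^sup>2"
      unfolding a2_def cs using nz slam.s_pos by (simp add: field_simps power2_eq_square)
    also have "1 / (L * \<alpha> * s) = 1 / (2 * \<alpha> * (1 - \<alpha>) * \<beta> * \<zeta>)"
      unfolding s_eq using nz by simp
    also have "6 * L * s / \<alpha> = 12 * (1 - \<alpha>) * \<beta> * \<zeta> / \<alpha>"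
      unfolding s_eq using nz by simp
    finally have a2: "a2 = (1 / (2 * \<alpha> * (1 - \<alpha>) * \<beta> * \<zeta>) + 12 * (1 - \<alpha>) * \<beta> * \<zeta> / \<alpha> + 2) * \<sigma>\<^sup>2" .
    have a3: "a3 = 0"
      by (simp add: a3_def cs)
    have rhs2_eq: "rhs2 \<zeta> K = rhs1 K" for K
      unfolding rhs1_eq rhs2_def a1 a2 a3 by (simp add: add_divide_distrib)
    have \<Phi>\<^sub>2_pos: "0 < \<Phi>\<^sub>2"
      unfolding \<Phi>\<^sub>2_def using gap_nonneg slam.L_pos \<sigma> by (intro add_nonneg_pos) auto
    have "rhs1 \<in> O(\<lambda>K. \<Phi>\<^sub>2 * ln K / K)"
      by (rule ln_add_one_over_in_bigo[OF rhs1_nonneg rhs1_le \<Phi>\<^sub>2_pos])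
    then show ?thesis
      using bound by (simp add: rhs2_eq[abs_def])
  qed
  show ?thesis
    unfolding Let_def
  proof (intro conjI allI impI)
    show "rhs1 \<in> O(\<lambda>K. \<Phi> * ln K / K)"
      by (rule ln_add_one_over_in_bigo[OF rhs1_nonneg rhs1_le \<Phi>_pos])
    show "\<exists>K\<ge>1. ?e K \<le> \<epsilon>" if "0 < \<epsilon>" for \<epsilon>
      by (rule accuracy_reached[OF e A \<Phi>_pos that])
    show "(\<lambda>\<epsilon>. real (iteration_complexity ?e \<epsilon>)) \<in> O[at_right 0](\<lambda>\<epsilon>. ln (\<Phi> / \<epsilon>\<^sup>2) * (\<Phi> / \<epsilon>\<^sup>2))"
      by (rule iteration_complexity_in_bigo[OF e A \<Phi>_pos])
    show "(\<lambda>\<epsilon>. real (sample_complexity N ?e \<epsilon>))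
        \<in> O[at_right 0](\<lambda>\<epsilon>. (ln (\<Phi> / \<epsilon>\<^sup>2))\<^sup>2 * (\<Phi>\<^sup>2 / \<epsilon> ^ 4))"
      unfolding N_def by (rule sample_complexity_in_bigo[OF e A \<Phi>_pos])
  qed (use int bound part2 in auto)
qed

end
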